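(* Every structure $M$ in a finite language, of any cardinality, has an elementary extension $M\prec\overline{M}$ to a pseudo-countable structure $\overline{M}$.
   Context: Work in ZFC with universe $V$. For a complete Boolean algebra $\mathbb{B}$, $V^{\mathbb{B}}$ is the class of $\mathbb{B}$-names with the usual Boolean values $[\![\varphi]\!]\in\mathbb{B}$. For an ultrafilter $U\subseteq\mathbb{B}$ with $U\in V$ (not necessarily generic), the Boolean quotient $V^{\mathbb{B}}/U$ is the class model whose elements are the classes $[\sigma]_U$ of names modulo $\sigma=_U\tau \iff [\![\sigma=\tau]\!]\in U$, with membership $[\sigma]_U\,\overline{\in}\,[\tau]_U\iff[\![\sigma\in\tau]\!]\in U$; it is a definable class in $V$ and satisfies $\varphi$ iff $[\![\varphi]\!]\in U$. A structure $M$ is pseudo-countable if it is isomorphic to a structure that is countable inside some Boolean quotient $V^{\mathbb{B}}/U$, where $\mathbb{B}=\mathrm{Coll}(\omega,\kappa)$ is the (complete Boolean algebra of the) forcing to collapse some cardinal $\kappa$ to be countable and $U$ is an ultrafilter on $\mathbb{B}$ in $V$. *)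

theory Defs
  imports "HOL-Algebra.Complete_Lattice" "HOL-Library.Multiset"
begin

section \<open>The universe of sets\<close>

text \<open>
  A type of this class is a universe \<open>V\<close> of ZFC sets, \<open>elts x\<close> being the set of elements of \<open>x\<close>.
  Separation and Replacement range over arbitrary HOL predicates and functions, so the
  HOL sets of elements of \<open>V\<close> play the role of classes; such a class is a set of \<open>V\<close> iff it lies in
  \<open>range elts\<close>. The axiom of choice is inherited from HOL.
\<close>

class zfc_universe =
  fixes elts :: "'a \<Rightarrow> 'a set"
  assumes extensionality: "elts x = elts y \<Longrightarrow> x = y"
    and foundation: "wf {(x, y). x \<in> elts y}"
    and pairing: "{x, y} \<in> range elts"
    and union: "(\<Union>y\<in>elts x. elts y) \<in> range elts"
    and powerset: "{y. elts y \<subseteq> elts x} \<in> range elts"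
    and separation: "{y \<in> elts x. P y} \<in> range elts"
    and replacement: "f ` elts x \<in> range elts"
    and infinity: "\<exists>w. (\<exists>z\<in>elts w. elts z = {}) \<and>
                       (\<forall>x\<in>elts w. \<exists>y\<in>elts w. elts y = insert x (elts x))"

abbreviation is_set :: "'v::zfc_universe set \<Rightarrow> bool" where
  "is_set A \<equiv> A \<in> range elts"

definition mkset :: "'v::zfc_universe set \<Rightarrow> 'v" where
  "mkset A = (THE x. elts x = A)"

definition vpair :: "'v::zfc_universe \<Rightarrow> 'v \<Rightarrow> 'v" where
  "vpair x y = mkset {mkset {x}, mkset {x, y}}"

primrec vnat :: "nat \<Rightarrow> 'v::zfc_universe" where
  "vnat 0 = mkset {}"
| "vnat (Suc n) = mkset (insert (vnat n) (elts (vnat n)))"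

definition transitive_set :: "'v::zfc_universe \<Rightarrow> bool" where
  "transitive_set x \<longleftrightarrow> (\<forall>y\<in>elts x. elts y \<subseteq> elts x)"

definition ordinal :: "'v::zfc_universe \<Rightarrow> bool" where
  "ordinal \<alpha> \<longleftrightarrow> transitive_set \<alpha> \<and> (\<forall>\<beta>\<in>elts \<alpha>. transitive_set \<beta>)"

definition cardinal :: "'v::zfc_universe \<Rightarrow> bool" where
  "cardinal \<kappa> \<longleftrightarrow> ordinal \<kappa> \<and> (\<forall>\<beta>\<in>elts \<kappa>. \<nexists>f. bij_betw f (elts \<beta>) (elts \<kappa>))"

lemma elts_mkset: "is_set A \<Longrightarrow> elts (mkset A) = A"
proof -
  assume "is_set A"
  then obtain x where x: "elts x = A" by auto
  have "(THE x. elts x = A) = x"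
    using x by (intro the_equality) (auto intro: extensionality)
  with x show ?thesis by (simp add: mkset_def)
qed

lemma elts_vpair: "elts (vpair x y) = {mkset {x}, mkset {x, y}}"
  by (simp add: vpair_def elts_mkset pairing)

lemma elts_mkset_pair: "elts (mkset {x, y}) = {x, y}"
  by (simp add: elts_mkset pairing)

lemma elts_mkset_singleton: "elts (mkset {x}) = {x}"
  using elts_mkset_pair[of x x] by simp

lemma vpair_inject [simp]: "vpair x y = vpair x' y' \<longleftrightarrow> x = x' \<and> y = y'"
proof
  assume "vpair x y = vpair x' y'"
  then have "{mkset {x}, mkset {x, y}} = {mkset {x'}, mkset {x', y'}}"
    by (metis elts_vpair)
  then have "elts ` {mkset {x}, mkset {x, y}} = elts ` {mkset {x'}, mkset {x', y'}}"
    by simp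
  then have "{{x}, {x, y}} = {{x'}, {x', y'}}"
    by (simp add: elts_mkset_pair elts_mkset_singleton)
  then show "x = x' \<and> y = y'"
    by (auto simp: doubleton_eq_iff)
qed auto

lemma mem_trancl_vpair:
  assumes "vpair \<rho> b \<in> elts \<sigma>"
  shows "(\<rho>, \<sigma>) \<in> {(x, y). x \<in> elts y}\<^sup>+"
proof -
  have "\<rho> \<in> elts (mkset {\<rho>})" "mkset {\<rho>} \<in> elts (vpair \<rho> b)"
    by (simp_all add: elts_vpair elts_mkset_singleton)
  then have "(\<rho>, vpair \<rho> b) \<in> {(x, y). x \<in> elts y}\<^sup>+"
    by (meson CollectI case_prodI r_into_trancl trancl_into_trancl)
  with assms show ?thesis
    by (meson CollectI case_prodI trancl_into_trancl)
qed


section \<open>Complete Boolean algebras and the collapse forcing\<close>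

definition bcompl :: "('a, 'm) gorder_scheme \<Rightarrow> 'a \<Rightarrow> 'a" where
  "bcompl B a = (THE c. c \<in> carrier B \<and> a \<sqinter>\<^bsub>B\<^esub> c = \<bottom>\<^bsub>B\<^esub> \<and> a \<squnion>\<^bsub>B\<^esub> c = \<top>\<^bsub>B\<^esub>)"

definition bimp :: "('a, 'm) gorder_scheme \<Rightarrow> 'a \<Rightarrow> 'a \<Rightarrow> 'a" where
  "bimp B a b = bcompl B a \<squnion>\<^bsub>B\<^esub> b"

locale complete_boolean_algebra_on = complete_lattice B for B (structure) +
  assumes distrib: "\<lbrakk>a \<in> carrier B; b \<in> carrier B; c \<in> carrier B\<rbrakk>
      \<Longrightarrow> a \<sqinter> (b \<squnion> c) = (a \<sqinter> b) \<squnion> (a \<sqinter> c)"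
    and complemented: "a \<in> carrier B
      \<Longrightarrow> \<exists>!c. c \<in> carrier B \<and> a \<sqinter> c = \<bottom> \<and> a \<squnion> c = \<top>"

definition ultrafilter_on :: "('a, 'm) gorder_scheme \<Rightarrow> 'a set \<Rightarrow> bool" where
  "ultrafilter_on B U \<longleftrightarrow>
     U \<subseteq> carrier B \<and> \<top>\<^bsub>B\<^esub> \<in> U \<and> \<bottom>\<^bsub>B\<^esub> \<notin> U \<and>
     (\<forall>a\<in>U. \<forall>b\<in>carrier B. a \<sqsubseteq>\<^bsub>B\<^esub> b \<longrightarrow> b \<in> U) \<and>
     (\<forall>a\<in>U. \<forall>b\<in>U. a \<sqinter>\<^bsub>B\<^esub> b \<in> U) \<and>
     (\<forall>a\<in>carrier B. a \<in> U \<or> bcompl B a \<in> U)"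

definition regular_open :: "'p set \<Rightarrow> ('p \<Rightarrow> 'p \<Rightarrow> bool) \<Rightarrow> 'p set \<Rightarrow> bool" where
  "regular_open P stronger A \<longleftrightarrow>
     A \<subseteq> P \<and>
     (\<forall>p\<in>A. \<forall>q\<in>P. stronger q p \<longrightarrow> q \<in> A) \<and>
     (\<forall>p\<in>P. (\<forall>q\<in>P. stronger q p \<longrightarrow> (\<exists>r\<in>A. stronger r q)) \<longrightarrow> p \<in> A)"

definition regular_open_algebra ::
    "'v::zfc_universe set \<Rightarrow> ('v \<Rightarrow> 'v \<Rightarrow> bool) \<Rightarrow> 'v gorder" where
  "regular_open_algebra P stronger =
     \<lparr> carrier = {a. regular_open P stronger (elts a)},
       eq = (=),
       le = (\<lambda>a b. elts a \<subseteq> elts b) \<rparr>"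

definition collapse_conditions :: "'v::zfc_universe \<Rightarrow> 'v set" where
  "collapse_conditions \<kappa> =
     {p. finite (elts p) \<and>
         (\<forall>z\<in>elts p. \<exists>n. \<exists>\<alpha>\<in>elts \<kappa>. z = vpair (vnat n) \<alpha>) \<and>
         (\<forall>x \<alpha> \<beta>. vpair x \<alpha> \<in> elts p \<longrightarrow> vpair x \<beta> \<in> elts p \<longrightarrow> \<alpha> = \<beta>)}"

text \<open>The Boolean completion of \<open>Coll(\<omega>, \<kappa>)\<close>: a condition is stronger if it is a larger function.\<close>

definition collapse_algebra :: "'v::zfc_universe \<Rightarrow> 'v gorder" where
  "collapse_algebra \<kappa> =
     regular_open_algebra (collapse_conditions \<kappa>) (\<lambda>q p. elts p \<subseteq> elts q)"

lemma is_set_subset: 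
  assumes "is_set A" "C \<subseteq> A" shows "is_set C"
proof -
  from assms(1) obtain x where x: "A = elts x" by (rule imageE)
  have e: "{y\<in>elts x. y \<in> C} = C" using assms(2) unfolding x by blast
  have "is_set {y\<in>elts x. y \<in> C}" by (rule separation)
  then show ?thesis by (rule back_subst[where P=is_set, OF _ e])
qed

lemma is_set_image: "is_set A \<Longrightarrow> is_set ((f :: 'v \<Rightarrow> 'v::zfc_universe) ` A)"
  by (erule imageE) (simp only: replacement)

lemma is_set_UN: fixes f :: "'v::zfc_universe \<Rightarrow> 'v set" assumes "is_set A" "\<And>x. x \<in> A \<Longrightarrow> is_set (f x)" shows "is_set (\<Union>x\<in>A. f x)"
proof -
  have "is_set ((\<lambda>x. mkset (f x)) ` A)" using assms(1) by (rule is_set_image)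
  then obtain z where z: "elts z = (\<lambda>x. mkset (f x)) ` A" by (metis imageE)
  have "(\<Union>y\<in>elts z. elts y) = (\<Union>x\<in>A. f x)"
    using assms(2) by (simp add: z elts_mkset)
  then show ?thesis using union[of z] by simp
qed

lemma is_set_vnat: "is_set (range (vnat :: nat \<Rightarrow> 'v::zfc_universe))"
proof -
  obtain w z where w: "z\<in>elts w" "elts (z::'v) = {}"
      "\<forall>x\<in>elts w. \<exists>y\<in>elts w. elts y = insert x (elts x)" using infinity by blast
  have "vnat n \<in> elts w" for n
  proof (induction n)
    case 0
    have "mkset {} = z" using w(2) by (metis elts_mkset extensionality rangeI)
    then show ?case using w by simp
  next
    case (Suc n)
    then obtain y where "y\<in>elts w" "elts y = insert (vnat n) (elts (vnat n))" using w by blast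
    then show ?case by (metis elts_mkset extensionality rangeI vnat.simps(2))
  qed
  then have "range vnat \<subseteq> elts w" by blast
  then show ?thesis by (rule is_set_subset[OF rangeI])
qed

lemma is_set_collapse_conditions: "is_set (collapse_conditions \<kappa>)"
proof -
  have "is_set (\<Union>x\<in>range vnat. (\<lambda>\<alpha>. vpair x \<alpha>) ` elts \<kappa>)"
    by (rule is_set_UN[OF is_set_vnat]) (rule replacement)
  then obtain X where X: "elts X = (\<Union>x\<in>range vnat. (\<lambda>\<alpha>. vpair x \<alpha>) ` elts \<kappa>)" by (metis imageE)
  have "collapse_conditions \<kappa> \<subseteq> {y. elts y \<subseteq> elts X}"
    unfolding X collapse_conditions_def by blast
  then show ?thesis by (rule is_set_subset[OF powerset])
qed

definition reg :: "'p set \<Rightarrow> ('p \<Rightarrow> 'p \<Rightarrow> bool) \<Rightarrow> 'p set \<Rightarrow> 'p set" where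
  "reg P st A = {p\<in>P. \<forall>q\<in>P. st q p \<longrightarrow> (\<exists>r\<in>A. st r q)}"

locale regular_open_poset =
  fixes P :: "'v::zfc_universe set" and st
  assumes small: "is_set P"
    and refl: "\<And>p. p \<in> P \<Longrightarrow> st p p"
    and trans: "\<And>p q r. st p q \<Longrightarrow> st q r \<Longrightarrow> st p r"
begin

abbreviation "B \<equiv> regular_open_algebra P st"
abbreviation "ro \<equiv> regular_open P st"

lemma ro_reg: "A \<subseteq> P \<Longrightarrow> ro (reg P st A)"
proof -
  assume A: "A \<subseteq> P"
  have d: "q \<in> reg P st A" if "p \<in> reg P st A" "q \<in> P" "st q p" for p q
    using that trans unfolding reg_def by blast
  have "p \<in> reg P st A" if p: "p \<in> P" "\<forall>q\<in>P. st q p \<longrightarrow> (\<exists>r\<in>reg P st A. st r q)" for p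
    unfolding reg_def
  proof (intro CollectI conjI ballI impI p(1))
    fix q assume "q \<in> P" "st q p"
    then obtain r where r: "r \<in> reg P st A" "st r q" using p(2) by blast
    then have "r \<in> P" by (simp add: reg_def)
    then obtain s where "s \<in> A" "st s r" using r(1) refl unfolding reg_def by blast
    then show "\<exists>r\<in>A. st r q" using trans r(2) by blast
  qed
  moreover have "reg P st A \<subseteq> P" by (auto simp: reg_def)
  ultimately show ?thesis using d unfolding regular_open_def by meson
qed

lemma reg_sub: "ro A \<Longrightarrow> A \<subseteq> reg P st A"
  unfolding regular_open_def reg_def using refl by blast

lemma reg_least: "ro A \<Longrightarrow> C \<subseteq> A \<Longrightarrow> reg P st C \<subseteq> A"
  unfolding regular_open_def reg_def by blast

lemma sub_reg: "(\<And>p. p\<in>A \<Longrightarrow> p\<in>P \<and> (\<forall>q\<in>P. st q p \<longrightarrow> q \<in> A)) \<Longrightarrow> A \<subseteq> reg P st A"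
  unfolding reg_def using refl by blast

lemma ro_Int: "ro A \<Longrightarrow> ro C \<Longrightarrow> ro (A \<inter> C)"
  unfolding regular_open_def by (intro conjI) (blast, blast, meson Int_iff)

lemma ro_INT: "S \<noteq> {} \<Longrightarrow> (\<And>A. A\<in>S \<Longrightarrow> ro A) \<Longrightarrow> ro (\<Inter>S)"
  unfolding regular_open_def by (intro conjI) (blast, blast, meson Inter_iff)

lemma roD: "ro A \<Longrightarrow> A \<subseteq> P" by (simp add: regular_open_def)

lemma ro_empty: "ro {}" unfolding regular_open_def using refl by blast
lemma ro_P: "ro P" unfolding regular_open_def by blast

lemma elts_mk: "ro A \<Longrightarrow> elts (mkset A) = A"
  by (rule elts_mkset, rule is_set_subset[OF small]) (rule roD)

lemma car: "x \<in> carrier B \<longleftrightarrow> ro (elts x)" by (simp add: regular_open_algebra_def)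
lemma le: "le B x y \<longleftrightarrow> elts x \<subseteq> elts y" by (simp add: regular_open_algebra_def)
lemma eqq: "eq B = (=)" by (simp add: regular_open_algebra_def)

sublocale po: partial_order B
proof unfold_locales
  fix x y z w
  show "eq B x x" by (simp add: eqq)
  show "eq B x y \<Longrightarrow> eq B y x" by (simp add: eqq)
  show "eq B x y \<Longrightarrow> eq B y z \<Longrightarrow> eq B x z" by (simp add: eqq)
  show "le B x x" by (simp add: le)
  show "eq B x y" if "le B x y" "le B y x"
    using extensionality[of x y] that unfolding eqq le by (rule_tac extensionality) (rule subset_antisym)
  show "le B x z" if "le B x y" "le B y z" using that unfolding le by (rule subset_trans)
  show "le B x z = le B y w" if "eq B x y" "eq B z w" using that by (simp add: eqq)
  show "eq B = (=)" by (rule eqq)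
qed

sublocale cl: complete_lattice B
proof (rule po.complete_lattice_criterion1)
  show "\<exists>g. greatest B g (carrier B)"
    by (rule exI[of _ "mkset P"]) (simp add: greatest_def car le elts_mk ro_P Collect_mono roD)
next
  fix A assume A: "A \<subseteq> carrier B" "A \<noteq> {}"
  have r: "ro (\<Inter> (elts ` A))" using A by (intro ro_INT) (auto simp: car)
  show "\<exists>i. greatest B i (Lower B A)"
  proof (rule exI[of _ "mkset (\<Inter> (elts ` A))"], unfold greatest_def, intro conjI ballI)
    show "Lower B A \<subseteq> carrier B" by simp
    show "mkset (\<Inter> (elts ` A)) \<in> Lower B A"
      unfolding Lower_def by (simp add: car le elts_mk[OF r] r INF_lower)
    fix x assume "x \<in> Lower B A"
    then have "\<forall>y\<in>A. elts x \<subseteq> elts y" using A(1) unfolding Lower_def le by blast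
    then show "le B x (mkset (\<Inter> (elts ` A)))" unfolding le elts_mk[OF r] by blast
  qed
qed

lemma meet: "ro (elts a) \<Longrightarrow> ro (elts b) \<Longrightarrow> elts (meet B a b) = elts a \<inter> elts b"
proof -
  assume a: "ro (elts a)" "ro (elts b)"
  have "greatest B (mkset (elts a \<inter> elts b)) (Lower B {a,b})"
    using a by (simp add: greatest_def Lower_def car le elts_mk ro_Int; blast)
  then have "meet B a b = mkset (elts a \<inter> elts b)"
    unfolding meet_def inf_def by (metis (no_types, lifting) po.greatest_unique someI_ex)
  then show ?thesis using a by (simp add: elts_mk ro_Int)
qed

lemma join: "ro (elts a) \<Longrightarrow> ro (elts b) \<Longrightarrow> elts (join B a b) = reg P st (elts a \<union> elts b)"
proof -
  assume a: "ro (elts a)" "ro (elts b)"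
  have r: "ro (reg P st (elts a \<union> elts b))" using a by (intro ro_reg) (simp add: roD)
  have s: "elts a \<union> elts b \<subseteq> reg P st (elts a \<union> elts b)"
    using a unfolding regular_open_def by (intro sub_reg) blast
  have "least B (mkset (reg P st (elts a \<union> elts b))) (Upper B {a,b})"
    using a r s reg_least[of _ "elts a \<union> elts b"]
    by (simp add: least_def Upper_def car le elts_mk)
  then have "join B a b = mkset (reg P st (elts a \<union> elts b))"
    unfolding join_def sup_def by (metis (no_types, lifting) po.least_unique someI_ex)
  then show ?thesis using r by (simp add: elts_mk)
qed

lemma bot: "elts (bottom B) = {}"
proof -
  have "least B (mkset {}) (carrier B)" by (auto simp: least_def car le elts_mk ro_empty)
  then show ?thesis unfolding bottom_def
    by (metis (no_types, lifting) po.least_unique someI_ex elts_mk ro_empty)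
qed

lemma top: "elts (top B) = P"
proof -
  have "greatest B (mkset P) (carrier B)" 
    by (simp add: greatest_def car le elts_mk ro_P Collect_mono roD)
  then show ?thesis unfolding top_def
    by (metis (no_types, lifting) po.greatest_unique someI_ex elts_mk ro_P)
qed

lemma ro_compl: assumes "ro A" shows "ro {p\<in>P. \<forall>q\<in>P. st q p \<longrightarrow> q \<notin> A}"
proof -
  let ?C = "{p\<in>P. \<forall>q\<in>P. st q p \<longrightarrow> q \<notin> A}"
  have "q \<in> ?C" if "p\<in>?C" "q\<in>P" "st q p" for p q using that trans by blast
  moreover have "p \<in> ?C" if p: "p\<in>P" "\<forall>q\<in>P. st q p \<longrightarrow> (\<exists>r\<in>?C. st r q)" for p
  proof (intro CollectI conjI ballI impI p(1) notI)
    fix q assume q: "q \<in> P" "st q p" "q \<in> A"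
    then obtain r where r: "r \<in> ?C" "st r q" using p(2) by blast
    then have "r \<in> A" using q assms unfolding regular_open_def by blast
    then show False using r refl by blast
  qed
  ultimately show ?thesis unfolding regular_open_def by blast
qed

sublocale complete_boolean_algebra_on B
proof (unfold_locales, goal_cases)
  case (1 a b c)
  then have r: "ro (elts a)" "ro (elts b)" "ro (elts c)" by (auto simp: car)
  have j: "join B b c \<in> carrier B" "meet B a b \<in> carrier B" "meet B a c \<in> carrier B"
    using 1 by auto
  have "elts a \<inter> reg P st (elts b \<union> elts c) = reg P st (elts a \<inter> elts b \<union> elts a \<inter> elts c)"
  proof (intro equalityI subsetI)
    fix p assume p: "p \<in> elts a \<inter> reg P st (elts b \<union> elts c)"
    then have "p \<in> P" by (simp add: reg_def)
    moreover have "\<exists>s\<in>elts a \<inter> elts b \<union> elts a \<inter> elts c. st s q" if q: "q \<in> P" "st q p" for q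
    proof -
      obtain s where s: "s \<in> elts b \<union> elts c" "st s q" using p q unfolding reg_def by blast
      then have "s \<in> P" using r unfolding regular_open_def by blast
      then have "s \<in> elts a" using p r(1) trans[OF s(2) q(2)] unfolding regular_open_def by blast
      then show ?thesis using s by blast
    qed
    ultimately show "p \<in> reg P st (elts a \<inter> elts b \<union> elts a \<inter> elts c)" by (simp add: reg_def)
  next
    fix p assume p: "p \<in> reg P st (elts a \<inter> elts b \<union> elts a \<inter> elts c)"
    have "p \<in> reg P st (elts a)" "p \<in> reg P st (elts b \<union> elts c)" using p unfolding reg_def by blast+
    then show "p \<in> elts a \<inter> reg P st (elts b \<union> elts c)" using reg_least[OF r(1) subset_refl] by blast
  qed
  then show ?case using r j by (intro extensionality) (simp add: car meet join)
next
  case (2 a)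
  then have r: "ro (elts a)" by (auto simp: car)
  let ?c = "{p\<in>P. \<forall>q\<in>P. st q p \<longrightarrow> q \<notin> elts a}"
  have rc: "ro ?c" by (rule ro_compl[OF r])
  show ?case
  proof (rule ex1I[of _ "mkset ?c"])
    have 1: "elts a \<inter> ?c = {}" using refl by blast
    have 2: "reg P st (elts a \<union> ?c) = P" 
    proof -
      have "\<exists>s\<in>elts a \<union> ?c. st s q" if "q \<in> P" for q
      proof (cases "\<exists>s\<in>elts a. st s q")
        case False
        then have "q \<in> ?c" using that by blast
        then show ?thesis using refl that by blast
      qed blast
      then show ?thesis unfolding reg_def by blast
    qed
    show "mkset ?c \<in> carrier B \<and> meet B a (mkset ?c) = bottom B \<and> join B a (mkset ?c) = top B"
    proof (intro conjI)
      have rc': "ro (elts (mkset ?c))" by (simp add: elts_mk[OF rc] rc)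
      show "mkset ?c \<in> carrier B" using rc' by (simp only: car)
      show "meet B a (mkset ?c) = bottom B"
        by (rule extensionality) (simp only: meet[OF r rc'] elts_mk[OF rc] bot 1)
      show "join B a (mkset ?c) = top B"
        by (rule extensionality) (simp only: join[OF r rc'] elts_mk[OF rc] top 2)
    qed
  next
    fix c assume "c \<in> carrier B \<and> meet B a c = bottom B \<and> join B a c = top B"
    then have c: "ro (elts c)" "elts a \<inter> elts c = {}" "reg P st (elts a \<union> elts c) = P"
      using r meet[of a c] join[of a c] by (simp_all add: car bot top)
    have "elts c = ?c"
    proof (intro equalityI subsetI)
      fix p assume "p \<in> elts c"
      then show "p \<in> ?c" using c unfolding regular_open_def by blast
    next
      fix p assume p: "p \<in> ?c"
      have "\<exists>s\<in>elts c. st s q" if q: "q \<in> P" "st q p" for q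
      proof -
        obtain s where s: "s \<in> elts a \<union> elts c" "st s q" using c(3) q refl unfolding reg_def by blast
        then have "s \<in> P" using r c unfolding regular_open_def by blast
        then have "s \<notin> elts a" using p trans[OF s(2) q(2)] by blast
        then show ?thesis using s by blast
      qed
      then show "p \<in> elts c" using p c(1) unfolding regular_open_def by blast
    qed
    then show "c = mkset ?c" using rc by (intro extensionality) (simp only: elts_mk)
  qed
qed
end

lemma collapse_algebra_complete: "complete_boolean_algebra_on (collapse_algebra \<kappa>)"
proof -
  interpret regular_open_poset "collapse_conditions \<kappa>" "\<lambda>q p. elts p \<subseteq> elts q"
    by unfold_locales (auto simp: is_set_collapse_conditions)
  show ?thesis unfolding collapse_algebra_def by unfold_locales
qed


section \<open>Names, Boolean values and the Boolean quotient\<close>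

inductive name :: "('v::zfc_universe, 'm) gorder_scheme \<Rightarrow> 'v \<Rightarrow> bool" for B where
  "(\<And>z. z \<in> elts \<tau> \<Longrightarrow> \<exists>\<pi> b. z = vpair \<pi> b \<and> name B \<pi> \<and> b \<in> carrier B) \<Longrightarrow> name B \<tau>"

definition entries :: "'v::zfc_universe \<Rightarrow> ('v \<times> 'v) set" where
  "entries \<tau> = {(\<pi>, b). vpair \<pi> b \<in> elts \<tau>}"

function bval_mem :: "('v::zfc_universe, 'm) gorder_scheme \<Rightarrow> 'v \<Rightarrow> 'v \<Rightarrow> 'v"
  and bval_eq :: "('v::zfc_universe, 'm) gorder_scheme \<Rightarrow> 'v \<Rightarrow> 'v \<Rightarrow> 'v" where
  "bval_mem B \<sigma> \<tau> = \<Squnion>\<^bsub>B\<^esub> ((\<lambda>(\<pi>, b). b \<sqinter>\<^bsub>B\<^esub> bval_eq B \<sigma> \<pi>) ` entries \<tau>)"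
| "bval_eq B \<sigma> \<tau> =
     \<Sqinter>\<^bsub>B\<^esub> ((\<lambda>(\<pi>, b). bimp B b (bval_mem B \<pi> \<tau>)) ` entries \<sigma>) \<sqinter>\<^bsub>B\<^esub>
     \<Sqinter>\<^bsub>B\<^esub> ((\<lambda>(\<pi>, b). bimp B b (bval_mem B \<pi> \<sigma>)) ` entries \<tau>)"
  by pat_completeness auto
termination
proof (relation "inv_image (mult1 ({(x, y). x \<in> elts y}\<^sup>+))
    (\<lambda>x. case x of Inl (B, \<sigma>, \<tau>) \<Rightarrow> {#\<sigma>, \<tau>#} | Inr (B, \<sigma>, \<tau>) \<Rightarrow> {#\<sigma>, \<tau>#})", goal_cases)
  case 1
  show ?case by (intro wf_inv_image wf_mult1 wf_trancl foundation)
next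
  case (2 B \<sigma> \<tau> z \<pi> b)
  then have "(\<pi>, \<tau>) \<in> {(x, y). x \<in> elts y}\<^sup>+"
    by (auto simp: entries_def intro: mem_trancl_vpair)
  then show ?case
    by (auto intro!: mult1I[of _ \<tau> "{#\<sigma>#}" _ "{#\<pi>#}"])
next
  case (3 B \<sigma> \<tau> z \<pi> b)
  then have "(\<pi>, \<sigma>) \<in> {(x, y). x \<in> elts y}\<^sup>+"
    by (auto simp: entries_def intro: mem_trancl_vpair)
  then show ?case
    by (auto intro!: mult1I[of _ \<sigma> "{#\<tau>#}" _ "{#\<pi>#}"])
next
  case (4 B \<sigma> \<tau> z \<pi> b)
  then have "(\<pi>, \<tau>) \<in> {(x, y). x \<in> elts y}\<^sup>+"
    by (auto simp: entries_def intro: mem_trancl_vpair)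
  then show ?case
    by (auto intro!: mult1I[of _ \<tau> "{#\<sigma>#}" _ "{#\<pi>#}"])
qed

declare bval_mem.simps [simp del] bval_eq.simps [simp del]

definition name_class :: "('v::zfc_universe, 'm) gorder_scheme \<Rightarrow> 'v set \<Rightarrow> 'v \<Rightarrow> 'v set" where
  "name_class B U \<sigma> = {\<tau>. name B \<tau> \<and> bval_eq B \<sigma> \<tau> \<in> U}"

definition quotient_universe :: "('v::zfc_universe, 'm) gorder_scheme \<Rightarrow> 'v set \<Rightarrow> 'v set set" where
  "quotient_universe B U = name_class B U ` Collect (name B)"

definition quotient_mem ::
    "('v::zfc_universe, 'm) gorder_scheme \<Rightarrow> 'v set \<Rightarrow> 'v set \<Rightarrow> 'v set \<Rightarrow> bool" where
  "quotient_mem B U X Y \<longleftrightarrow>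
     (\<exists>\<sigma> \<tau>. name B \<sigma> \<and> name B \<tau> \<and> X = name_class B U \<sigma> \<and> Y = name_class B U \<tau> \<and>
            bval_mem B \<sigma> \<tau> \<in> U)"


section \<open>First-order structures in a finite language\<close>

text \<open>
  A finite language is given by the list of arities of its function symbols (constants being
  nullary) and the list of arities of its relation symbols; the symbols are the list positions.
\<close>

record language =
  fun_arities :: "nat list"
  rel_arities :: "nat list"

record 'a struct =
  domain :: "'a set"
  Fun :: "nat \<Rightarrow> 'a list \<Rightarrow> 'a"
  Rel :: "nat \<Rightarrow> 'a list \<Rightarrow> bool"

definition tuples :: "'a set \<Rightarrow> nat \<Rightarrow> 'a list set" where
  "tuples A n = {xs. set xs \<subseteq> A \<and> length xs = n}"

definition is_structure :: "language \<Rightarrow> 'a struct \<Rightarrow> bool" where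
  "is_structure L M \<longleftrightarrow>
     domain M \<noteq> {} \<and>
     (\<forall>i < length (fun_arities L). \<forall>xs \<in> tuples (domain M) (fun_arities L ! i).
        Fun M i xs \<in> domain M)"

datatype tm = Var nat | App nat "tm list"

datatype fm =
    Eq tm tm
  | Atom nat "tm list"
  | Neg fm
  | Conj fm fm
  | Exists nat fm

fun wf_tm :: "language \<Rightarrow> tm \<Rightarrow> bool" where
  "wf_tm L (Var n) \<longleftrightarrow> True"
| "wf_tm L (App i ts) \<longleftrightarrow>
     i < length (fun_arities L) \<and> length ts = fun_arities L ! i \<and> (\<forall>t\<in>set ts. wf_tm L t)"

fun wf_fm :: "language \<Rightarrow> fm \<Rightarrow> bool" where
  "wf_fm L (Eq s t) \<longleftrightarrow> wf_tm L s \<and> wf_tm L t"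
| "wf_fm L (Atom i ts) \<longleftrightarrow>
     i < length (rel_arities L) \<and> length ts = rel_arities L ! i \<and> (\<forall>t\<in>set ts. wf_tm L t)"
| "wf_fm L (Neg \<phi>) \<longleftrightarrow> wf_fm L \<phi>"
| "wf_fm L (Conj \<phi> \<psi>) \<longleftrightarrow> wf_fm L \<phi> \<and> wf_fm L \<psi>"
| "wf_fm L (Exists n \<phi>) \<longleftrightarrow> wf_fm L \<phi>"

fun tm_val :: "'a struct \<Rightarrow> (nat \<Rightarrow> 'a) \<Rightarrow> tm \<Rightarrow> 'a" where
  "tm_val M e (Var n) = e n"
| "tm_val M e (App i ts) = Fun M i (map (tm_val M e) ts)"

fun sat :: "'a struct \<Rightarrow> (nat \<Rightarrow> 'a) \<Rightarrow> fm \<Rightarrow> bool" where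
  "sat M e (Eq s t) \<longleftrightarrow> tm_val M e s = tm_val M e t"
| "sat M e (Atom i ts) \<longleftrightarrow> Rel M i (map (tm_val M e) ts)"
| "sat M e (Neg \<phi>) \<longleftrightarrow> \<not> sat M e \<phi>"
| "sat M e (Conj \<phi> \<psi>) \<longleftrightarrow> sat M e \<phi> \<and> sat M e \<psi>"
| "sat M e (Exists n \<phi>) \<longleftrightarrow> (\<exists>a\<in>domain M. sat M (e(n := a)) \<phi>)"

definition substructure :: "language \<Rightarrow> 'a struct \<Rightarrow> 'a struct \<Rightarrow> bool" where
  "substructure L M N \<longleftrightarrow>
     domain M \<subseteq> domain N \<and>
     (\<forall>i < length (fun_arities L). \<forall>xs \<in> tuples (domain M) (fun_arities L ! i).
        Fun M i xs = Fun N i xs) \<and>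
     (\<forall>i < length (rel_arities L). \<forall>xs \<in> tuples (domain M) (rel_arities L ! i).
        Rel M i xs = Rel N i xs)"

definition elementary_extension :: "language \<Rightarrow> 'a struct \<Rightarrow> 'a struct \<Rightarrow> bool" where
  "elementary_extension L M N \<longleftrightarrow>
     substructure L M N \<and>
     (\<forall>\<phi> e. wf_fm L \<phi> \<longrightarrow> range e \<subseteq> domain M \<longrightarrow> (sat M e \<phi> \<longleftrightarrow> sat N e \<phi>))"

definition isomorphic :: "language \<Rightarrow> 'a struct \<Rightarrow> 'b struct \<Rightarrow> bool" where
  "isomorphic L M N \<longleftrightarrow>
     (\<exists>h. bij_betw h (domain M) (domain N) \<and>
        (\<forall>i < length (fun_arities L). \<forall>xs \<in> tuples (domain M) (fun_arities L ! i).
           h (Fun M i xs) = Fun N i (map h xs)) \<and>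
        (\<forall>i < length (rel_arities L). \<forall>xs \<in> tuples (domain M) (rel_arities L ! i).
           Rel M i xs \<longleftrightarrow> Rel N i (map h xs)))"


section \<open>Countable structures inside a model of set theory\<close>

text \<open>
  The predicates below spell out satisfaction, in the model with universe \<open>W\<close> and membership
  relation \<open>E\<close>, of the corresponding formulas of set theory: all set quantifiers are relativized
  to \<open>W\<close>. In particular \<open>omega\<close> is whatever the model takes to be the set of natural numbers, and
  countability is witnessed by a function of the model. Quantification over lists only occurs for
  lists of a fixed standard length and stands for a block of first-order quantifiers.
\<close>

locale class_model =
  fixes W :: "'w set" and E :: "'w \<Rightarrow> 'w \<Rightarrow> bool"
begin

definition members :: "'w \<Rightarrow> 'w set" where
  "members x = {y \<in> W. E y x}"

definition is_empty :: "'w \<Rightarrow> bool" where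
  "is_empty x \<longleftrightarrow> (\<forall>y\<in>W. \<not> E y x)"

definition is_successor :: "'w \<Rightarrow> 'w \<Rightarrow> bool" where
  "is_successor x y \<longleftrightarrow> (\<forall>z\<in>W. E z y \<longleftrightarrow> E z x \<or> z = x)"

definition is_inductive :: "'w \<Rightarrow> bool" where
  "is_inductive w \<longleftrightarrow>
     (\<exists>z\<in>members w. is_empty z) \<and> (\<forall>x\<in>members w. \<exists>y\<in>members w. is_successor x y)"

definition is_omega :: "'w \<Rightarrow> bool" where
  "is_omega w \<longleftrightarrow>
     is_inductive w \<and> (\<forall>v\<in>W. is_inductive v \<longrightarrow> (\<forall>x\<in>W. E x w \<longrightarrow> E x v))"

definition is_upair :: "'w \<Rightarrow> 'w \<Rightarrow> 'w \<Rightarrow> bool" where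
  "is_upair x y u \<longleftrightarrow> (\<forall>z\<in>W. E z u \<longleftrightarrow> z = x \<or> z = y)"

definition is_pair :: "'w \<Rightarrow> 'w \<Rightarrow> 'w \<Rightarrow> bool" where
  "is_pair x y p \<longleftrightarrow> (\<exists>u\<in>W. \<exists>v\<in>W. is_upair x x u \<and> is_upair x y v \<and> is_upair u v p)"

text \<open>The tuple \<open>\<langle>x\<^sub>1, \<dots>, x\<^sub>n\<rangle>\<close> is coded as the iterated pair \<open>\<langle>x\<^sub>1, \<langle>x\<^sub>2, \<dots> \<langle>x\<^sub>n, \<emptyset>\<rangle> \<dots>\<rangle>\<rangle>\<close>.\<close>

primrec is_tuple :: "'w list \<Rightarrow> 'w \<Rightarrow> bool" where
  "is_tuple [] t \<longleftrightarrow> is_empty t"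
| "is_tuple (x # xs) t \<longleftrightarrow> (\<exists>s\<in>W. is_tuple xs s \<and> is_pair x s t)"

definition maps_to :: "'w \<Rightarrow> 'w \<Rightarrow> 'w \<Rightarrow> bool" where
  "maps_to f x y \<longleftrightarrow> (\<exists>p\<in>W. is_pair x y p \<and> E p f)"

definition is_injection :: "'w \<Rightarrow> 'w \<Rightarrow> 'w \<Rightarrow> bool" where
  "is_injection f A C \<longleftrightarrow>
     (\<forall>p\<in>members f. \<exists>x\<in>members A. \<exists>y\<in>members C. is_pair x y p) \<and>
     (\<forall>x\<in>members A. \<exists>!y. y \<in> members C \<and> maps_to f x y) \<and>
     (\<forall>x\<in>members A. \<forall>x'\<in>members A. \<forall>y\<in>members C.
        maps_to f x y \<longrightarrow> maps_to f x' y \<longrightarrow> x = x')"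

definition is_countable :: "'w \<Rightarrow> bool" where
  "is_countable A \<longleftrightarrow> (\<exists>w\<in>W. \<exists>f\<in>W. is_omega w \<and> is_injection f A w)"

definition is_relation :: "'w \<Rightarrow> nat \<Rightarrow> 'w \<Rightarrow> bool" where
  "is_relation A n R \<longleftrightarrow> (\<forall>t\<in>members R. \<exists>xs \<in> tuples (members A) n. is_tuple xs t)"

definition holds_at :: "'w \<Rightarrow> 'w list \<Rightarrow> bool" where
  "holds_at R xs \<longleftrightarrow> (\<exists>t\<in>W. is_tuple xs t \<and> E t R)"

definition value_at :: "'w \<Rightarrow> 'w list \<Rightarrow> 'w \<Rightarrow> bool" where
  "value_at F xs y \<longleftrightarrow> (\<exists>t\<in>W. is_tuple xs t \<and> maps_to F t y)"

definition is_operation :: "'w \<Rightarrow> nat \<Rightarrow> 'w \<Rightarrow> bool" where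
  "is_operation A n F \<longleftrightarrow>
     (\<forall>p\<in>members F. \<exists>xs \<in> tuples (members A) n. \<exists>y\<in>members A. \<exists>t\<in>W.
        is_tuple xs t \<and> is_pair t y p) \<and>
     (\<forall>xs \<in> tuples (members A) n. \<exists>!y. y \<in> members A \<and> value_at F xs y)"

text \<open>\<open>x\<close> is, in the model, the \<open>L\<close>-structure \<open>\<langle>D, F\<^sub>0, F\<^sub>1, \<dots>, R\<^sub>0, R\<^sub>1, \<dots>\<rangle>\<close> with domain \<open>D\<close>.\<close>

definition is_internal_structure ::
    "language \<Rightarrow> 'w \<Rightarrow> 'w \<Rightarrow> 'w list \<Rightarrow> 'w list \<Rightarrow> bool" where
  "is_internal_structure L x D Fs Rs \<longleftrightarrow>
     x \<in> W \<and> D \<in> W \<and> set Fs \<subseteq> W \<and> set Rs \<subseteq> W \<and>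
     is_tuple (D # Fs @ Rs) x \<and>
     \<not> is_empty D \<and>
     list_all2 (is_operation D) (fun_arities L) Fs \<and>
     list_all2 (is_relation D) (rel_arities L) Rs"

definition external_structure :: "'w \<Rightarrow> 'w list \<Rightarrow> 'w list \<Rightarrow> 'w struct" where
  "external_structure D Fs Rs =
     \<lparr> domain = members D,
       Fun = (\<lambda>i xs. THE y. y \<in> members D \<and> value_at (Fs ! i) xs y),
       Rel = (\<lambda>i xs. holds_at (Rs ! i) xs) \<rparr>"

end

text \<open>
  The ultrafilter is given by an element \<open>U\<close> of the universe, that is, \<open>U \<in> V\<close>; no genericity is
  required.
\<close>

definition pseudo_countable :: "language \<Rightarrow> 'v::zfc_universe struct \<Rightarrow> bool" where
  "pseudo_countable L N \<longleftrightarrow>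
     (\<exists>\<kappa> U x D Fs Rs.
        cardinal (\<kappa>::'v) \<and>
        (let B = collapse_algebra \<kappa>;
             W = quotient_universe B (elts U);
             E = quotient_mem B (elts U)
         in ultrafilter_on B (elts U) \<and>
            class_model.is_internal_structure W E L x D Fs Rs \<and>
            class_model.is_countable W E D \<and>
            isomorphic L N (class_model.external_structure W E D Fs Rs)))"

end

theory Submission
  imports Defs
begin

text \<open>
  Let \<open>\<kappa>\<close> be the cardinality of the domain \<open>D\<close> of \<open>M\<close>, let \<open>B\<close> be the completion of \<open>Coll(\<omega>, \<kappa>)\<close>
  with any ultrafilter \<open>U\<close>, and let \<open>j a\<close> be the class of the check name of \<open>a\<close>. An element of the
  quotient that belongs to some \<open>j X\<close> is locally a check name, so it amounts to a partial function
  from conditions to \<open>X\<close> that is constant below each condition of its domain. Hence the structure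
  that the quotient sees on \<open>j D\<close> is the Boolean ultrapower of \<open>M\<close>, and \<open>j\<close> embeds \<open>M\<close>
  elementarily into it by the theorem of Los. The generic surjection from \<open>\<omega>\<close> onto \<open>\<kappa>\<close> has a name,
  and from it one gets an element of the quotient that injects \<open>j D\<close> into \<open>j \<omega>\<close>, which is what the
  quotient takes for \<open>\<omega>\<close>.
\<close>

section \<open>Forcing relation of the regular open algebra\<close>

text \<open>Only atomic Boolean values are available and the ultrafilter need not be generic, so no
  truth lemma for the quotient as a model of set theory is at hand: every internal predicate (pair,
  tuple, omega, injection) is translated by hand into a statement about decided values. The uniform
  device is \<open>large Q\<close>: the regular open set generated by a predicate \<open>Q\<close>
  on conditions lies in \<open>U\<close>. Large predicates behave like a filter as long as one
  partner of a conjunction is persistent. Without genericity a member of \<open>j X\<close> need not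
  be any \<open>j a\<close>, and \<open>j vomega\<close> may have nonstandard members; existence in
  the quotient therefore comes from gluing local witnesses. The particular forcing matters only at
  the end: an element of the domain is sent to the first place where the generic function takes the
  corresponding ordinal, and the conditions deciding that place are dense. Finally, elements of the
  quotient are classes of names instead of sets, and the extension has to contain \<open>M\<close>
  literally; hence the coding and relocation.\<close>

context regular_open_poset
begin

section \<open>Lattice operations as operations on sets of conditions\<close>

lemma ro_down: "ro A \<Longrightarrow> p \<in> A \<Longrightarrow> q \<in> P \<Longrightarrow> st q p \<Longrightarrow> q \<in> A"
  unfolding regular_open_def by blast

lemma ro_dense: "ro A \<Longrightarrow> p \<in> P \<Longrightarrow> (\<And>q. q \<in> P \<Longrightarrow> st q p \<Longrightarrow> \<exists>r\<in>A. st r q) \<Longrightarrow> p \<in> A"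
  unfolding regular_open_def by blast

text \<open>A union of regular open sets is open but need not be regular; \<open>reg\<close> adds
  exactly the conditions below which the union is dense, and this gives the least regular open set
  containing it.\<close>

lemma Sup_elts:
  assumes "A \<subseteq> carrier B"
  shows "elts (\<Squnion>\<^bsub>B\<^esub> A) = reg P st (\<Union>a\<in>A. elts a)"
proof -
  let ?S = "reg P st (\<Union>a\<in>A. elts a)"
  have ro_mem: "ro (elts a)" if "a \<in> A" for a using assms that by (auto simp: car)
  have sub: "(\<Union>a\<in>A. elts a) \<subseteq> P" using ro_mem roD by blast
  then have r: "ro ?S" by (rule ro_reg)
  have "elts a \<subseteq> ?S" if "a \<in> A" for a
  proof -
    have "elts a \<subseteq> reg P st (elts a)" by (rule reg_sub[OF ro_mem[OF that]])
    also have "\<dots> \<subseteq> ?S" using that by (auto simp: reg_def) blast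
    finally show ?thesis .
  qed
  moreover have "?S \<subseteq> elts y" if "y \<in> Upper B A" for y
  proof (rule reg_least)
    show "ro (elts y)" using that by (simp add: Upper_def car)
    show "(\<Union>a\<in>A. elts a) \<subseteq> elts y" using that assms by (force simp: Upper_def le)
  qed
  ultimately have "least B (mkset ?S) (Upper B A)"
    using r assms by (auto simp: least_def Upper_def car le elts_mk)
  then have "\<Squnion>\<^bsub>B\<^esub> A = mkset ?S"
    unfolding sup_def by (metis (no_types, lifting) po.least_unique someI_ex)
  then show ?thesis using r by (simp add: elts_mk)
qed

text \<open>Intersections of regular open sets stay regular, so no regularization appears. The bound
  \<open>p \<in> P\<close> gives the empty infimum its value, the whole poset.\<close>

lemma Inf_elts:
  assumes "A \<subseteq> carrier B"
  shows "elts (\<Sqinter>\<^bsub>B\<^esub> A) = {p \<in> P. \<forall>a\<in>A. p \<in> elts a}"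
proof -
  let ?S = "{p \<in> P. \<forall>a\<in>A. p \<in> elts a}"
  have ro_mem: "ro (elts a)" if "a \<in> A" for a using assms that by (auto simp: car)
  have r: "ro ?S"
    unfolding regular_open_def
  proof (intro conjI ballI impI)
    fix p assume p: "p \<in> P" "\<forall>q\<in>P. st q p \<longrightarrow> (\<exists>r\<in>?S. st r q)"
    have "p \<in> elts a" if "a \<in> A" for a
      using p that by (intro ro_dense[OF ro_mem[OF that]]) blast+
    then show "p \<in> ?S" using p by blast
  qed (use ro_mem ro_down in blast)+
  have "greatest B (mkset ?S) (Lower B A)"
    unfolding greatest_def
  proof (intro conjI ballI)
    show "mkset ?S \<in> Lower B A" using r by (auto simp: Lower_def car le elts_mk)
    fix x assume x: "x \<in> Lower B A"
    then have "elts x \<subseteq> P" by (intro roD) (simp add: Lower_def car)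
    moreover have "elts x \<subseteq> elts a" if "a \<in> A" for a
      using x that assms by (auto simp: Lower_def le)
    ultimately show "x \<sqsubseteq>\<^bsub>B\<^esub> mkset ?S" using r by (auto simp: le elts_mk)
  qed simp
  then have "\<Sqinter>\<^bsub>B\<^esub> A = mkset ?S"
    unfolding inf_def by (metis (no_types, lifting) po.greatest_unique someI_ex)
  then show ?thesis using r by (simp add: elts_mk)
qed

lemma bcompl_props:
  assumes "a \<in> carrier B"
  shows "bcompl B a \<in> carrier B" "elts a \<inter> elts (bcompl B a) = {}"
    "reg P st (elts a \<union> elts (bcompl B a)) = P"
proof -
  have c: "bcompl B a \<in> carrier B \<and> meet B a (bcompl B a) = bottom B \<and> join B a (bcompl B a) = top B"
    unfolding bcompl_def by (rule theI'[OF complemented[OF assms]])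
  then show "bcompl B a \<in> carrier B" by blast
  with c assms show "elts a \<inter> elts (bcompl B a) = {}" "reg P st (elts a \<union> elts (bcompl B a)) = P"
    using meet[of a "bcompl B a"] join[of a "bcompl B a"] bot top by (auto simp: car)
qed

lemma elts_bcompl:
  assumes "a \<in> carrier B"
  shows "elts (bcompl B a) = {p \<in> P. \<forall>q\<in>P. st q p \<longrightarrow> q \<notin> elts a}"
proof (intro equalityI subsetI)
  note c = bcompl_props[OF assms]
  have r: "ro (elts a)" "ro (elts (bcompl B a))" using assms c(1) by (simp_all add: car)
  fix p
  show "p \<in> {p \<in> P. \<forall>q\<in>P. st q p \<longrightarrow> q \<notin> elts a}" if "p \<in> elts (bcompl B a)"
    using that r c(2) roD ro_down by blast
  assume p: "p \<in> {p \<in> P. \<forall>q\<in>P. st q p \<longrightarrow> q \<notin> elts a}"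
  show "p \<in> elts (bcompl B a)"
  proof (rule ro_dense[OF r(2)])
    \<comment> \<open>The union of \<open>a\<close> and its complement is dense, so some
      \<open>s\<close> below \<open>q\<close> lies in one of them, and the assumption on
      \<open>p\<close> excludes \<open>a\<close>.\<close>
    fix q assume q: "q \<in> P" "st q p"
    then obtain s where s: "s \<in> elts a \<union> elts (bcompl B a)" "st s q"
      using c(3) refl unfolding reg_def by blast
    then have "s \<notin> elts a" using p r(1) roD q(2) trans by blast
    then show "\<exists>s\<in>elts (bcompl B a). st s q" using s by blast
  qed (use p in blast)
qed

lemma bimp_carrier: "a \<in> carrier B \<Longrightarrow> b \<in> carrier B \<Longrightarrow> bimp B a b \<in> carrier B"
  unfolding bimp_def by (simp add: bcompl_props(1))

text \<open>This turns the algebraic implication into the forcing clause for implication. From right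
  to left, an extension of \<open>p\<close> either has a further extension in \<open>a\<close>,
  hence in \<open>b\<close>, or already lies in the complement of \<open>a\<close>; so the two
  joined sets are dense below \<open>p\<close>.\<close>

lemma mem_bimp:
  assumes "a \<in> carrier B" "b \<in> carrier B"
  shows "p \<in> elts (bimp B a b) \<longleftrightarrow> p \<in> P \<and> (\<forall>q\<in>P. st q p \<longrightarrow> q \<in> elts a \<longrightarrow> q \<in> elts b)"
proof -
  note c = bcompl_props[OF assms(1)]
  have r: "ro (elts a)" "ro (elts b)" "ro (elts (bcompl B a))" using assms c(1) by (simp_all add: car)
  have e: "elts (bimp B a b) = reg P st (elts (bcompl B a) \<union> elts b)"
    unfolding bimp_def by (rule join[OF r(3,2)])
  show ?thesis
  proof (intro iffI conjI ballI impI)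
    assume p: "p \<in> elts (bimp B a b)"
    then show "p \<in> P" by (simp add: e reg_def)
    fix q assume q: "q \<in> P" "st q p" "q \<in> elts a"
    show "q \<in> elts b"
    proof (rule ro_dense[OF r(2) q(1)])
      fix t assume t: "t \<in> P" "st t q"
      then obtain s where s: "s \<in> elts (bcompl B a) \<union> elts b" "st s t"
        using p trans[OF t(2) q(2)] by (auto simp: e reg_def)
      have "s \<in> P" using s r roD by blast
      then have "s \<in> elts a" using q(3) r(1) ro_down trans[OF s(2) t(2)] by blast
      then show "\<exists>s\<in>elts b. st s t" using s c(2) by blast
    qed
  next
    assume p: "p \<in> P \<and> (\<forall>q\<in>P. st q p \<longrightarrow> q \<in> elts a \<longrightarrow> q \<in> elts b)"
    show "p \<in> elts (bimp B a b)" unfolding e reg_def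
    proof (intro CollectI conjI ballI impI)
      show "p \<in> P" using p by blast
      fix q assume q: "q \<in> P" "st q p"
      show "\<exists>s\<in>elts (bcompl B a) \<union> elts b. st s q"
      proof (cases "\<exists>s\<in>elts a. st s q")
        case True
        then obtain s where s: "s \<in> elts a" "st s q" by blast
        then have "s \<in> elts b" using p roD[OF r(1)] q trans by blast
        then show ?thesis using s by blast
      next
        case False
        then have "q \<in> elts (bcompl B a)" using q by (auto simp: elts_bcompl[OF assms(1)])
        then show ?thesis using refl q by blast
      qed
    qed
  qed
qed

section \<open>Boolean values of names and the forcing relation\<close>

lemma name_entry:
  assumes "name B \<tau>" "(\<pi>, b) \<in> entries \<tau>"
  shows "name B \<pi>" "b \<in> carrier B"
proof -
  have "vpair \<pi> b \<in> elts \<tau>" using assms(2) by (simp add: entries_def)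
  then have "\<exists>\<pi>' b'. vpair \<pi> b = vpair \<pi>' b' \<and> name B \<pi>' \<and> b' \<in> carrier B"
    using assms(1) by (blast elim: name.cases)
  then show "name B \<pi>" "b \<in> carrier B" by simp_all
qed

text \<open>The induction rule of the mutual recursion treats the algebra as a variable, so the
  equations \<open>b = B\<close> and \<open>c = B\<close> hold it fixed. Being a name is what puts
  the coefficients of the entries into the carrier.\<close>

lemma bval_carrier_aux:
  "(name (b :: 'v gorder) \<sigma> \<longrightarrow> name b \<tau> \<longrightarrow> b = B \<longrightarrow> bval_mem b \<sigma> \<tau> \<in> carrier b)"
  "(name c \<sigma>' \<longrightarrow> name c \<tau>' \<longrightarrow> c = B \<longrightarrow> bval_eq (c :: 'v gorder) \<sigma>' \<tau>' \<in> carrier c)"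
proof (induction b \<sigma> \<tau> and c \<sigma>' \<tau>' rule: bval_mem_bval_eq.induct)
  case (1 b \<sigma> \<tau>)
  show ?case
  proof (intro impI)
    assume a: "name b \<sigma>" "name b \<tau>" "b = B"
    have "c \<sqinter>\<^bsub>B\<^esub> bval_eq B \<sigma> \<pi> \<in> carrier B" if "(\<pi>, c) \<in> entries \<tau>" for \<pi> c
      using 1[OF that HOL.refl] a name_entry[OF _ that] by (intro cl.meet_closed) simp_all
    then have "(\<lambda>(\<pi>, c). c \<sqinter>\<^bsub>B\<^esub> bval_eq B \<sigma> \<pi>) ` entries \<tau> \<subseteq> carrier B" by auto
    then show "bval_mem b \<sigma> \<tau> \<in> carrier b"
      using a(3) by (simp add: bval_mem.simps)
  qed
next
  case (2 b \<sigma> \<tau>)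
  show ?case
  proof (intro impI)
    assume a: "name b \<sigma>" "name b \<tau>" "b = B"
    have "bimp B c (bval_mem B \<pi> \<tau>) \<in> carrier B" if "(\<pi>, c) \<in> entries \<sigma>" for \<pi> c
      using 2(1)[OF that HOL.refl] a name_entry[OF _ that] by (intro bimp_carrier) simp_all
    then have "(\<lambda>(\<pi>, c). bimp B c (bval_mem B \<pi> \<tau>)) ` entries \<sigma> \<subseteq> carrier B" by auto
    moreover have "bimp B c (bval_mem B \<pi> \<sigma>) \<in> carrier B" if "(\<pi>, c) \<in> entries \<tau>" for \<pi> c
      using 2(2)[OF that HOL.refl] a name_entry[OF _ that] by (intro bimp_carrier) simp_all
    then have "(\<lambda>(\<pi>, c). bimp B c (bval_mem B \<pi> \<sigma>)) ` entries \<tau> \<subseteq> carrier B" by auto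
    ultimately show "bval_eq b \<sigma> \<tau> \<in> carrier b"
      using a(3) by (simp add: bval_eq.simps)
  qed
qed

lemma bval_mem_carrier [simp]: "name B \<sigma> \<Longrightarrow> name B \<tau> \<Longrightarrow> bval_mem B \<sigma> \<tau> \<in> carrier B"
  using bval_carrier_aux(1) by blast

lemma bval_eq_carrier [simp]: "name B \<sigma> \<Longrightarrow> name B \<tau> \<Longrightarrow> bval_eq B \<sigma> \<tau> \<in> carrier B"
  using bval_carrier_aux(2) by blast

text \<open>Elements of the algebra are themselves sets of conditions, so forcing an atomic
  statement is membership in its Boolean value; the recursive forcing clauses are recovered as
  lemmas.\<close>

definition forces_mem :: "'v \<Rightarrow> 'v \<Rightarrow> 'v \<Rightarrow> bool" where
  "forces_mem p \<sigma> \<tau> \<longleftrightarrow> p \<in> elts (bval_mem B \<sigma> \<tau>)"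

definition forces_eq :: "'v \<Rightarrow> 'v \<Rightarrow> 'v \<Rightarrow> bool" where
  "forces_eq p \<sigma> \<tau> \<longleftrightarrow> p \<in> elts (bval_eq B \<sigma> \<tau>)"

lemma forces_mem_ro: "name B \<sigma> \<Longrightarrow> name B \<tau> \<Longrightarrow> ro {p. forces_mem p \<sigma> \<tau>}"
  using bval_mem_carrier[of \<sigma> \<tau>] by (simp add: car forces_mem_def)

lemma forces_eq_ro: "name B \<sigma> \<Longrightarrow> name B \<tau> \<Longrightarrow> ro {p. forces_eq p \<sigma> \<tau>}"
  using bval_eq_carrier[of \<sigma> \<tau>] by (simp add: car forces_eq_def)

lemma forces_mem_P: "forces_mem p \<sigma> \<tau> \<Longrightarrow> name B \<sigma> \<Longrightarrow> name B \<tau> \<Longrightarrow> p \<in> P"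
  using forces_mem_ro roD by blast
lemma forces_eq_P: "forces_eq p \<sigma> \<tau> \<Longrightarrow> name B \<sigma> \<Longrightarrow> name B \<tau> \<Longrightarrow> p \<in> P"
  using forces_eq_ro roD by blast

lemma forces_mem_down: "forces_mem p \<sigma> \<tau> \<Longrightarrow> q \<in> P \<Longrightarrow> st q p \<Longrightarrow> name B \<sigma> \<Longrightarrow> name B \<tau> \<Longrightarrow> forces_mem q \<sigma> \<tau>"
  using ro_down[OF forces_mem_ro] by blast
lemma forces_eq_down: "forces_eq p \<sigma> \<tau> \<Longrightarrow> q \<in> P \<Longrightarrow> st q p \<Longrightarrow> name B \<sigma> \<Longrightarrow> name B \<tau> \<Longrightarrow> forces_eq q \<sigma> \<tau>"
  using ro_down[OF forces_eq_ro] by blast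

lemma forces_mem_dense:
  "name B \<sigma> \<Longrightarrow> name B \<tau> \<Longrightarrow> p \<in> P \<Longrightarrow> (\<And>q. q \<in> P \<Longrightarrow> st q p \<Longrightarrow> \<exists>r. forces_mem r \<sigma> \<tau> \<and> st r q) \<Longrightarrow> forces_mem p \<sigma> \<tau>"
  using ro_dense[OF forces_mem_ro, of \<sigma> \<tau> p] by blast

text \<open>The supremum over the entries becomes density below \<open>p\<close>, by
  \<open>Sup_elts\<close>; the meet with a coefficient becomes membership in it.\<close>

lemma forces_mem_iff:
  assumes n: "name B \<sigma>" "name B \<tau>"
  shows "forces_mem p \<sigma> \<tau> \<longleftrightarrow> p \<in> P \<and>
    (\<forall>q\<in>P. st q p \<longrightarrow> (\<exists>r \<pi> b. r \<in> P \<and> st r q \<and> (\<pi>, b) \<in> entries \<tau> \<and> r \<in> elts b \<and> forces_eq r \<sigma> \<pi>))"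
proof -
  have "c \<sqinter>\<^bsub>B\<^esub> bval_eq B \<sigma> \<pi> \<in> carrier B" if "(\<pi>, c) \<in> entries \<tau>" for \<pi> c
    using n name_entry[OF _ that] by (intro cl.meet_closed) simp_all
  then have c: "(\<lambda>(\<pi>, c). c \<sqinter>\<^bsub>B\<^esub> bval_eq B \<sigma> \<pi>) ` entries \<tau> \<subseteq> carrier B" by auto
  have m: "elts (b \<sqinter>\<^bsub>B\<^esub> bval_eq B \<sigma> \<pi>) = elts b \<inter> {r. forces_eq r \<sigma> \<pi>}" if "(\<pi>, b) \<in> entries \<tau>" for \<pi> b
    using name_entry[OF n(2) that] n bval_eq_carrier[of \<sigma> \<pi>] by (subst meet) (auto simp: car forces_eq_def)
  have "(\<Union>a\<in>(\<lambda>(\<pi>, c). c \<sqinter>\<^bsub>B\<^esub> bval_eq B \<sigma> \<pi>) ` entries \<tau>. elts a) =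
      {r. \<exists>\<pi> b. (\<pi>, b) \<in> entries \<tau> \<and> r \<in> elts b \<and> forces_eq r \<sigma> \<pi>}" (is "?L = ?R")
  proof (rule Set.set_eqI)
    fix r
    have "r \<in> ?L \<longleftrightarrow> (\<exists>\<pi> b. (\<pi>, b) \<in> entries \<tau> \<and> r \<in> elts (b \<sqinter>\<^bsub>B\<^esub> bval_eq B \<sigma> \<pi>))"
      by (simp add: Bex_def split_paired_Ex)
    also have "\<dots> \<longleftrightarrow> r \<in> ?R" by (simp add: m cong: conj_cong)
    finally show "r \<in> ?L \<longleftrightarrow> r \<in> ?R" .
  qed
  then have "forces_mem p \<sigma> \<tau> \<longleftrightarrow> p \<in> reg P st {r. \<exists>\<pi> b. (\<pi>, b) \<in> entries \<tau> \<and> r \<in> elts b \<and> forces_eq r \<sigma> \<pi>}"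
    unfolding forces_mem_def by (simp add: bval_mem.simps Sup_elts[OF c])
  moreover have "r \<in> P" if "(\<pi>, b) \<in> entries \<tau>" "forces_eq r \<sigma> \<pi>" for r \<pi> b
    using forces_eq_P[OF that(2) n(1)] name_entry[OF n(2) that(1)] by blast
  ultimately show ?thesis unfolding reg_def by blast
qed

text \<open>Equality is built from infima and implications, both of which are computed on all
  extensions; so in contrast to membership no density clause occurs.\<close>

lemma forces_eq_iff:
  assumes n: "name B \<sigma>" "name B \<tau>"
  shows "forces_eq p \<sigma> \<tau> \<longleftrightarrow> p \<in> P \<and>
    (\<forall>\<pi> b q. (\<pi>, b) \<in> entries \<sigma> \<longrightarrow> q \<in> P \<longrightarrow> st q p \<longrightarrow> q \<in> elts b \<longrightarrow> forces_mem q \<pi> \<tau>) \<and>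
    (\<forall>\<pi> b q. (\<pi>, b) \<in> entries \<tau> \<longrightarrow> q \<in> P \<longrightarrow> st q p \<longrightarrow> q \<in> elts b \<longrightarrow> forces_mem q \<pi> \<sigma>)"
proof -
  have "bimp B c (bval_mem B \<pi> \<tau>) \<in> carrier B" if "(\<pi>, c) \<in> entries \<sigma>" for \<pi> c
    using n name_entry[OF _ that] by (intro bimp_carrier) simp_all
  moreover have "bimp B c (bval_mem B \<pi> \<sigma>) \<in> carrier B" if "(\<pi>, c) \<in> entries \<tau>" for \<pi> c
    using n name_entry[OF _ that] by (intro bimp_carrier) simp_all
  ultimately have c: "(\<lambda>(\<pi>, c). bimp B c (bval_mem B \<pi> \<tau>)) ` entries \<sigma> \<subseteq> carrier B"
    "(\<lambda>(\<pi>, c). bimp B c (bval_mem B \<pi> \<sigma>)) ` entries \<tau> \<subseteq> carrier B"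
    by auto
  have "ro (elts (\<Sqinter>\<^bsub>B\<^esub> ((\<lambda>(\<pi>, c). bimp B c (bval_mem B \<pi> \<tau>)) ` entries \<sigma>)))"
     "ro (elts (\<Sqinter>\<^bsub>B\<^esub> ((\<lambda>(\<pi>, c). bimp B c (bval_mem B \<pi> \<sigma>)) ` entries \<tau>)))"
    using c by (auto simp flip: car)
  note m = meet[OF this]
  have i1: "p \<in> elts (bimp B b (bval_mem B \<pi> \<tau>)) \<longleftrightarrow> p \<in> P \<and>
      (\<forall>q\<in>P. st q p \<longrightarrow> q \<in> elts b \<longrightarrow> forces_mem q \<pi> \<tau>)" if "(\<pi>, b) \<in> entries \<sigma>" for \<pi> b
    unfolding forces_mem_def using name_entry[OF n(1) that] n by (intro mem_bimp) auto
  have i2: "p \<in> elts (bimp B b (bval_mem B \<pi> \<sigma>)) \<longleftrightarrow> p \<in> P \<and>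
      (\<forall>q\<in>P. st q p \<longrightarrow> q \<in> elts b \<longrightarrow> forces_mem q \<pi> \<sigma>)" if "(\<pi>, b) \<in> entries \<tau>" for \<pi> b
    unfolding forces_mem_def using name_entry[OF n(2) that] n by (intro mem_bimp) auto
  have "forces_eq p \<sigma> \<tau> \<longleftrightarrow> p \<in> P \<and> (\<forall>(\<pi>, b)\<in>entries \<sigma>. p \<in> elts (bimp B b (bval_mem B \<pi> \<tau>))) \<and>
      (\<forall>(\<pi>, b)\<in>entries \<tau>. p \<in> elts (bimp B b (bval_mem B \<pi> \<sigma>)))"
    unfolding forces_eq_def by (subst bval_eq.simps) (auto simp: m Inf_elts[OF c(1)] Inf_elts[OF c(2)])
  then show ?thesis using i1 i2 by fast
qed

lemma name_entries_induct [consumes 1, case_names name]: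
  assumes "name B \<sigma>"
    and "\<And>\<sigma>. name B \<sigma> \<Longrightarrow> (\<And>\<pi> b. (\<pi>, b) \<in> entries \<sigma> \<Longrightarrow> Q \<pi>) \<Longrightarrow> Q \<sigma>"
  shows "Q \<sigma>"
  using assms(1)
proof (induction rule: name.induct)
  case (1 \<tau>)
  show ?case
  proof (rule assms(2))
    show "name B \<tau>"
    proof (rule name.intros)
      fix z assume "z \<in> elts \<tau>"
      from 1[OF this] show "\<exists>\<pi> b. z = vpair \<pi> b \<and> name B \<pi> \<and> b \<in> carrier B" by blast
    qed
    show "Q \<pi>" if "(\<pi>, b) \<in> entries \<tau>" for \<pi> b
    proof -
      have "vpair \<pi> b \<in> elts \<tau>" using that by (simp add: entries_def)
      from 1[OF this] show ?thesis by auto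
    qed
  qed
qed

section \<open>Forced equality as a congruence\<close>

lemma forces_eq_refl:
  assumes "name B \<sigma>" "p \<in> P" shows "forces_eq p \<sigma> \<sigma>"
  using assms
proof (induction arbitrary: p rule: name_entries_induct)
  case (name \<sigma>)
  have "forces_mem q \<pi> \<sigma>" if e: "(\<pi>, b) \<in> entries \<sigma>" "q \<in> P" "q \<in> elts b" for \<pi> b q
  proof -
    have "name B \<pi>" "ro (elts b)" using name_entry[OF name(1) e(1)] by (auto simp: car)
    then show ?thesis
      using e name refl ro_down[of "elts b" q] by (subst forces_mem_iff) blast+
  qed
  then show ?case using name by (subst forces_eq_iff) auto
qed

lemma forces_eq_sym: "name B \<sigma> \<Longrightarrow> name B \<tau> \<Longrightarrow> forces_eq p \<sigma> \<tau> \<Longrightarrow> forces_eq p \<tau> \<sigma>"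
  by (simp add: forces_eq_iff)

lemma forces_mem_witness:
  assumes "forces_mem p \<sigma> \<tau>" and n: "name B \<sigma>" "name B \<tau>"
  obtains r \<pi> b where "r \<in> P" "st r p" "(\<pi>, b) \<in> entries \<tau>" "r \<in> elts b" "forces_eq r \<sigma> \<pi>" "name B \<pi>"
proof -
  have p: "p \<in> P" "st p p" using forces_mem_P[OF assms] refl by blast+
  then obtain r \<pi> b where "r \<in> P" "st r p" "(\<pi>, b) \<in> entries \<tau>" "r \<in> elts b" "forces_eq r \<sigma> \<pi>"
    using assms(1) unfolding forces_mem_iff[OF n] by blast
  then show ?thesis using that name_entry(1)[OF n(2)] by blast
qed

lemma forces_mem_entry:
  assumes "name B \<sigma>" "name B \<tau>" "(\<pi>, b) \<in> entries \<tau>" "p \<in> elts b" "forces_eq p \<sigma> \<pi>"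
  shows "forces_mem p \<sigma> \<tau>"
proof -
  have \<pi>: "name B \<pi>" "ro (elts b)" using name_entry[OF assms(2,3)] by (auto simp: car)
  show ?thesis
    using assms \<pi> refl ro_down[OF \<pi>(2) assms(4)] forces_eq_down[OF assms(5)] forces_eq_P by (subst forces_mem_iff) blast+
qed

lemma forces_eq_entry1:
  "forces_eq p \<sigma> \<tau> \<Longrightarrow> name B \<sigma> \<Longrightarrow> name B \<tau> \<Longrightarrow> (\<pi>, b) \<in> entries \<sigma> \<Longrightarrow> q \<in> P \<Longrightarrow> st q p \<Longrightarrow> q \<in> elts b \<Longrightarrow> forces_mem q \<pi> \<tau>"
  unfolding forces_eq_iff by blast

text \<open>The induction runs on the first name only, with \<open>\<tau>\<close>,
  \<open>\<rho>\<close> and \<open>p\<close> arbitrary. An entry of one outer name is traced through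
  an entry of \<open>\<tau>\<close> to an entry of the other outer name, passing twice to a stronger
  condition.\<close>

lemma forces_eq_trans:
  assumes "name B \<sigma>" "name B \<tau>" "name B \<rho>" "forces_eq p \<sigma> \<tau>" "forces_eq p \<tau> \<rho>"
  shows "forces_eq p \<sigma> \<rho>"
  using assms
proof (induction arbitrary: p \<tau> \<rho> rule: name_entries_induct)
  case (name \<sigma>)
  note n = \<open>name B \<sigma>\<close> \<open>name B \<tau>\<close> \<open>name B \<rho>\<close>
  have p: "p \<in> P" using name forces_eq_P by blast
  have "forces_mem q \<pi> \<rho>" if e: "(\<pi>, b) \<in> entries \<sigma>" "q \<in> P" "st q p" "q \<in> elts b" for \<pi> b q
  proof (rule forces_mem_dense)
    note \<pi> = name_entry[OF n(1) e(1)]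
    show "name B \<pi>" by (rule \<pi>)
    show "name B \<rho>" "q \<in> P" by fact+
    fix q' assume q': "q' \<in> P" "st q' q"
    have "forces_mem q \<pi> \<tau>" using forces_eq_entry1[OF \<open>forces_eq p \<sigma> \<tau>\<close>] n e by blast
    then have "forces_mem q' \<pi> \<tau>" using forces_mem_down q' \<pi> n by blast
    then obtain r \<pi>' b' where r: "r \<in> P" "st r q'" "(\<pi>', b') \<in> entries \<tau>" "r \<in> elts b'" "forces_eq r \<pi> \<pi>'" "name B \<pi>'"
      using forces_mem_witness \<pi> n by metis
    have "st r p" using r q' e trans by blast
    then have "forces_mem r \<pi>' \<rho>" using forces_eq_entry1[OF \<open>forces_eq p \<tau> \<rho>\<close>] n r by blast
    then obtain s \<pi>'' b'' where s: "s \<in> P" "st s r" "(\<pi>'', b'') \<in> entries \<rho>" "s \<in> elts b''" "forces_eq s \<pi>' \<pi>''" "name B \<pi>''"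
      using forces_mem_witness r n by metis
    have "forces_eq s \<pi> \<pi>'" using forces_eq_down[OF r(5) s(1,2)] r(6) \<pi> by blast
    then have "forces_eq s \<pi> \<pi>''" using name(2)[OF e(1) r(6) s(6)] s by blast
    then have "forces_mem s \<pi> \<rho>" using forces_mem_entry \<pi> n s by blast
    then show "\<exists>r. forces_mem r \<pi> \<rho> \<and> st r q'" using s r trans by blast
  qed
  moreover have "forces_mem q \<pi>'' \<sigma>" if e: "(\<pi>'', b'') \<in> entries \<rho>" "q \<in> P" "st q p" "q \<in> elts b''" for \<pi>'' b'' q
  proof (rule forces_mem_dense)
    note \<pi> = name_entry[OF n(3) e(1)]
    have s1: "forces_eq p \<rho> \<tau>" "forces_eq p \<tau> \<sigma>" using name forces_eq_sym by blast+
    show "name B \<pi>''" by (rule \<pi>)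
    show "name B \<sigma>" "q \<in> P" by fact+
    fix q' assume q': "q' \<in> P" "st q' q"
    have "forces_mem q \<pi>'' \<tau>" using forces_eq_entry1[OF s1(1)] n e by blast
    then have "forces_mem q' \<pi>'' \<tau>" using forces_mem_down q' \<pi> n by blast
    then obtain r \<pi>' b' where r: "r \<in> P" "st r q'" "(\<pi>', b') \<in> entries \<tau>" "r \<in> elts b'" "forces_eq r \<pi>'' \<pi>'" "name B \<pi>'"
      using forces_mem_witness \<pi> n by metis
    have "st r p" using r q' e trans by blast
    then have "forces_mem r \<pi>' \<sigma>" using forces_eq_entry1[OF s1(2)] n r by blast
    then obtain s \<pi>0 b0 where s: "s \<in> P" "st s r" "(\<pi>0, b0) \<in> entries \<sigma>" "s \<in> elts b0" "forces_eq s \<pi>' \<pi>0" "name B \<pi>0"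
      using forces_mem_witness r n by metis
    have "forces_eq s \<pi>' \<pi>''" using forces_eq_down[OF r(5) s(1,2)] r(6) \<pi> forces_eq_sym by blast
    \<comment> \<open>The trace started in \<open>\<rho>\<close> and only now reaches an entry of
      \<open>\<sigma>\<close>, to which the induction hypothesis applies; symmetry puts the two
      equalities into the order it expects.\<close>
    then have "forces_eq s \<pi>0 \<pi>''" using name(2)[OF s(3) r(6) \<pi>(1)] s r forces_eq_sym by blast
    then have "forces_mem s \<pi>'' \<sigma>" using forces_mem_entry forces_eq_sym \<pi> n s by blast
    then show "\<exists>r. forces_mem r \<pi>'' \<sigma> \<and> st r q'" using s r trans by blast
  qed
  ultimately show ?case using n p by (subst forces_eq_iff) auto
qed

lemma forces_mem_cong_left:
  assumes "forces_mem p \<sigma> \<tau>" "forces_eq p \<sigma> \<sigma>'" "name B \<sigma>" "name B \<sigma>'" "name B \<tau>"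
  shows "forces_mem p \<sigma>' \<tau>"
proof (rule forces_mem_dense)
  fix q assume q: "q \<in> P" "st q p"
  have "forces_mem q \<sigma> \<tau>" using forces_mem_down assms q by blast
  then obtain r \<pi> b where r: "r \<in> P" "st r q" "(\<pi>, b) \<in> entries \<tau>" "r \<in> elts b" "forces_eq r \<sigma> \<pi>" "name B \<pi>"
    using forces_mem_witness assms by metis
  have "forces_eq r \<sigma> \<sigma>'" using forces_eq_down[OF assms(2) r(1)] trans r q assms by blast
  then have "forces_eq r \<sigma>' \<pi>" using forces_eq_trans forces_eq_sym assms r by metis
  then show "\<exists>r. forces_mem r \<sigma>' \<tau> \<and> st r q" using forces_mem_entry r assms by blast
qed (use assms forces_mem_P in auto)

lemma forces_mem_cong_right:
  assumes "forces_mem p \<sigma> \<tau>" "forces_eq p \<tau> \<tau>'" "name B \<sigma>" "name B \<tau>" "name B \<tau>'"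
  shows "forces_mem p \<sigma> \<tau>'"
proof (rule forces_mem_dense)
  fix q assume q: "q \<in> P" "st q p"
  have "forces_mem q \<sigma> \<tau>" using forces_mem_down assms q by blast
  then obtain r \<pi> b where r: "r \<in> P" "st r q" "(\<pi>, b) \<in> entries \<tau>" "r \<in> elts b" "forces_eq r \<sigma> \<pi>" "name B \<pi>"
    using forces_mem_witness assms by metis
  have "st r p" using trans r q by blast
  then have "forces_mem r \<pi> \<tau>'" using forces_eq_entry1[OF assms(2,4,5) r(3,1) _ r(4)] by blast
  then have "forces_mem r \<sigma> \<tau>'" using forces_mem_cong_left forces_eq_sym r assms by metis
  then show "\<exists>r. forces_mem r \<sigma> \<tau>' \<and> st r q" using r by blast
qed (use assms forces_mem_P in auto)

end

section \<open>Check names and the maximum principle\<close>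

lemma is_set_fst_entries: "is_set (fst ` entries (\<tau> :: 'v::zfc_universe))"
proof -
  have "fst ` entries \<tau> \<subseteq> (\<lambda>z. THE \<pi>. \<exists>b. z = vpair \<pi> b) ` elts \<tau>"
    by (force simp: entries_def image_iff)
  then show ?thesis by (rule is_set_subset[OF replacement])
qed

text \<open>The argument \<open>t\<close> is meant to be the top of the algebra, so that every
  element enters with full Boolean value; as a parameter it keeps the recursion independent of any
  poset.\<close>

function check_name :: "'v::zfc_universe \<Rightarrow> 'v \<Rightarrow> 'v" where
  "check_name t x = mkset ((\<lambda>y. vpair (check_name t y) t) ` elts x)"
  by pat_completeness auto
termination
  by (relation "inv_image {(x, y). x \<in> elts y} snd") (simp_all add: wf_inv_image foundation)

declare check_name.simps [simp del]

lemma elts_induct [case_names elts]: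
  assumes "\<And>x :: 'v::zfc_universe. (\<And>y. y \<in> elts x \<Longrightarrow> Q y) \<Longrightarrow> Q x"
  shows "Q x"
  using foundation by (rule wf_induct_rule) (use assms in blast)

lemma entries_check_name: "entries (check_name t x) = (\<lambda>y. (check_name t y, t)) ` elts x"
proof -
  have "elts (check_name t x) = (\<lambda>y. vpair (check_name t y) t) ` elts x"
    by (subst check_name.simps, rule elts_mkset[OF replacement])
  then show ?thesis by (auto simp: entries_def)
qed

text \<open>Least elements for a well-order of the whole type. Beyond plain choice they are stable:
  shrinking a set without losing its chosen element leaves the choice unchanged. This is what makes
  local choices survive the strengthening of a condition.\<close>

lemma coherent_choice:
  obtains least :: "'a set \<Rightarrow> 'a"
  where "\<And>S. S \<noteq> {} \<Longrightarrow> least S \<in> S"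
    and "\<And>S T. T \<subseteq> S \<Longrightarrow> least S \<in> T \<Longrightarrow> least T = least S"
proof -
  obtain r :: "'a rel" where r: "Well_order r" "Field r = UNIV"
    using well_ordering[where 'a='a] by blast
  then have wf: "wf (r - Id)" and tot: "\<And>x y. x \<noteq> y \<Longrightarrow> (x, y) \<in> r \<or> (y, x) \<in> r"
    and anti: "antisym r"
    unfolding well_order_on_def linear_order_on_def total_on_def partial_order_on_def by auto
  define least where "least S = (SOME x. x \<in> S \<and> (\<forall>y\<in>S. y \<noteq> x \<longrightarrow> (y, x) \<notin> r))" for S
  have l: "least S \<in> S \<and> (\<forall>y\<in>S. y \<noteq> least S \<longrightarrow> (y, least S) \<notin> r)" if ne: "S \<noteq> {}" for S
    unfolding least_def
  proof (rule someI_ex)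
    obtain x where "x \<in> S" using ne by blast
    then obtain z where "z \<in> S" "\<And>y. (y, z) \<in> r - Id \<Longrightarrow> y \<notin> S" using wfE_min[OF wf] by metis
    then show "\<exists>x. x \<in> S \<and> (\<forall>y\<in>S. y \<noteq> x \<longrightarrow> (y, x) \<notin> r)" by blast
  qed
  show thesis
  proof
    show "least S \<in> S" if "S \<noteq> {}" for S using l[OF that] by blast
    show "least T = least S" if "T \<subseteq> S" "least S \<in> T" for S T
    proof (rule ccontr)
      assume ne: "least T \<noteq> least S"
      have "S \<noteq> {}" "T \<noteq> {}" using that by blast+
      note lS = l[OF this(1)] and lT = l[OF this(2)]
      have "(least T, least S) \<notin> r" using lS lT that(1) ne by blast
      moreover have "(least S, least T) \<notin> r" using lT that(2) ne by metis
      ultimately show False using tot[OF ne] by blast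
    qed
  qed
qed

context regular_open_poset
begin

section \<open>Check names, names with given weights, and mixing\<close>

abbreviation "chk \<equiv> check_name (top B)"

lemma name_chk [simp]: "name B (chk x)"
proof (induction x rule: elts_induct)
  case (elts x)
  have "elts (chk x) = (\<lambda>y. vpair (chk y) (top B)) ` elts x"
    by (subst check_name.simps, rule elts_mkset[OF replacement])
  then show ?case using elts by (intro name.intros) auto
qed

lemma forces_mem_chkD:
  assumes "forces_mem p \<sigma> (chk b)" "name B \<sigma>"
  obtains q a where "q \<in> P" "st q p" "a \<in> elts b" "forces_eq q \<sigma> (chk a)"
  by (rule forces_mem_witness[OF assms name_chk]) (auto simp: entries_check_name that)

lemma forces_mem_chkI:
  assumes "a \<in> elts b" "forces_eq p \<sigma> (chk a)" "name B \<sigma>"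
  shows "forces_mem p \<sigma> (chk b)"
  using assms forces_eq_P[OF assms(2)] by (intro forces_mem_entry[where \<pi>="chk a" and b="top B"]) (auto simp: entries_check_name top)

text \<open>Every element of a check name carries the top value, so it is forced into the other
  side, where some extension identifies it with a concrete element. The induction hypothesis applies
  at that extension because it holds for all conditions.\<close>

lemma forces_eq_chk_iff [simp]: "forces_eq p (chk a) (chk b) \<longleftrightarrow> p \<in> P \<and> a = b"
proof
  show "p \<in> P \<and> a = b" if "forces_eq p (chk a) (chk b)"
    using that
  proof (induction a arbitrary: b p rule: elts_induct)
    case (elts a)
    have p: "p \<in> P" using forces_eq_P elts(2) by simp
    have forces_mem: "forces_mem p (chk x) (chk y)" if "forces_eq p (chk y') (chk y)" "x \<in> elts y'" for x y y'
      using p that(2) by (intro forces_eq_entry1[OF that(1), where b="top B"]) (auto simp: entries_check_name top refl)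
    have "x \<in> elts b" if x: "x \<in> elts a" for x
    proof -
      obtain q y where "y \<in> elts b" "forces_eq q (chk x) (chk y)"
        by (rule forces_mem_chkD[OF forces_mem[OF elts(2) x] name_chk])
      then show ?thesis using elts(1)[OF x] by blast
    qed
    moreover have "y \<in> elts a" if y: "y \<in> elts b" for y
    proof -
      have "forces_eq p (chk b) (chk a)" using forces_eq_sym elts(2) by simp
      then obtain q x where x: "x \<in> elts a" "forces_eq q (chk y) (chk x)"
        by (rule forces_mem_chkD[OF forces_mem[OF _ y] name_chk])
      then show ?thesis using elts(1)[OF x(1) forces_eq_sym[OF _ _ x(2)]] by simp
    qed
    ultimately show ?case using p by (auto intro: extensionality)
  qed
  show "forces_eq p (chk a) (chk b)" if "p \<in> P \<and> a = b" using that forces_eq_refl by simp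
qed

lemma mem_mk_reg:
  "A \<subseteq> P \<Longrightarrow> p \<in> elts (mkset (reg P st A)) \<longleftrightarrow> p \<in> P \<and> (\<forall>q\<in>P. st q p \<longrightarrow> (\<exists>r\<in>A. st r q))"
  by (simp add: elts_mk ro_reg) (simp add: reg_def)

text \<open>The weights \<open>Q\<close> may be arbitrary sets of conditions; \<open>reg\<close>
  turns them into elements of the algebra. The lemmas \<open>forces_mem_name_ofD\<close> and
  \<open>forces_mem_name_ofI\<close> then allow working with \<open>Q\<close> itself, up to passing
  to extensions.\<close>

definition name_of :: "'v set \<Rightarrow> ('v \<Rightarrow> 'v set) \<Rightarrow> 'v" where
  "name_of Z Q = mkset ((\<lambda>\<pi>. vpair \<pi> (mkset (reg P st (Q \<pi>)))) ` Z)"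

context
  fixes Z :: "'v set" and Q :: "'v \<Rightarrow> 'v set"
  assumes Z: "is_set Z" "\<And>\<pi>. \<pi> \<in> Z \<Longrightarrow> name B \<pi>" and Q: "\<And>\<pi>. \<pi> \<in> Z \<Longrightarrow> Q \<pi> \<subseteq> P"
begin

lemma elts_name_of: "elts (name_of Z Q) = (\<lambda>\<pi>. vpair \<pi> (mkset (reg P st (Q \<pi>)))) ` Z"
  unfolding name_of_def by (rule elts_mkset[OF is_set_image[OF Z(1)]])

lemma name_name_of: "name B (name_of Z Q)"
  using Z Q by (intro name.intros) (auto simp: elts_name_of car elts_mk ro_reg)

lemma entries_name_of: "entries (name_of Z Q) = (\<lambda>\<pi>. (\<pi>, mkset (reg P st (Q \<pi>)))) ` Z"
  by (auto simp: entries_def elts_name_of)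

lemma forces_mem_name_ofD:
  assumes "forces_mem p \<sigma> (name_of Z Q)" "name B \<sigma>"
  obtains q \<pi> where "q \<in> P" "st q p" "\<pi> \<in> Z" "q \<in> Q \<pi>" "forces_eq q \<sigma> \<pi>"
proof -
  obtain r \<pi> b where r: "r \<in> P" "st r p" "(\<pi>, b) \<in> entries (name_of Z Q)" "r \<in> elts b" "forces_eq r \<sigma> \<pi>"
    by (rule forces_mem_witness[OF assms name_name_of])
  then have \<pi>: "\<pi> \<in> Z" and b: "b = mkset (reg P st (Q \<pi>))" by (auto simp: entries_name_of)
  obtain s where s: "s \<in> Q \<pi>" "st s r" using r(1,4) refl unfolding b mem_mk_reg[OF Q[OF \<pi>]] by blast
  then have "s \<in> P" using Q \<pi> by blast
  moreover have "forces_eq s \<sigma> \<pi>" using forces_eq_down[OF r(5) \<open>s \<in> P\<close> s(2) assms(2)] Z \<pi> by blast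
  ultimately show thesis using that \<pi> s trans[OF s(2) r(2)] by blast
qed

lemma forces_mem_name_ofI:
  assumes "name B \<sigma>" "\<pi> \<in> Z" "forces_eq p \<sigma> \<pi>"
    and "\<And>q. q \<in> P \<Longrightarrow> st q p \<Longrightarrow> \<exists>r\<in>Q \<pi>. st r q"
  shows "forces_mem p \<sigma> (name_of Z Q)"
proof (rule forces_mem_entry[OF assms(1) name_name_of _ _ assms(3)])
  show "(\<pi>, mkset (reg P st (Q \<pi>))) \<in> entries (name_of Z Q)"
    using assms by (simp add: entries_name_of)
  show "p \<in> elts (mkset (reg P st (Q \<pi>)))"
    using assms(4) forces_eq_P[OF assms(3,1) Z(2)[OF assms(2)]] by (simp add: mem_mk_reg[OF Q[OF assms(2)]])
qed

end

text \<open>The classical mixing lemma with an open set in place of an antichain: \<open>w\<close>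
  is constant below each condition of \<open>D\<close>, so its values at compatible conditions agree
  and can be pasted into one name.\<close>

lemma mixing:
  assumes sub: "D \<subseteq> P" and names: "\<And>p. p \<in> D \<Longrightarrow> name B (w p)"
    and down: "\<And>p q. p \<in> D \<Longrightarrow> q \<in> P \<Longrightarrow> st q p \<Longrightarrow> q \<in> D \<and> w q = w p"
  obtains \<tau> where "name B \<tau>" "\<And>p. p \<in> D \<Longrightarrow> forces_eq p \<tau> (w p)"
proof
  define Z where "Z = (\<Union>p\<in>D. fst ` entries (w p))"
  \<comment> \<open>The weight of \<open>\<pi>\<close> collects the conditions of \<open>D\<close>
    at which the local name \<open>w p\<close> contains \<open>\<pi>\<close> with a coefficient that
    already holds there.\<close>
  define Q where "Q \<pi> = {p \<in> D. \<exists>b. (\<pi>, b) \<in> entries (w p) \<and> p \<in> elts b}" for \<pi>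
  have Z: "is_set Z" unfolding Z_def
    using is_set_UN[OF is_set_subset[OF small sub] is_set_fst_entries] .
  have Zn: "name B \<pi>" if "\<pi> \<in> Z" for \<pi>
    using that names name_entry by (fastforce simp: Z_def)
  have Q: "Q \<pi> \<subseteq> P" for \<pi> using sub by (auto simp: Q_def)
  let ?\<tau> = "name_of Z Q"
  show n: "name B ?\<tau>" by (rule name_name_of[OF Z Zn Q])
  fix p assume p: "p \<in> D"
  show "forces_eq p ?\<tau> (w p)"
    unfolding forces_eq_iff[OF n names[OF p]]
  proof (intro conjI allI impI)
    show "p \<in> P" using p sub by blast
    fix \<pi> b q assume e: "(\<pi>, b) \<in> entries ?\<tau>" "q \<in> P" "st q p" "q \<in> elts b"
    then have \<pi>: "\<pi> \<in> Z" and b: "b = mkset (reg P st (Q \<pi>))"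
      by (auto simp: entries_name_of[OF Z Zn Q])
    show "forces_mem q \<pi> (w p)"
    proof (rule forces_mem_dense[OF Zn[OF \<pi>] names[OF p] e(2)])
      fix q' assume q': "q' \<in> P" "st q' q"
      then obtain s where s: "s \<in> Q \<pi>" "st s q'"
        using e(4) unfolding b mem_mk_reg[OF Q] by blast
      then obtain c where c: "(\<pi>, c) \<in> entries (w s)" "s \<in> elts c" "s \<in> P" using sub by (auto simp: Q_def)
      have "st s p" using s q' e trans by blast
      then have "w s = w p" using down[OF p c(3)] by blast
      then have "forces_mem s \<pi> (w p)"
        using c forces_mem_entry[OF Zn[OF \<pi>] names[OF p], of \<pi> c s] forces_eq_refl[OF Zn[OF \<pi>]] by simp
      then show "\<exists>r. forces_mem r \<pi> (w p) \<and> st r q'" using s by blast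
    qed
  next
    fix \<pi> b q assume e: "(\<pi>, b) \<in> entries (w p)" "q \<in> P" "st q p" "q \<in> elts b"
    have "\<pi> \<in> fst ` entries (w p)" using e(1) by (rule image_eqI[rotated]) simp
    then have \<pi>: "\<pi> \<in> Z" using p unfolding Z_def by blast
    show "forces_mem q \<pi> ?\<tau>"
    proof (rule forces_mem_name_ofI[OF Z Zn Q Zn[OF \<pi>] \<pi>])
      show "forces_eq q \<pi> \<pi>" by (rule forces_eq_refl[OF Zn[OF \<pi>] e(2)])
      fix r assume r: "r \<in> P" "st r q"
      have "ro (elts b)" using name_entry[OF names[OF p] e(1)] by (simp add: car)
      then have "r \<in> elts b" using ro_down r e by blast
      moreover have "r \<in> D \<and> w r = w p" using down[OF p] r e trans by blast
      ultimately have "r \<in> Q \<pi>" using e by (auto simp: Q_def)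
      then show "\<exists>r'\<in>Q \<pi>. st r' r" using refl r by blast
    qed
  qed
qed

text \<open>
  The name chosen by a condition \<open>p\<close> is the least \<open>\<sigma>\<close> that some extension
  of \<open>p\<close> allows, and only conditions that allow their own choice are retained; this makes the choice
  persistent without picking a maximal antichain.
\<close>

lemma maximum_principle:
  assumes down: "\<And>p q \<sigma>. \<Phi> p \<sigma> \<Longrightarrow> q \<in> P \<Longrightarrow> st q p \<Longrightarrow> \<Phi> q \<sigma>"
  obtains \<tau> where "name B \<tau>"
    "\<And>p \<sigma>. p \<in> P \<Longrightarrow> name B \<sigma> \<Longrightarrow> \<Phi> p \<sigma> \<Longrightarrow>
       \<exists>q\<in>P. st q p \<and> (\<exists>\<sigma>. name B \<sigma> \<and> \<Phi> q \<sigma> \<and> forces_eq q \<tau> \<sigma>)"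
proof -
  obtain least :: "'v set \<Rightarrow> 'v" where l: "\<And>S. S \<noteq> {} \<Longrightarrow> least S \<in> S"
    "\<And>S T. T \<subseteq> S \<Longrightarrow> least S \<in> T \<Longrightarrow> least T = least S"
    by (rule coherent_choice) blast
  define S where "S p = {\<sigma>. name B \<sigma> \<and> (\<exists>q\<in>P. st q p \<and> \<Phi> q \<sigma>)}" for p
  define D where "D = {p \<in> P. name B (least (S p)) \<and> \<Phi> p (least (S p))}"
  have S_mono: "S q \<subseteq> S p" if "st q p" for p q
    using that trans unfolding S_def by blast
  have D_eq: "q \<in> D \<and> least (S q) = least (S p)"
    if "name B (least (S p))" "\<Phi> q (least (S p))" "q \<in> P" "st q p" for p q
  proof -
    have "least (S p) \<in> S q" using that refl unfolding S_def by blast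
    then have "least (S q) = least (S p)" using l(2) S_mono that(4) by blast
    then show ?thesis using that by (simp add: D_def)
  qed
  obtain \<tau> where \<tau>: "name B \<tau>" "\<And>p. p \<in> D \<Longrightarrow> forces_eq p \<tau> (least (S p))"
  proof (rule mixing)
    show "D \<subseteq> P" "\<And>p. p \<in> D \<Longrightarrow> name B (least (S p))" by (auto simp: D_def)
    show "q \<in> D \<and> least (S q) = least (S p)" if "p \<in> D" "q \<in> P" "st q p" for p q
      using that down by (intro D_eq) (auto simp: D_def)
  qed blast
  show thesis
  proof (rule that[OF \<tau>(1)])
    fix p \<sigma> assume p: "p \<in> P" "name B \<sigma>" "\<Phi> p \<sigma>"
    then have "\<sigma> \<in> S p" using refl unfolding S_def by blast
    then have "least (S p) \<in> S p" using l(1) by blast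
    then obtain q where q: "name B (least (S p))" "\<Phi> q (least (S p))" "q \<in> P" "st q p"
      unfolding S_def by blast
    then show "\<exists>q\<in>P. st q p \<and> (\<exists>\<sigma>. name B \<sigma> \<and> \<Phi> q \<sigma> \<and> forces_eq q \<tau> \<sigma>)"
      using D_eq[OF q] \<tau>(2)[of q] by metis
  qed
qed

end

section \<open>The Boolean quotient\<close>

locale boolean_quotient = regular_open_poset +
  fixes U :: "'a set"
  assumes ultrafilter: "ultrafilter_on B U"
begin

text \<open>An arbitrary predicate is identified with the regular open set that it generates, so
  that statements about \<open>U\<close> can be argued condition by condition without naming
  elements of the algebra.\<close>

definition large :: "('a \<Rightarrow> bool) \<Rightarrow> bool" where
  "large Q \<longleftrightarrow> mkset (reg P st {p \<in> P. Q p}) \<in> U"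

definition persistent :: "('a \<Rightarrow> bool) \<Rightarrow> bool" where
  "persistent Q \<longleftrightarrow> (\<forall>p q. Q p \<longrightarrow> q \<in> P \<longrightarrow> st q p \<longrightarrow> Q q)"

lemma persI: "(\<And>p q. Q p \<Longrightarrow> q \<in> P \<Longrightarrow> st q p \<Longrightarrow> Q q) \<Longrightarrow> persistent Q"
  unfolding persistent_def by blast

lemma persD: "persistent Q \<Longrightarrow> Q p \<Longrightarrow> q \<in> P \<Longrightarrow> st q p \<Longrightarrow> Q q"
  unfolding persistent_def by blast

section \<open>Calculus of large predicates\<close>

lemma U_up: "a \<in> U \<Longrightarrow> b \<in> carrier B \<Longrightarrow> elts a \<subseteq> elts b \<Longrightarrow> b \<in> U"
  using ultrafilter unfolding ultrafilter_on_def by (simp add: le)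

lemma large_carrier: "mkset (reg P st {p \<in> P. Q p}) \<in> carrier B"
  unfolding car by (subst elts_mk) (auto intro!: ro_reg)

lemma large_elts: "b \<in> carrier B \<Longrightarrow> large (\<lambda>p. p \<in> elts b) \<longleftrightarrow> b \<in> U"
proof -
  assume b: "b \<in> carrier B"
  then have r: "ro (elts b)" by (simp add: car)
  then have "{p \<in> P. p \<in> elts b} = elts b" using roD by blast
  moreover have "reg P st (elts b) = elts b"
    using reg_least[OF r subset_refl] reg_sub[OF r] by blast
  ultimately have "mkset (reg P st {p \<in> P. p \<in> elts b}) = b"
    using r by (intro extensionality) (simp add: elts_mk)
  then show ?thesis by (simp add: large_def)
qed

text \<open>The regular open set generated by \<open>R\<close> consists of the conditions below
  which \<open>R\<close> is dense, so refining each condition with \<open>Q\<close> to one with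
  \<open>R\<close> gives an inclusion of Boolean values.\<close>

lemma large_dense:
  assumes "large Q" and "\<And>p. p \<in> P \<Longrightarrow> Q p \<Longrightarrow> \<exists>q\<in>P. st q p \<and> R q"
  shows "large R"
  unfolding large_def
proof (rule U_up[OF assms(1)[unfolded large_def] large_carrier], rule subsetI)
  fix p assume "p \<in> elts (mkset (reg P st {p \<in> P. Q p}))"
  then have p: "p \<in> P" "\<forall>q\<in>P. st q p \<longrightarrow> (\<exists>r\<in>{p \<in> P. Q p}. st r q)"
    by (auto simp: mem_mk_reg)
  have "\<exists>r\<in>{p \<in> P. R p}. st r q" if q: "q \<in> P" "st q p" for q
  proof -
    obtain r where r: "r \<in> P" "Q r" "st r q" using p(2) q by blast
    then obtain s where "s \<in> P" "st s r" "R s" using assms(2) by blast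
    then show ?thesis using r trans by blast
  qed
  then show "p \<in> elts (mkset (reg P st {p \<in> P. R p}))"
    using p(1) by (simp add: mem_mk_reg)
qed

lemma large_mono: "large Q \<Longrightarrow> (\<And>p. p \<in> P \<Longrightarrow> Q p \<Longrightarrow> R p) \<Longrightarrow> large R"
  by (rule large_dense) (use refl in blast)+

lemma large_all: "(\<And>p. p \<in> P \<Longrightarrow> \<exists>q\<in>P. st q p \<and> R q) \<Longrightarrow> large R"
proof -
  assume a: "\<And>p. p \<in> P \<Longrightarrow> \<exists>q\<in>P. st q p \<and> R q"
  have "top B \<in> U" using ultrafilter by (simp add: ultrafilter_on_def)
  then have "large (\<lambda>p. p \<in> elts (top B))" by (subst large_elts) auto
  then show "large R" using a by (rule large_dense)
qed

text \<open>Below a condition in both Boolean values, first take an extension with \<open>Q\<close>,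
  then one of that with \<open>R\<close>; persistence carries \<open>Q\<close> down to the second.
  Two dense sets of conditions could otherwise be disjoint.\<close>

lemma large_combine:
  assumes "large Q" "large R" "persistent Q" and "\<And>p. p \<in> P \<Longrightarrow> Q p \<Longrightarrow> R p \<Longrightarrow> \<exists>q\<in>P. st q p \<and> S q"
  shows "large S"
proof -
  let ?b = "\<lambda>Q. mkset (reg P st {p \<in> P. Q p})"
  have m: "meet B (?b Q) (?b R) \<in> U"
    using assms(1,2) ultrafilter unfolding ultrafilter_on_def large_def by blast
  have c: "meet B (?b Q) (?b R) \<in> carrier B" by (intro cl.meet_closed large_carrier)
  have e: "elts (meet B (?b Q) (?b R)) = elts (?b Q) \<inter> elts (?b R)"
    using large_carrier by (intro meet) (simp_all only: flip: car)
  show ?thesis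
  proof (rule large_dense)
    show "large (\<lambda>p. p \<in> elts (meet B (?b Q) (?b R)))" using m by (simp only: large_elts[OF c])
    fix p assume p: "p \<in> P" "p \<in> elts (meet B (?b Q) (?b R))"
    then have "p \<in> elts (?b Q)" "p \<in> elts (?b R)" by (simp_all add: e)
    note pq = this[unfolded mem_mk_reg[OF Collect_restrict]]
    obtain q where q: "q \<in> P" "Q q" "st q p" using pq(1) p(1) refl by blast
    then obtain r where r: "r \<in> P" "R r" "st r q" using pq(2) by blast
    have "Q r" using persD[OF assms(3) q(2) r(1,3)] .
    then obtain s where "s \<in> P" "st s r" "S s" using assms(4) r by blast
    then show "\<exists>q\<in>P. st q p \<and> S q" using trans q r by blast
  qed
qed

lemma large_both:
  assumes "large Q" "large R" "persistent Q" and "\<And>p. p \<in> P \<Longrightarrow> Q p \<Longrightarrow> R p \<Longrightarrow> S p"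
  shows "large S"
  by (rule large_combine[OF assms(1-3)]) (use assms(4) refl in blast)

lemma large_False: "\<not> large (\<lambda>p. False)"
proof
  assume "large (\<lambda>p. False)"
  then have "mkset (reg P st {}) \<in> U" by (simp add: large_def)
  moreover have "bottom B \<in> carrier B" by simp
  moreover have "elts (mkset (reg P st {})) \<subseteq> elts (bottom B)"
    unfolding bot by (rule subsetI, simp add: mem_mk_reg) (use refl in blast)
  ultimately have "bottom B \<in> U" by (rule U_up)
  then show False using ultrafilter by (simp add: ultrafilter_on_def)
qed

lemma large_conflict:
  "large Q \<Longrightarrow> large R \<Longrightarrow> persistent Q \<Longrightarrow> (\<And>p. p \<in> P \<Longrightarrow> Q p \<Longrightarrow> R p \<Longrightarrow> False) \<Longrightarrow> False"
  using large_combine[of Q R "\<lambda>p. False"] large_False by blast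

text \<open>The ultrafilter contains the complement of the value of \<open>Q\<close>. A condition in
  the complement is not in the value itself, so some extension has no further extension with
  \<open>Q\<close>.\<close>

lemma large_neg:
  assumes "\<not> large Q" shows "large (\<lambda>p. \<forall>q\<in>P. st q p \<longrightarrow> \<not> Q q)"
proof -
  let ?b = "mkset (reg P st {p \<in> P. Q p})"
  have c: "bcompl B ?b \<in> U"
    using assms ultrafilter large_carrier unfolding ultrafilter_on_def large_def by blast
  have "large (\<lambda>p. p \<in> elts (bcompl B ?b))"
    using c by (simp only: large_elts[OF bcompl_props(1)[OF large_carrier]])
  then show ?thesis
  proof (rule large_dense)
    fix p assume p: "p \<in> P" "p \<in> elts (bcompl B ?b)"
    then have "p \<notin> elts ?b" using refl by (simp add: elts_bcompl[OF large_carrier])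
    then obtain q where "q \<in> P" "st q p" "\<not> (\<exists>r\<in>{p \<in> P. Q p}. st r q)"
      using p(1) unfolding mem_mk_reg[OF Collect_restrict] by blast
    then show "\<exists>q\<in>P. st q p \<and> (\<forall>r\<in>P. st r q \<longrightarrow> \<not> Q r)" by blast
  qed
qed

lemma large_neg_iff:
  assumes "persistent Q" shows "large (\<lambda>p. \<forall>q\<in>P. st q p \<longrightarrow> \<not> Q q) \<longleftrightarrow> \<not> large Q"
  using large_neg[of Q] large_conflict[OF _ _ assms] refl by blast

lemma persistent_neg [intro]: "persistent (\<lambda>p. \<forall>q\<in>P. st q p \<longrightarrow> \<not> Q q)"
  using trans unfolding persistent_def by blast

text \<open>Primality of the ultrafilter. The denial of \<open>Q\<close> on all extensions is
  persistent for any \<open>Q\<close>, which is what lets it be combined with the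
  disjunction.\<close>

lemma large_disj: "large (\<lambda>p. Q p \<or> R p) \<Longrightarrow> large Q \<or> large R"
proof (rule ccontr)
  assume a: "large (\<lambda>p. Q p \<or> R p)" "\<not> (large Q \<or> large R)"
  have "large R"
    by (rule large_combine[OF large_neg[of Q] a(1)]) (use a(2) persistent_neg refl in blast)+
  then show False using a(2) by blast
qed

section \<open>Equality, membership and fullness in the quotient\<close>

definition W :: "'a set set" where "W = quotient_universe B U"
definition E :: "'a set \<Rightarrow> 'a set \<Rightarrow> bool" where "E = quotient_mem B U"
abbreviation "cls \<equiv> name_class B U"

lemma large_forces_mem: "name B \<sigma> \<Longrightarrow> name B \<tau> \<Longrightarrow> bval_mem B \<sigma> \<tau> \<in> U \<longleftrightarrow> large (\<lambda>p. forces_mem p \<sigma> \<tau>)"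
  unfolding forces_mem_def by (simp add: large_elts)

lemma large_forces_eq: "name B \<sigma> \<Longrightarrow> name B \<tau> \<Longrightarrow> bval_eq B \<sigma> \<tau> \<in> U \<longleftrightarrow> large (\<lambda>p. forces_eq p \<sigma> \<tau>)"
  unfolding forces_eq_def by (simp add: large_elts)

lemma persistent_forces_eq [intro]: "name B \<sigma> \<Longrightarrow> name B \<tau> \<Longrightarrow> persistent (\<lambda>p. forces_eq p \<sigma> \<tau>)"
  by (rule persI) (rule forces_eq_down)

lemma persistent_forces_mem [intro]: "name B \<sigma> \<Longrightarrow> name B \<tau> \<Longrightarrow> persistent (\<lambda>p. forces_mem p \<sigma> \<tau>)"
  by (rule persI) (rule forces_mem_down)

lemma large_forces_eq_trans:
  "large (\<lambda>p. forces_eq p \<sigma> \<tau>) \<Longrightarrow> large (\<lambda>p. forces_eq p \<tau> \<rho>) \<Longrightarrow> name B \<sigma> \<Longrightarrow> name B \<tau> \<Longrightarrow> name B \<rho> \<Longrightarrow> large (\<lambda>p. forces_eq p \<sigma> \<rho>)"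
  by (rule large_both[of "\<lambda>p. forces_eq p \<sigma> \<tau>" "\<lambda>p. forces_eq p \<tau> \<rho>"]) (blast, blast, blast, rule forces_eq_trans)

lemma large_forces_eq_sym: "large (\<lambda>p. forces_eq p \<sigma> \<tau>) \<Longrightarrow> name B \<sigma> \<Longrightarrow> name B \<tau> \<Longrightarrow> large (\<lambda>p. forces_eq p \<tau> \<sigma>)"
  by (erule large_mono) (rule forces_eq_sym)

lemma large_forces_eq_refl: "name B \<sigma> \<Longrightarrow> large (\<lambda>p. forces_eq p \<sigma> \<sigma>)"
  by (rule large_all) (use refl forces_eq_refl[of \<sigma>] in blast)

lemma cls_eq_iff:
  assumes n: "name B \<sigma>" "name B \<tau>" shows "cls \<sigma> = cls \<tau> \<longleftrightarrow> large (\<lambda>p. forces_eq p \<sigma> \<tau>)"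
proof
  show "large (\<lambda>p. forces_eq p \<sigma> \<tau>)" if "cls \<sigma> = cls \<tau>"
  proof -
    have "\<tau> \<in> cls \<tau>" using n large_forces_eq_refl by (simp add: name_class_def large_forces_eq)
    then have "\<tau> \<in> cls \<sigma>" by (simp only: that)
    then show ?thesis using n by (simp add: name_class_def large_forces_eq)
  qed
  show "cls \<sigma> = cls \<tau>" if "large (\<lambda>p. forces_eq p \<sigma> \<tau>)"
  proof -
    have "large (\<lambda>p. forces_eq p \<tau> \<sigma>)" using large_forces_eq_sym that n by blast
    then have "bval_eq B \<sigma> \<rho> \<in> U \<longleftrightarrow> bval_eq B \<tau> \<rho> \<in> U" if "name B \<rho>" for \<rho>
      using large_forces_eq_trans[of \<sigma> \<tau> \<rho>] large_forces_eq_trans[of \<tau> \<sigma> \<rho>] \<open>large (\<lambda>p. forces_eq p \<sigma> \<tau>)\<close> n that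
      by (auto simp: large_forces_eq)
    then show ?thesis unfolding name_class_def by blast
  qed
qed

lemma W_cls [simp]: "name B \<sigma> \<Longrightarrow> cls \<sigma> \<in> W"
  by (simp add: W_def quotient_universe_def)

definition rep :: "'a set \<Rightarrow> 'a" where "rep X = (SOME \<sigma>. name B \<sigma> \<and> cls \<sigma> = X)"

lemma rep: "X \<in> W \<Longrightarrow> name B (rep X)" "X \<in> W \<Longrightarrow> cls (rep X) = X"
proof -
  assume "X \<in> W"
  then have "\<exists>\<sigma>. name B \<sigma> \<and> cls \<sigma> = X" by (auto simp: W_def quotient_universe_def)
  then have "name B (rep X) \<and> cls (rep X) = X" unfolding rep_def by (rule someI_ex)
  then show "name B (rep X)" "cls (rep X) = X" by blast+
qed

lemma large_rep_cls: "name B \<sigma> \<Longrightarrow> large (\<lambda>p. forces_eq p (rep (cls \<sigma>)) \<sigma>)"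
  using cls_eq_iff[of "rep (cls \<sigma>)" \<sigma>] rep[of "cls \<sigma>"] by simp

lemma W_eq_iff: "X \<in> W \<Longrightarrow> Y \<in> W \<Longrightarrow> X = Y \<longleftrightarrow> large (\<lambda>p. forces_eq p (rep X) (rep Y))"
  using cls_eq_iff[of "rep X" "rep Y"] rep by simp

lemma E_cls:
  assumes n: "name B \<sigma>" "name B \<tau>" shows "E (cls \<sigma>) (cls \<tau>) \<longleftrightarrow> large (\<lambda>p. forces_mem p \<sigma> \<tau>)"
proof
  assume "E (cls \<sigma>) (cls \<tau>)"
  then obtain \<sigma>' \<tau>' where s: "name B \<sigma>'" "name B \<tau>'" "cls \<sigma> = cls \<sigma>'" "cls \<tau> = cls \<tau>'" "bval_mem B \<sigma>' \<tau>' \<in> U"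
    unfolding E_def quotient_mem_def by blast
  have 1: "large (\<lambda>p. forces_eq p \<sigma>' \<sigma>)" "large (\<lambda>p. forces_eq p \<tau>' \<tau>)" "large (\<lambda>p. forces_mem p \<sigma>' \<tau>')"
    using s n cls_eq_iff large_forces_mem by metis+
  have "large (\<lambda>p. forces_mem p \<sigma> \<tau>')"
    by (rule large_both[OF 1(1,3) persistent_forces_eq[OF s(1) n(1)]]) (rule forces_mem_cong_left[OF _ _ s(1) n(1) s(2)])
  then show "large (\<lambda>p. forces_mem p \<sigma> \<tau>)"
    by (rule large_both[OF 1(2) _ persistent_forces_eq[OF s(2) n(2)]]) (rule forces_mem_cong_right[OF _ _ n(1) s(2) n(2)])
next
  assume "large (\<lambda>p. forces_mem p \<sigma> \<tau>)"
  then show "E (cls \<sigma>) (cls \<tau>)" using n large_forces_mem unfolding E_def quotient_mem_def by blast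
qed

lemma E_iff: "X \<in> W \<Longrightarrow> Y \<in> W \<Longrightarrow> E X Y \<longleftrightarrow> large (\<lambda>p. forces_mem p (rep X) (rep Y))"
  using E_cls[of "rep X" "rep Y"] rep by simp

lemma E_cls2: "X \<in> W \<Longrightarrow> name B \<tau> \<Longrightarrow> E X (cls \<tau>) \<longleftrightarrow> large (\<lambda>p. forces_mem p (rep X) \<tau>)"
  using E_cls[of "rep X" \<tau>] rep by simp

text \<open>Fullness: local witnesses are glued to a single element of the quotient by
  \<open>maximum_principle\<close>. The conclusion keeps the local witness \<open>\<sigma>\<close>
  and only equates it with \<open>rep Z\<close>, so \<open>\<Phi>\<close> may depend on the
  syntactic form of a name; \<open>lift\<close> applies it to the property of being a check
  name.\<close>

lemma W_maximum:
  assumes persistent: "\<And>\<sigma>. persistent (\<lambda>p. \<Phi> p \<sigma>)"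
    and "large (\<lambda>p. \<exists>\<sigma>. name B \<sigma> \<and> \<Phi> p \<sigma>)"
  obtains Z where "Z \<in> W" "large (\<lambda>p. \<exists>\<sigma>. name B \<sigma> \<and> \<Phi> p \<sigma> \<and> forces_eq p (rep Z) \<sigma>)"
proof -
  obtain \<tau> where \<tau>: "name B \<tau>"
    "\<And>p \<sigma>. p \<in> P \<Longrightarrow> name B \<sigma> \<Longrightarrow> \<Phi> p \<sigma> \<Longrightarrow>
       \<exists>q\<in>P. st q p \<and> (\<exists>\<sigma>. name B \<sigma> \<and> \<Phi> q \<sigma> \<and> forces_eq q \<tau> \<sigma>)"
    by (rule maximum_principle[of \<Phi>]) (use persistent[unfolded persistent_def] in blast)+
  have W: "cls \<tau> \<in> W" and n: "name B (rep (cls \<tau>))" using \<tau>(1) rep by simp_all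
  have 1: "large (\<lambda>p. \<exists>\<sigma>. name B \<sigma> \<and> \<Phi> p \<sigma> \<and> forces_eq p \<tau> \<sigma>)"
    using assms(2) by (rule large_dense) (use \<tau>(2) in blast)
  have "large (\<lambda>p. \<exists>\<sigma>. name B \<sigma> \<and> \<Phi> p \<sigma> \<and> forces_eq p (rep (cls \<tau>)) \<sigma>)"
    by (rule large_both[OF large_rep_cls[OF \<tau>(1)] 1 persistent_forces_eq[OF n \<tau>(1)]]) (use forces_eq_trans[OF n \<tau>(1)] in blast)
  then show thesis using that W by blast
qed

definition forces_nmem :: "'a \<Rightarrow> 'a \<Rightarrow> 'a \<Rightarrow> bool" where
  "forces_nmem p \<sigma> \<tau> \<longleftrightarrow> (\<forall>q\<in>P. st q p \<longrightarrow> \<not> forces_mem q \<sigma> \<tau>)"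

lemma forces_nmem_down: "forces_nmem p \<sigma> \<tau> \<Longrightarrow> st q p \<Longrightarrow> forces_nmem q \<sigma> \<tau>"
  unfolding forces_nmem_def using trans by blast

lemma not_E_iff: "X \<in> W \<Longrightarrow> Y \<in> W \<Longrightarrow> \<not> E X Y \<longleftrightarrow> large (\<lambda>p. forces_nmem p (rep X) (rep Y))"
  unfolding forces_nmem_def by (simp add: large_neg_iff[OF persistent_forces_mem] rep E_iff)

lemma forces_nmem_cong_left:
  assumes "forces_nmem p \<sigma> \<tau>" "forces_eq p \<sigma> \<sigma>'" "name B \<sigma>" "name B \<sigma>'" "name B \<tau>"
  shows "forces_nmem p \<sigma>' \<tau>"
  unfolding forces_nmem_def
proof (intro ballI impI notI)
  fix q assume q: "q \<in> P" "st q p" "forces_mem q \<sigma>' \<tau>"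
  have "forces_eq q \<sigma>' \<sigma>" 
    by (rule forces_eq_sym[OF assms(3,4) forces_eq_down[OF assms(2) q(1,2) assms(3,4)]])
  then have "forces_mem q \<sigma> \<tau>" by (rule forces_mem_cong_left[OF q(3) _ assms(4,3,5)])
  then show False using assms(1) q unfolding forces_nmem_def by blast
qed

text \<open>If equality is not forced, some extension lies in the coefficient of an entry of one
  name without forcing that entry into the other. Forced membership is closed under density, so a
  further extension excludes the entry outright.\<close>

lemma not_forces_eq_witness:
  assumes n: "name B \<sigma>" "name B \<tau>" and p: "p \<in> P" "\<not> forces_eq p \<sigma> \<tau>"
  obtains q \<pi> where "q \<in> P" "st q p" "name B \<pi>"
    "forces_mem q \<pi> \<sigma> \<and> forces_nmem q \<pi> \<tau> \<or> forces_mem q \<pi> \<tau> \<and> forces_nmem q \<pi> \<sigma>"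
proof -
  have w: "\<exists>r. r \<in> P \<and> st r p \<and> forces_mem r \<pi> \<sigma> \<and> forces_nmem r \<pi> \<tau>"
    if a: "(\<pi>, b) \<in> entries \<sigma>" "q \<in> P" "st q p" "q \<in> elts b" "\<not> forces_mem q \<pi> \<tau>" "name B \<sigma>" "name B \<tau>"
    for \<sigma> \<tau> \<pi> b q
  proof -
    have \<pi>: "name B \<pi>" by (rule name_entry(1)[OF a(6,1)])
    have "\<exists>r\<in>P. st r q \<and> (\<forall>s. forces_mem s \<pi> \<tau> \<longrightarrow> \<not> st s r)"
    proof (rule ccontr)
      assume "\<not> ?thesis"
      then have n: "\<exists>s. forces_mem s \<pi> \<tau> \<and> st s r" if "r \<in> P" "st r q" for r using that by blast
      have "forces_mem q \<pi> \<tau>" by (rule forces_mem_dense[OF \<pi> a(7,2) n])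
      then show False using a(5) by blast
    qed
    then obtain r where r: "r \<in> P" "st r q" "\<forall>s. forces_mem s \<pi> \<tau> \<longrightarrow> \<not> st s r" by blast
    have "forces_mem q \<pi> \<sigma>" by (rule forces_mem_entry[OF \<pi> a(6,1,4) forces_eq_refl[OF \<pi> a(2)]])
    then have "forces_mem r \<pi> \<sigma>" by (rule forces_mem_down[OF _ r(1,2) \<pi> a(6)])
    then show ?thesis using r trans[OF r(2) a(3)] unfolding forces_nmem_def by blast
  qed
  have "(\<exists>\<pi> b q. (\<pi>, b) \<in> entries \<sigma> \<and> q \<in> P \<and> st q p \<and> q \<in> elts b \<and> \<not> forces_mem q \<pi> \<tau>) \<or>
      (\<exists>\<pi> b q. (\<pi>, b) \<in> entries \<tau> \<and> q \<in> P \<and> st q p \<and> q \<in> elts b \<and> \<not> forces_mem q \<pi> \<sigma>)"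
    using p unfolding forces_eq_iff[OF n] by blast
  then show thesis
  proof (elim disjE exE conjE)
    fix \<pi> b q assume a: "(\<pi>, b) \<in> entries \<sigma>" "q \<in> P" "st q p" "q \<in> elts b" "\<not> forces_mem q \<pi> \<tau>"
    show thesis using w[OF a n] that name_entry[OF n(1) a(1)] by blast
  next
    fix \<pi> b q assume a: "(\<pi>, b) \<in> entries \<tau>" "q \<in> P" "st q p" "q \<in> elts b" "\<not> forces_mem q \<pi> \<sigma>"
    show thesis using w[OF a n(2,1)] that name_entry[OF n(2) a(1)] by blast
  qed
qed

text \<open>Unequal classes differ locally at some name; fullness glues these names to one
  \<open>Z\<close>, and primality decides which of the two sides contains \<open>Z\<close>. Later
  this identifies an internally described object with one built condition by condition.\<close>

lemma W_extensionality:
  assumes X: "X \<in> W" and Y: "Y \<in> W" and eq: "\<And>Z. Z \<in> W \<Longrightarrow> E Z X \<longleftrightarrow> E Z Y"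
  shows "X = Y"
proof (rule ccontr)
  assume "X \<noteq> Y"
  then have "\<not> large (\<lambda>p. forces_eq p (rep X) (rep Y))" using W_eq_iff X Y by blast
  then have ne: "large (\<lambda>p. \<forall>q\<in>P. st q p \<longrightarrow> \<not> forces_eq q (rep X) (rep Y))" by (rule large_neg)
  note n = rep(1)[OF X] rep(1)[OF Y]
  let ?\<Phi> = "\<lambda>p \<pi>. name B \<pi> \<and> (forces_mem p \<pi> (rep X) \<and> forces_nmem p \<pi> (rep Y) \<or> forces_mem p \<pi> (rep Y) \<and> forces_nmem p \<pi> (rep X))"
  have 1: "large (\<lambda>p. \<exists>\<pi>. name B \<pi> \<and> ?\<Phi> p \<pi>)"
    using ne
  proof (rule large_dense)
    fix p assume p: "p \<in> P" "\<forall>q\<in>P. st q p \<longrightarrow> \<not> forces_eq q (rep X) (rep Y)"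
    then have "\<not> forces_eq p (rep X) (rep Y)" using refl by blast
    then show "\<exists>q\<in>P. st q p \<and> (\<exists>\<pi>. name B \<pi> \<and> ?\<Phi> q \<pi>)"
      by (rule not_forces_eq_witness[OF n p(1)]) blast+
  qed
  have persistent: "persistent (\<lambda>p. ?\<Phi> p \<sigma>)" for \<sigma>
    using forces_mem_down forces_nmem_down n by (intro persI) blast
  obtain Z where Z: "Z \<in> W" and large: "large (\<lambda>p. \<exists>\<sigma>. name B \<sigma> \<and> ?\<Phi> p \<sigma> \<and> forces_eq p (rep Z) \<sigma>)"
    by (rule W_maximum[OF persistent 1])
  have "large (\<lambda>p. forces_mem p (rep Z) (rep X) \<and> forces_nmem p (rep Z) (rep Y) \<or> forces_mem p (rep Z) (rep Y) \<and> forces_nmem p (rep Z) (rep X))"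
    using large
  proof (rule large_mono)
    fix p assume "\<exists>\<sigma>. name B \<sigma> \<and> ?\<Phi> p \<sigma> \<and> forces_eq p (rep Z) \<sigma>"
    then obtain \<sigma> where s: "name B \<sigma>" "?\<Phi> p \<sigma>" "forces_eq p \<sigma> (rep Z)"
      using forces_eq_sym[OF rep(1)[OF Z]] by blast
    then show "forces_mem p (rep Z) (rep X) \<and> forces_nmem p (rep Z) (rep Y) \<or> forces_mem p (rep Z) (rep Y) \<and> forces_nmem p (rep Z) (rep X)"
      using forces_mem_cong_left[OF _ s(3,1) rep(1)[OF Z]] forces_nmem_cong_left[OF _ s(3,1) rep(1)[OF Z]] n by blast
  qed
  then have "large (\<lambda>p. forces_mem p (rep Z) (rep X) \<and> forces_nmem p (rep Z) (rep Y)) \<or>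
      large (\<lambda>p. forces_mem p (rep Z) (rep Y) \<and> forces_nmem p (rep Z) (rep X))" by (rule large_disj)
  then show False
  proof (elim disjE, goal_cases)
    case 1
    have "E Z X" unfolding E_iff[OF Z X] by (rule large_mono[OF 1]) blast
    moreover have "\<not> E Z Y" unfolding not_E_iff[OF Z Y] by (rule large_mono[OF 1]) blast
    ultimately show False using eq Z by blast
  next
    case 2
    have "E Z Y" unfolding E_iff[OF Z Y] by (rule large_mono[OF 2]) blast
    moreover have "\<not> E Z X" unfolding not_E_iff[OF Z X] by (rule large_mono[OF 2]) blast
    ultimately show False using eq Z by blast
  qed
qed

end

section \<open>Locally standard elements\<close>

text \<open>The coding tested by \<open>is_tuple\<close>, carried out in the ground
  universe.\<close>

primrec vtuple :: "'v::zfc_universe list \<Rightarrow> 'v" where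
  "vtuple [] = mkset {}"
| "vtuple (a # as) = vpair a (vtuple as)"

lemma vtuple_inject: "length as = length bs \<Longrightarrow> vtuple as = vtuple bs \<longleftrightarrow> as = bs"
  by (induction as bs rule: list_induct2) auto

lemma is_set_empty: "is_set {}"
proof -
  have "is_set {y \<in> elts x. False}" for x :: 'a by (rule separation)
  then show ?thesis by simp
qed

lemma is_set_singleton: "is_set {x}"
  using pairing[of x x] by simp

lemma tuples_Suc: "tuples A (Suc n) = (\<Union>a\<in>A. (#) a ` tuples A n)"
  by (auto simp: tuples_def length_Suc_conv image_iff)

lemma is_set_vtuples:
  assumes "is_set D" shows "is_set (vtuple ` tuples D n)"
proof (induction n)
  case 0
  have "tuples D 0 = {[]}" by (auto simp: tuples_def)
  then show ?case using is_set_singleton by (metis image_empty image_insert)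
next
  case (Suc n)
  have "vtuple ` tuples D (Suc n) = (\<Union>a\<in>D. vpair a ` (vtuple ` tuples D n))"
    unfolding tuples_Suc by (force simp: image_iff)
  then show ?case using is_set_UN[OF assms is_set_image[OF Suc]] by metis
qed

text \<open>Replacement speaks of functions on the universe, whereas tuples are HOL lists; the
  detour through \<open>vtuple\<close>, injective on lists of a given length, brings
  \<open>h\<close> into the required form.\<close>

lemma is_set_vtuple_image:
  fixes h :: "'v::zfc_universe list \<Rightarrow> 'v"
  assumes "is_set D" shows "is_set (h ` tuples D n)"
proof -
  have inj: "inj_on vtuple (tuples D n)"
    by (rule inj_onI) (simp add: tuples_def vtuple_inject)
  have "h ` tuples D n = (\<lambda>z. h (inv_into (tuples D n) vtuple z)) ` (vtuple ` tuples D n)"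
    unfolding image_image using inv_into_f_f[OF inj] by (intro image_cong) simp_all
  then show ?thesis using is_set_image[OF is_set_vtuples[OF assms]] by metis
qed

context boolean_quotient
begin

sublocale cm: class_model W E .

lemma persistent_const: "persistent (\<lambda>p. c)"
  by (simp add: persistent_def)

lemma persistent_conj: "persistent Q \<Longrightarrow> persistent R \<Longrightarrow> persistent (\<lambda>p. Q p \<and> R p)"
  by (auto simp: persistent_def)

lemma persistent_disj: "persistent Q \<Longrightarrow> persistent R \<Longrightarrow> persistent (\<lambda>p. Q p \<or> R p)"
  by (auto simp: persistent_def)

lemma persistent_ex: "(\<And>x. persistent (Q x)) \<Longrightarrow> persistent (\<lambda>p. \<exists>x. Q x p)"
  by (unfold persistent_def) blast

lemma persistent_imp: "persistent R \<Longrightarrow> persistent (\<lambda>p. c \<longrightarrow> R p)"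
  by (auto simp: persistent_def)

lemma persistent_bex: "(\<And>x. persistent (Q x)) \<Longrightarrow> persistent (\<lambda>p. \<exists>x\<in>A. Q x p)"
  by (unfold persistent_def) blast

section \<open>Values decided by conditions\<close>

definition dec :: "'a \<Rightarrow> 'a set \<Rightarrow> 'a \<Rightarrow> bool" where
  "dec p X a \<longleftrightarrow> p \<in> P \<and> forces_eq p (rep X) (chk a)"

lemma dec_unique: "dec p X a \<Longrightarrow> dec p X b \<Longrightarrow> X \<in> W \<Longrightarrow> a = b"
  using forces_eq_trans[of "chk a" "rep X" "chk b" p] forces_eq_sym[of "rep X" "chk a" p] rep(1)[of X]
  unfolding dec_def by simp

lemma dec_down: "dec p X a \<Longrightarrow> q \<in> P \<Longrightarrow> st q p \<Longrightarrow> X \<in> W \<Longrightarrow> dec q X a"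
  using forces_eq_down[of p "rep X" "chk a" q] rep(1)[of X] unfolding dec_def by simp

lemma persistent_dec: "X \<in> W \<Longrightarrow> persistent (\<lambda>p. dec p X a)"
  by (rule persI) (rule dec_down)

definition decs :: "'a \<Rightarrow> 'a set list \<Rightarrow> 'a list \<Rightarrow> bool" where
  "decs p xs as \<longleftrightarrow> list_all2 (dec p) xs as"

lemma decs_simps [simp]:
  "decs p [] as \<longleftrightarrow> as = []"
  "decs p xs [] \<longleftrightarrow> xs = []"
  "decs p (x # xs) (a # as) \<longleftrightarrow> dec p x a \<and> decs p xs as"
  by (auto simp: decs_def)

lemma decs_Cons: "decs p (x # xs) bs \<longleftrightarrow> (\<exists>a as. bs = a # as \<and> dec p x a \<and> decs p xs as)"
  by (cases bs) auto

lemma decs_length: "decs p xs as \<Longrightarrow> length as = length xs"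
  by (simp add: decs_def list_all2_lengthD)

lemma decs_unique: "decs p xs as \<Longrightarrow> decs p xs bs \<Longrightarrow> set xs \<subseteq> W \<Longrightarrow> as = bs"
proof (induction xs arbitrary: as bs)
  case (Cons x xs)
  then show ?case using dec_unique by (auto simp: decs_Cons)
qed simp

lemma decs_down: "decs p xs as \<Longrightarrow> q \<in> P \<Longrightarrow> st q p \<Longrightarrow> set xs \<subseteq> W \<Longrightarrow> decs q xs as"
proof (induction xs arbitrary: as)
  case (Cons x xs)
  then show ?case using dec_down by (auto simp: decs_Cons)
qed simp

lemma persistent_decs: "set xs \<subseteq> W \<Longrightarrow> persistent (\<lambda>p. decs p xs as)"
  by (rule persI) (rule decs_down)

lemmas persistent_intros = persistent_dec persistent_decs persistent_conj persistent_disj persistent_ex persistent_bex persistent_imp persistent_const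

text \<open>
  The elements that are given by persistent partial functions from conditions to the ground
  universe: a condition is sent to the set it decides. They form the Boolean ultrapower of the universe.
\<close>

definition std :: "'a set \<Rightarrow> bool" where
  "std X \<longleftrightarrow> X \<in> W \<and> large (\<lambda>p. \<exists>a. dec p X a)"

lemma std_W: "std X \<Longrightarrow> X \<in> W"
  by (simp add: std_def)

lemma large_decs: "set xs \<subseteq> Collect std \<Longrightarrow> large (\<lambda>p. \<exists>as. decs p xs as)"
proof (induction xs)
  case Nil
  then show ?case using refl by (intro large_all) auto
next
  case (Cons x xs)
  then have x: "large (\<lambda>p. \<exists>a. dec p x a)" "x \<in> W" and xs: "large (\<lambda>p. \<exists>as. decs p xs as)"
    by (simp_all add: std_def)
  show ?case
    by (rule large_both[OF x(1) xs]) (intro persistent_intros x(2), force simp: decs_Cons)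
qed

lemma dec_eqI:
  assumes "X \<in> W" "Y \<in> W" "large (\<lambda>p. \<exists>a. dec p X a \<and> dec p Y a)" shows "X = Y"
proof -
  note n = rep(1)[OF assms(1)] rep(1)[OF assms(2)]
  show ?thesis unfolding W_eq_iff[OF assms(1,2)]
    by (rule large_mono[OF assms(3)])
      (use forces_eq_trans[OF n(1) name_chk n(2)] forces_eq_sym[OF n(2) name_chk] in \<open>auto simp: dec_def\<close>)
qed

lemma forces_mem_dec:
  assumes "forces_mem p (rep X) (rep Y)" "dec p Y b" "X \<in> W" "Y \<in> W"
  obtains q a where "q \<in> P" "st q p" "dec q X a" "a \<in> elts b"
proof -
  note n = rep(1)[OF assms(3)] rep(1)[OF assms(4)]
  have "forces_mem p (rep X) (chk b)"
    using forces_mem_cong_right[OF assms(1) _ n name_chk] assms(2) by (simp add: dec_def)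
  then show thesis by (rule forces_mem_chkD[OF _ n(1)]) (rule that, simp_all add: dec_def)
qed

lemma forces_mem_decI:
  assumes "dec p X a" "dec p Y b" "a \<in> elts b" "X \<in> W" "Y \<in> W"
  shows "forces_mem p (rep X) (rep Y)"
proof -
  note n = rep(1)[OF assms(4)] rep(1)[OF assms(5)]
  have "forces_mem p (rep X) (chk b)" using forces_mem_chkI[OF assms(3) _ n(1)] assms(1) by (simp add: dec_def)
  then show ?thesis
    using forces_mem_cong_right[OF _ forces_eq_sym[OF n(2) name_chk] n(1) name_chk n(2)] assms(2) by (simp add: dec_def)
qed

text \<open>Where \<open>Y\<close> is decided, a condition forcing \<open>X\<close> into it has an
  extension that decides \<open>X\<close> as well. So membership in a locally standard element
  reduces to membership in the ground universe, and members of such elements are again locally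
  standard.\<close>

lemma E_dec_iff:
  assumes "X \<in> W" "std Y"
  shows "E X Y \<longleftrightarrow> large (\<lambda>p. \<exists>a b. dec p X a \<and> dec p Y b \<and> a \<in> elts b)"
proof
  have Y: "Y \<in> W" "large (\<lambda>p. \<exists>b. dec p Y b)" using assms(2) by (simp_all add: std_def)
  show "large (\<lambda>p. \<exists>a b. dec p X a \<and> dec p Y b \<and> a \<in> elts b)" if "E X Y"
  proof (rule large_combine[OF Y(2)])
    show "large (\<lambda>p. forces_mem p (rep X) (rep Y))" using that E_iff assms Y by blast
    show "persistent (\<lambda>p. \<exists>b. dec p Y b)" by (intro persistent_intros Y)
    fix p assume "\<exists>b. dec p Y b" and forces_mem: "forces_mem p (rep X) (rep Y)"
    then obtain b where b: "dec p Y b" by blast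
    show "\<exists>q\<in>P. st q p \<and> (\<exists>a b. dec q X a \<and> dec q Y b \<and> a \<in> elts b)"
      by (rule forces_mem_dec[OF forces_mem b assms(1) Y(1)]) (use dec_down[OF b _ _ Y(1)] in blast)
  qed
  show "E X Y" if "large (\<lambda>p. \<exists>a b. dec p X a \<and> dec p Y b \<and> a \<in> elts b)"
    unfolding E_iff[OF assms(1) Y(1)]
    by (rule large_mono[OF that]) (use forces_mem_decI[OF _ _ _ assms(1) Y(1)] in blast)
qed

lemma std_E: "E X Y \<Longrightarrow> X \<in> W \<Longrightarrow> std Y \<Longrightarrow> std X"
  unfolding std_def[of X] by (auto simp: E_dec_iff elim!: large_mono)

text \<open>Fullness restricted to check names. This is the basic construction of elements: a rule
  attaching ground sets to conditions persistently is realized by one locally standard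
  element.\<close>

lemma lift:
  assumes "\<And>a. persistent (\<lambda>p. w p a)" and "large (\<lambda>p. \<exists>a. w p a)"
  obtains Z where "std Z" "large (\<lambda>p. \<exists>a. w p a \<and> dec p Z a)"
proof -
  have p: "persistent (\<lambda>p. \<exists>a. \<sigma> = chk a \<and> w p a)" for \<sigma> by (intro persistent_intros assms)
  have "large (\<lambda>p. \<exists>\<sigma>. name B \<sigma> \<and> (\<exists>a. \<sigma> = chk a \<and> w p a))"
    by (rule large_mono[OF assms(2)]) (use name_chk in blast)
  then obtain Z where Z: "Z \<in> W" "large (\<lambda>p. \<exists>\<sigma>. name B \<sigma> \<and> (\<exists>a. \<sigma> = chk a \<and> w p a) \<and> forces_eq p (rep Z) \<sigma>)"
    by (rule W_maximum[OF p])
  have large: "large (\<lambda>p. \<exists>a. w p a \<and> dec p Z a)"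
    by (rule large_mono[OF Z(2)]) (auto simp: dec_def)
  moreover have "std Z" unfolding std_def using Z(1) by (auto intro: large_mono[OF large])
  ultimately show thesis using that by blast
qed

lemma lift_list:
  assumes "\<And>as. persistent (\<lambda>p. w p as)" and "large (\<lambda>p. \<exists>as. length as = n \<and> w p as)"
  shows "\<exists>xs. set xs \<subseteq> Collect std \<and> length xs = n \<and> large (\<lambda>p. \<exists>as. w p as \<and> decs p xs as)"
  using assms
proof (induction n arbitrary: w)
  case 0
  have "large (\<lambda>p. \<exists>as. w p as \<and> decs p [] as)" by (rule large_mono[OF 0(2)]) auto
  then show ?case by (intro exI[of _ "[]"]) simp
next
  case (Suc n)
  have p: "persistent (\<lambda>p. \<exists>as. length as = n \<and> w p (a # as))" for a by (intro persistent_intros Suc(2))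
  have "large (\<lambda>p. \<exists>a as. length as = n \<and> w p (a # as))"
    by (rule large_mono[OF Suc(3)]) (auto simp: length_Suc_conv)
  then obtain Z where Z: "std Z" "large (\<lambda>p. \<exists>a. (\<exists>as. length as = n \<and> w p (a # as)) \<and> dec p Z a)"
    by (rule lift[OF p])
  \<comment> \<open>The predicate for the remaining coordinates mentions the value decided for
    \<open>Z\<close>, so that the tail is chosen to fit that same head.\<close>
  have p': "persistent (\<lambda>p. \<exists>a. dec p Z a \<and> w p (a # as))" for as
    by (intro persistent_intros Suc(2) std_W Z(1))
  have "large (\<lambda>p. \<exists>as. length as = n \<and> (\<exists>a. dec p Z a \<and> w p (a # as)))"
    by (rule large_mono[OF Z(2)]) blast
  from Suc.IH[OF p' this] obtain xs where xs: "set xs \<subseteq> Collect std" "length xs = n"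
    "large (\<lambda>p. \<exists>as. (\<exists>a. dec p Z a \<and> w p (a # as)) \<and> decs p xs as)" by blast
  have "large (\<lambda>p. \<exists>as. w p as \<and> decs p (Z # xs) as)"
    by (rule large_mono[OF xs(3)]) (auto simp: decs_Cons)
  then show ?case using xs Z(1) by (intro exI[of _ "Z # xs"]) simp
qed

definition j :: "'a \<Rightarrow> 'a set" where "j a = cls (chk a)"

lemma large_j: "large (\<lambda>p. dec p (j a) a)"
  unfolding j_def dec_def by (rule large_mono[OF large_rep_cls]) simp_all

lemma std_j [simp]: "std (j a)"
  unfolding std_def by (auto simp: j_def[of a] intro!: large_mono[OF large_j[of a, unfolded j_def]])

lemma W_j [simp]: "j a \<in> W"
  by (simp add: std_W)

lemma E_j_iff:
  assumes X: "X \<in> W" shows "E X (j b) \<longleftrightarrow> large (\<lambda>p. \<exists>a\<in>elts b. dec p X a)"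
proof -
  have "large (\<lambda>p. \<exists>a\<in>elts b. dec p X a)" if "large (\<lambda>p. \<exists>a c. dec p X a \<and> dec p (j b) c \<and> a \<in> elts c)"
    by (rule large_both[OF large_j[of b] that persistent_dec[OF W_j]]) (use dec_unique[OF _ _ W_j] in blast)
  moreover have "large (\<lambda>p. \<exists>a c. dec p X a \<and> dec p (j b) c \<and> a \<in> elts c)" if "large (\<lambda>p. \<exists>a\<in>elts b. dec p X a)"
    by (rule large_both[OF large_j[of b] that persistent_dec[OF W_j]]) blast
  ultimately show ?thesis using E_dec_iff[OF X std_j] by blast
qed

lemma j_eq_iff [simp]: "j a = j b \<longleftrightarrow> a = b"
proof
  assume "j a = j b"
  then have b: "large (\<lambda>p. dec p (j a) b)" using large_j[of b] by simp
  show "a = b"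
  proof (rule ccontr)
    assume "a \<noteq> b"
    then show False using large_conflict[OF large_j[of a] b persistent_dec[OF W_j]] dec_unique[OF _ _ W_j] by blast
  qed
qed simp

lemma dec_jI: "large (\<lambda>p. dec p X a) \<Longrightarrow> X \<in> W \<Longrightarrow> X = j a"
  by (rule dec_eqI[OF _ W_j large_both[OF large_j[of a] _ persistent_dec[OF W_j]]]) blast+

section \<open>Pairs and tuples as the quotient sees them\<close>

lemma mem_upair:
  assumes X: "std X" and Y: "std Y" and V: "V \<in> W" and Z: "Z \<in> W"
    and large: "large (\<lambda>p. \<exists>a b. dec p X a \<and> dec p Y b \<and> dec p V (mkset {a, b}))"
  shows "E Z V \<longleftrightarrow> Z = X \<or> Z = Y"
proof -
  note w = std_W[OF X] std_W[OF Y]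
  have sV: "std V" unfolding std_def using V by (auto intro: large_mono[OF large])
  have persistent: "persistent (\<lambda>p. \<exists>a b. dec p X a \<and> dec p Y b \<and> dec p V (mkset {a, b}))"
    by (intro persistent_intros w V)
  have "Z = X \<or> Z = Y" if "E Z V"
  proof -
    have "large (\<lambda>p. \<exists>c d. dec p Z c \<and> dec p V d \<and> c \<in> elts d)"
      using that by (simp add: E_dec_iff[OF Z sV])
    \<comment> \<open>Which of the two components \<open>Z\<close> equals may vary with the
      condition; primality afterwards settles on one of them.\<close>
    then have "large (\<lambda>p. (\<exists>a. dec p Z a \<and> dec p X a) \<or> (\<exists>a. dec p Z a \<and> dec p Y a))"
    proof (rule large_both[OF large _ persistent])
      fix p assume "\<exists>a b. dec p X a \<and> dec p Y b \<and> dec p V (mkset {a, b})"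
        and "\<exists>c d. dec p Z c \<and> dec p V d \<and> c \<in> elts d"
      then obtain a b c d where *: "dec p X a" "dec p Y b" "dec p V (mkset {a, b})"
        "dec p Z c" "dec p V d" "c \<in> elts d" by blast
      then have "d = mkset {a, b}" using dec_unique V by blast
      then show "(\<exists>a. dec p Z a \<and> dec p X a) \<or> (\<exists>a. dec p Z a \<and> dec p Y a)"
        using * by (auto simp: elts_mkset_pair)
    qed
    then have "large (\<lambda>p. \<exists>a. dec p Z a \<and> dec p X a) \<or> large (\<lambda>p. \<exists>a. dec p Z a \<and> dec p Y a)" by (rule large_disj)
    then show ?thesis using dec_eqI[OF Z] w by blast
  qed
  moreover have m: "a \<in> elts (mkset {a, b})" "b \<in> elts (mkset {a, b})" for a b :: 'a
    by (simp_all add: elts_mkset_pair)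
  have "E X V" unfolding E_dec_iff[OF w(1) sV] by (rule large_mono[OF large]) (use m in blast)
  moreover have "E Y V" unfolding E_dec_iff[OF w(2) sV] by (rule large_mono[OF large]) (use m in blast)
  ultimately show ?thesis by blast
qed

text \<open>Lets a binary operation of the ground universe act on locally standard elements
  condition by condition, as in a Boolean ultrapower.\<close>

lemma lift2:
  assumes X: "std X" and Y: "std Y"
  obtains Z where "std Z" "large (\<lambda>p. \<exists>a b. dec p X a \<and> dec p Y b \<and> dec p Z (f a b))"
proof -
  note w = std_W[OF X] std_W[OF Y]
  have large: "large (\<lambda>p. \<exists>c. \<exists>a b. dec p X a \<and> dec p Y b \<and> c = f a b)"
    by (rule large_both[of "\<lambda>p. \<exists>a. dec p X a" "\<lambda>p. \<exists>b. dec p Y b"])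
      (use X Y in \<open>auto simp: std_def intro!: persistent_intros\<close>)
  have p: "persistent (\<lambda>p. \<exists>a b. dec p X a \<and> dec p Y b \<and> c = f a b)" for c
    by (intro persistent_intros w)
  obtain Z where Z: "std Z" "large (\<lambda>p. \<exists>c. (\<exists>a b. dec p X a \<and> dec p Y b \<and> c = f a b) \<and> dec p Z c)"
    by (rule lift[OF p large])
  have "large (\<lambda>p. \<exists>a b. dec p X a \<and> dec p Y b \<and> dec p Z (f a b))"
    by (rule large_mono[OF Z(2)]) blast
  then show thesis using that Z(1) by blast
qed

text \<open>From right to left \<open>mem_upair\<close> computes the members. From left to right,
  the pair \<open>Z\<close> built condition by condition has the same members as \<open>V\<close>,
  and extensionality identifies the two.\<close>

lemma is_upair_iff:
  assumes X: "std X" and Y: "std Y" and V: "V \<in> W"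
  shows "cm.is_upair X Y V \<longleftrightarrow> large (\<lambda>p. \<exists>a b. dec p X a \<and> dec p Y b \<and> dec p V (mkset {a, b}))"
proof
  show "cm.is_upair X Y V" if "large (\<lambda>p. \<exists>a b. dec p X a \<and> dec p Y b \<and> dec p V (mkset {a, b}))"
    using mem_upair[OF X Y V _ that] by (simp add: cm.is_upair_def)
  assume u: "cm.is_upair X Y V"
  obtain Z where Z: "std Z" "large (\<lambda>p. \<exists>a b. dec p X a \<and> dec p Y b \<and> dec p Z (mkset {a, b}))"
    by (rule lift2[OF X Y])
  have "V = Z"
    using mem_upair[OF X Y std_W[OF Z(1)] _ Z(2)] u
    by (intro W_extensionality[OF V std_W[OF Z(1)]]) (simp add: cm.is_upair_def)
  then show "large (\<lambda>p. \<exists>a b. dec p X a \<and> dec p Y b \<and> dec p V (mkset {a, b}))" using Z(2) by simp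
qed

text \<open>A Kuratowski pair consists of three unordered pairs, each handled by
  \<open>is_upair_iff\<close>; the local components fit together because a condition decides at most
  one value.\<close>

lemma is_pair_iff:
  assumes X: "std X" and Y: "std Y" and V: "V \<in> W"
  shows "cm.is_pair X Y V \<longleftrightarrow> large (\<lambda>p. \<exists>a b. dec p X a \<and> dec p Y b \<and> dec p V (vpair a b))"
proof
  note w = std_W[OF X] std_W[OF Y]
  assume "cm.is_pair X Y V"
  then obtain u v where uv: "u \<in> W" "v \<in> W" "cm.is_upair X X u" "cm.is_upair X Y v" "cm.is_upair u v V"
    unfolding cm.is_pair_def by blast
  have L1: "large (\<lambda>p. \<exists>a b. dec p X a \<and> dec p X b \<and> dec p u (mkset {a, b}))"
    using uv is_upair_iff[OF X X] by blast
  have L2: "large (\<lambda>p. \<exists>a b. dec p X a \<and> dec p Y b \<and> dec p v (mkset {a, b}))"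
    using uv is_upair_iff[OF X Y] by blast
  have s: "std u" "std v" unfolding std_def using uv by (auto intro: large_mono[OF L1] large_mono[OF L2])
  have L3: "large (\<lambda>p. \<exists>a b. dec p u a \<and> dec p v b \<and> dec p V (mkset {a, b}))"
    using uv V is_upair_iff[OF s] by blast
  have L12: "large (\<lambda>p. \<exists>a b. dec p X a \<and> dec p Y b \<and> dec p u (mkset {a}) \<and> dec p v (mkset {a, b}))"
  proof (rule large_both[OF L1 L2])
    show "persistent (\<lambda>p. \<exists>a b. dec p X a \<and> dec p X b \<and> dec p u (mkset {a, b}))"
      by (intro persistent_intros w uv)
    fix p assume "\<exists>a b. dec p X a \<and> dec p X b \<and> dec p u (mkset {a, b})"
      "\<exists>a b. dec p X a \<and> dec p Y b \<and> dec p v (mkset {a, b})"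
    then obtain a a1 a2 b where *: "dec p X a1" "dec p X a2" "dec p u (mkset {a1, a2})" "dec p X a"
      "dec p Y b" "dec p v (mkset {a, b})" by blast
    then have "a1 = a" "a2 = a" using dec_unique w by blast+
    then show "\<exists>a b. dec p X a \<and> dec p Y b \<and> dec p u (mkset {a}) \<and> dec p v (mkset {a, b})"
      using * by auto
  qed
  show "large (\<lambda>p. \<exists>a b. dec p X a \<and> dec p Y b \<and> dec p V (vpair a b))"
  proof (rule large_both[OF L12 L3])
    show "persistent (\<lambda>p. \<exists>a b. dec p X a \<and> dec p Y b \<and> dec p u (mkset {a}) \<and> dec p v (mkset {a, b}))"
      by (intro persistent_intros w uv)
    fix p assume "\<exists>a b. dec p X a \<and> dec p Y b \<and> dec p u (mkset {a}) \<and> dec p v (mkset {a, b})"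
      "\<exists>a b. dec p u a \<and> dec p v b \<and> dec p V (mkset {a, b})"
    then obtain a b c d where *: "dec p X a" "dec p Y b" "dec p u (mkset {a})" "dec p v (mkset {a, b})"
      "dec p u c" "dec p v d" "dec p V (mkset {c, d})" by blast
    then have "c = mkset {a}" "d = mkset {a, b}" using dec_unique uv by blast+
    then show "\<exists>a b. dec p X a \<and> dec p Y b \<and> dec p V (vpair a b)"
      using * by (auto simp: vpair_def)
  qed
next
  note w = std_W[OF X] std_W[OF Y]
  assume large: "large (\<lambda>p. \<exists>a b. dec p X a \<and> dec p Y b \<and> dec p V (vpair a b))"
  obtain u where u: "std u" "large (\<lambda>p. \<exists>a b. dec p X a \<and> dec p X b \<and> dec p u (mkset {a, b}))"
    by (rule lift2[OF X X])
  obtain v where v: "std v" "large (\<lambda>p. \<exists>a b. dec p X a \<and> dec p Y b \<and> dec p v (mkset {a, b}))"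
    by (rule lift2[OF X Y])
  note w' = std_W[OF u(1)] std_W[OF v(1)]
  have L1: "large (\<lambda>p. \<exists>a b. dec p X a \<and> dec p u (mkset {a, a}) \<and> dec p V (vpair a b) \<and> dec p Y b)"
  proof (rule large_both[OF large u(2)])
    show "persistent (\<lambda>p. \<exists>a b. dec p X a \<and> dec p Y b \<and> dec p V (vpair a b))" by (intro persistent_intros w V)
    fix p assume "\<exists>a b. dec p X a \<and> dec p Y b \<and> dec p V (vpair a b)"
      "\<exists>a b. dec p X a \<and> dec p X b \<and> dec p u (mkset {a, b})"
    then obtain a b c d where *: "dec p X a" "dec p Y b" "dec p V (vpair a b)"
      "dec p X c" "dec p X d" "dec p u (mkset {c, d})" by blast
    then have "c = a" "d = a" using dec_unique w by blast+
    then show "\<exists>a b. dec p X a \<and> dec p u (mkset {a, a}) \<and> dec p V (vpair a b) \<and> dec p Y b"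
      using * by blast
  qed
  have "large (\<lambda>p. \<exists>a b. dec p u a \<and> dec p v b \<and> dec p V (mkset {a, b}))"
  proof (rule large_both[OF L1 v(2)])
    show "persistent (\<lambda>p. \<exists>a b. dec p X a \<and> dec p u (mkset {a, a}) \<and> dec p V (vpair a b) \<and> dec p Y b)"
      by (intro persistent_intros w V w')
    fix p assume "\<exists>a b. dec p X a \<and> dec p u (mkset {a, a}) \<and> dec p V (vpair a b) \<and> dec p Y b"
      "\<exists>a b. dec p X a \<and> dec p Y b \<and> dec p v (mkset {a, b})"
    then obtain a b c d where *: "dec p X a" "dec p u (mkset {a, a})" "dec p Y b" "dec p V (vpair a b)"
      "dec p X c" "dec p Y d" "dec p v (mkset {c, d})" by blast
    then have "c = a" "d = b" using dec_unique w by blast+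
    then show "\<exists>a b. dec p u a \<and> dec p v b \<and> dec p V (mkset {a, b})"
      using * by (auto simp: vpair_def)
  qed
  then have "cm.is_upair u v V" using is_upair_iff[OF u(1) v(1) V] by blast
  moreover have "cm.is_upair X X u" "cm.is_upair X Y v"
    using u(2) v(2) is_upair_iff[OF X X w'(1)] is_upair_iff[OF X Y w'(2)] by blast+
  ultimately show "cm.is_pair X Y V" using w' unfolding cm.is_pair_def by blast
qed

lemma is_empty_iff: "X \<in> W \<Longrightarrow> cm.is_empty X \<longleftrightarrow> X = j (mkset {})"
proof -
  assume X: "X \<in> W"
  have "\<not> E Z (j (mkset {}))" if "Z \<in> W" for Z
    using that large_False by (simp add: E_j_iff elts_mkset[OF is_set_empty])
  then show ?thesis
    using W_extensionality[OF X W_j, of "mkset {}"] unfolding cm.is_empty_def by auto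
qed

text \<open>The list has standard length, so external induction over it is legitimate. The tail
  \<open>s\<close> is locally standard because its value is decided on a large set, which makes
  \<open>is_pair_iff\<close> applicable.\<close>

lemma is_tuple_iff:
  assumes "set xs \<subseteq> Collect std" "V \<in> W"
  shows "cm.is_tuple xs V \<longleftrightarrow> large (\<lambda>p. \<exists>as. decs p xs as \<and> dec p V (vtuple as))"
  using assms
proof (induction xs arbitrary: V)
  case Nil
  have "V = j (mkset {}) \<longleftrightarrow> large (\<lambda>p. dec p V (mkset {}))"
    using large_j[of "mkset {}"] dec_jI[of V "mkset {}"] Nil by blast
  then show ?case using Nil by (simp add: is_empty_iff)
next
  case (Cons x xs)
  then have x: "std x" and xs: "set xs \<subseteq> Collect std" "set xs \<subseteq> W" and V: "V \<in> W"
    using std_W by auto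
  note IH = Cons.IH[OF xs(1)]
  show ?case
  proof
    assume "cm.is_tuple (x # xs) V"
    then obtain s where s: "s \<in> W" "cm.is_tuple xs s" "cm.is_pair x s V" by auto
    have L1: "large (\<lambda>p. \<exists>as. decs p xs as \<and> dec p s (vtuple as))" using IH s by blast
    then have ss: "std s" unfolding std_def using s(1) by (auto elim: large_mono)
    have L2: "large (\<lambda>p. \<exists>a b. dec p x a \<and> dec p s b \<and> dec p V (vpair a b))"
      using is_pair_iff[OF x ss V] s(3) by blast
    show "large (\<lambda>p. \<exists>as. decs p (x # xs) as \<and> dec p V (vtuple as))"
    proof (rule large_both[OF L1 L2])
      show "persistent (\<lambda>p. \<exists>as. decs p xs as \<and> dec p s (vtuple as))" by (intro persistent_intros xs s)
      fix p assume "\<exists>as. decs p xs as \<and> dec p s (vtuple as)"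
        "\<exists>a b. dec p x a \<and> dec p s b \<and> dec p V (vpair a b)"
      then obtain as a b where *: "decs p xs as" "dec p s (vtuple as)" "dec p x a" "dec p s b" "dec p V (vpair a b)"
        by blast
      then have "b = vtuple as" using dec_unique s(1) by blast
      then show "\<exists>as. decs p (x # xs) as \<and> dec p V (vtuple as)"
        using * by (intro exI[of _ "a # as"]) simp
    qed
  next
    assume large: "large (\<lambda>p. \<exists>as. decs p (x # xs) as \<and> dec p V (vtuple as))"
    have p: "persistent (\<lambda>p. \<exists>as. decs p xs as \<and> c = vtuple as)" for c by (intro persistent_intros xs)
    have "large (\<lambda>p. \<exists>c as. decs p xs as \<and> c = vtuple as)"
      by (rule large_mono[OF large_decs[OF xs(1)]]) blast
    then obtain s where s: "std s" "large (\<lambda>p. \<exists>c. (\<exists>as. decs p xs as \<and> c = vtuple as) \<and> dec p s c)"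
      by (rule lift[OF p])
    have "large (\<lambda>p. \<exists>as. decs p xs as \<and> dec p s (vtuple as))"
      by (rule large_mono[OF s(2)]) blast
    then have t: "cm.is_tuple xs s" using IH[OF std_W[OF s(1)]] by blast
    have "large (\<lambda>p. \<exists>a b. dec p x a \<and> dec p s b \<and> dec p V (vpair a b))"
    proof (rule large_both[OF large s(2)])
      show "persistent (\<lambda>p. \<exists>as. decs p (x # xs) as \<and> dec p V (vtuple as))"
        using std_W[OF x] xs by (intro persistent_intros V) auto
      fix p assume "\<exists>as. decs p (x # xs) as \<and> dec p V (vtuple as)"
        "\<exists>c. (\<exists>as. decs p xs as \<and> c = vtuple as) \<and> dec p s c"
      then obtain a as bs where *: "dec p x a" "decs p xs as" "dec p V (vtuple (a # as))"
        "decs p xs bs" "dec p s (vtuple bs)" by (auto simp: decs_Cons)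
      then have "bs = as" using decs_unique xs(2) by blast
      then show "\<exists>a b. dec p x a \<and> dec p s b \<and> dec p V (vpair a b)" using * by auto
    qed
    then have "cm.is_pair x s V" using is_pair_iff[OF x s(1) V] by blast
    then show "cm.is_tuple (x # xs) V" using t std_W[OF s(1)] by auto
  qed
qed

lemma tuple_exists:
  assumes "set xs \<subseteq> Collect std"
  obtains V where "std V" "cm.is_tuple xs V" "large (\<lambda>p. \<exists>as. decs p xs as \<and> dec p V (vtuple as))"
proof -
  have xs: "set xs \<subseteq> W" using assms std_W by auto
  have p: "persistent (\<lambda>p. \<exists>as. decs p xs as \<and> c = vtuple as)" for c by (intro persistent_intros xs)
  have "large (\<lambda>p. \<exists>c as. decs p xs as \<and> c = vtuple as)"
    by (rule large_mono[OF large_decs[OF assms]]) blast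
  then obtain s where s: "std s" "large (\<lambda>p. \<exists>c. (\<exists>as. decs p xs as \<and> c = vtuple as) \<and> dec p s c)"
    by (rule lift[OF p])
  have large: "large (\<lambda>p. \<exists>as. decs p xs as \<and> dec p s (vtuple as))"
    by (rule large_mono[OF s(2)]) blast
  then show thesis using that s(1) is_tuple_iff[OF assms std_W[OF s(1)]] by blast
qed

section \<open>Ground relations and functions seen through \<open>j\<close>\<close>

lemma holds_at_j_iff:
  assumes xs: "set xs \<subseteq> Collect std"
  shows "cm.holds_at (j R) xs \<longleftrightarrow> large (\<lambda>p. \<exists>as. decs p xs as \<and> vtuple as \<in> elts R)"
proof
  have xW: "set xs \<subseteq> W" using xs std_W by auto
  assume "cm.holds_at (j R) xs"
  then obtain t where t: "t \<in> W" "cm.is_tuple xs t" "E t (j R)" unfolding cm.holds_at_def by blast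
  have 1: "large (\<lambda>p. \<exists>as. decs p xs as \<and> dec p t (vtuple as))" using t is_tuple_iff[OF xs] by blast
  have 2: "large (\<lambda>p. \<exists>a\<in>elts R. dec p t a)" using t E_j_iff by blast
  show "large (\<lambda>p. \<exists>as. decs p xs as \<and> vtuple as \<in> elts R)"
    by (rule large_both[OF 1 2]) (intro persistent_intros xW t(1), use dec_unique[OF _ _ t(1)] in blast)
next
  have xW: "set xs \<subseteq> W" using xs std_W by auto
  assume large: "large (\<lambda>p. \<exists>as. decs p xs as \<and> vtuple as \<in> elts R)"
  obtain t where t: "std t" "cm.is_tuple xs t" "large (\<lambda>p. \<exists>as. decs p xs as \<and> dec p t (vtuple as))"
    by (rule tuple_exists[OF xs])
  have "E t (j R)" unfolding E_j_iff[OF std_W[OF t(1)]]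
  proof (rule large_both[OF t(3) large])
    show "persistent (\<lambda>p. \<exists>as. decs p xs as \<and> dec p t (vtuple as))"
      by (intro persistent_intros xW std_W t(1))
    fix p assume "\<exists>as. decs p xs as \<and> dec p t (vtuple as)" "\<exists>as. decs p xs as \<and> vtuple as \<in> elts R"
    then show "\<exists>a\<in>elts R. dec p t a" using decs_unique[OF _ _ xW] by blast
  qed
  then show "cm.holds_at (j R) xs" using t std_W unfolding cm.holds_at_def by blast
qed

lemma pair_exists:
  assumes "std X" "std Y"
  obtains V where "std V" "cm.is_pair X Y V" "large (\<lambda>p. \<exists>a b. dec p X a \<and> dec p Y b \<and> dec p V (vpair a b))"
proof -
  obtain V where V: "std V" "large (\<lambda>p. \<exists>a b. dec p X a \<and> dec p Y b \<and> dec p V (vpair a b))"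
    by (rule lift2[OF assms])
  then show thesis using that is_pair_iff[OF assms std_W[OF V(1)]] by blast
qed

lemma maps_to_j_iff:
  assumes X: "std X" and Y: "std Y"
  shows "cm.maps_to (j F) X Y \<longleftrightarrow> large (\<lambda>p. \<exists>a b. dec p X a \<and> dec p Y b \<and> vpair a b \<in> elts F)"
proof
  note w = std_W[OF X] std_W[OF Y]
  assume "cm.maps_to (j F) X Y"
  then obtain V where V: "V \<in> W" "cm.is_pair X Y V" "E V (j F)" unfolding cm.maps_to_def by blast
  have 1: "large (\<lambda>p. \<exists>a b. dec p X a \<and> dec p Y b \<and> dec p V (vpair a b))" using V is_pair_iff[OF X Y] by blast
  have 2: "large (\<lambda>p. \<exists>a\<in>elts F. dec p V a)" using V E_j_iff by blast
  show "large (\<lambda>p. \<exists>a b. dec p X a \<and> dec p Y b \<and> vpair a b \<in> elts F)"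
    by (rule large_both[OF 1 2]) (intro persistent_intros w V(1), use dec_unique[OF _ _ V(1)] in blast)
next
  note w = std_W[OF X] std_W[OF Y]
  assume large: "large (\<lambda>p. \<exists>a b. dec p X a \<and> dec p Y b \<and> vpair a b \<in> elts F)"
  obtain V where V: "std V" "cm.is_pair X Y V" "large (\<lambda>p. \<exists>a b. dec p X a \<and> dec p Y b \<and> dec p V (vpair a b))"
    by (rule pair_exists[OF X Y])
  have "E V (j F)" unfolding E_j_iff[OF std_W[OF V(1)]]
  proof (rule large_both[OF V(3) large])
    show "persistent (\<lambda>p. \<exists>a b. dec p X a \<and> dec p Y b \<and> dec p V (vpair a b))"
      by (intro persistent_intros w std_W V(1))
    fix p assume "\<exists>a b. dec p X a \<and> dec p Y b \<and> dec p V (vpair a b)"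
      "\<exists>a b. dec p X a \<and> dec p Y b \<and> vpair a b \<in> elts F"
    then show "\<exists>a\<in>elts F. dec p V a" using dec_unique[OF _ _ w(1)] dec_unique[OF _ _ w(2)] by blast
  qed
  then show "cm.maps_to (j F) X Y" using V std_W unfolding cm.maps_to_def by blast
qed

lemma value_at_j_iff:
  assumes xs: "set xs \<subseteq> Collect std" and Y: "std Y"
  shows "cm.value_at (j F) xs Y \<longleftrightarrow>
    large (\<lambda>p. \<exists>as b. decs p xs as \<and> dec p Y b \<and> vpair (vtuple as) b \<in> elts F)"
proof
  have xW: "set xs \<subseteq> W" using xs std_W by auto
  note w = std_W[OF Y]
  assume "cm.value_at (j F) xs Y"
  then obtain t where t: "t \<in> W" "cm.is_tuple xs t" "cm.maps_to (j F) t Y"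
    unfolding cm.value_at_def by blast
  have 1: "large (\<lambda>p. \<exists>as. decs p xs as \<and> dec p t (vtuple as))" using t is_tuple_iff[OF xs] by blast
  then have st: "std t" unfolding std_def using t(1) by (auto elim: large_mono)
  have 2: "large (\<lambda>p. \<exists>a b. dec p t a \<and> dec p Y b \<and> vpair a b \<in> elts F)"
    using t maps_to_j_iff[OF st Y] by blast
  show "large (\<lambda>p. \<exists>as b. decs p xs as \<and> dec p Y b \<and> vpair (vtuple as) b \<in> elts F)"
    by (rule large_both[OF 1 2]) (intro persistent_intros xW t(1), use dec_unique[OF _ _ t(1)] in blast)
next
  have xW: "set xs \<subseteq> W" using xs std_W by auto
  note w = std_W[OF Y]
  assume large: "large (\<lambda>p. \<exists>as b. decs p xs as \<and> dec p Y b \<and> vpair (vtuple as) b \<in> elts F)"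
  obtain t where t: "std t" "cm.is_tuple xs t" "large (\<lambda>p. \<exists>as. decs p xs as \<and> dec p t (vtuple as))"
    by (rule tuple_exists[OF xs])
  have "cm.maps_to (j F) t Y" unfolding maps_to_j_iff[OF t(1) Y]
  proof (rule large_both[OF t(3) large])
    show "persistent (\<lambda>p. \<exists>as. decs p xs as \<and> dec p t (vtuple as))"
      by (intro persistent_intros xW std_W t(1))
    fix p assume "\<exists>as. decs p xs as \<and> dec p t (vtuple as)"
      "\<exists>as b. decs p xs as \<and> dec p Y b \<and> vpair (vtuple as) b \<in> elts F"
    then show "\<exists>a b. dec p t a \<and> dec p Y b \<and> vpair a b \<in> elts F" using decs_unique[OF _ _ xW] by blast
  qed
  then show "cm.value_at (j F) xs Y" using t std_W unfolding cm.value_at_def by blast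
qed

end

section \<open>The Boolean ultrapower of a structure\<close>

text \<open>Ultrafilters are closed under finite meets, so only finitely many variables of an
  assignment can be expected to be decided together. The bound \<open>k\<close> makes their number
  explicit.\<close>

fun tm_below :: "nat \<Rightarrow> tm \<Rightarrow> bool" where
  "tm_below k (Var n) \<longleftrightarrow> n < k"
| "tm_below k (App i ts) \<longleftrightarrow> (\<forall>t\<in>set ts. tm_below k t)"

text \<open>Quantified variables are bounded as well, so that an update at \<open>n\<close> concerns
  one of the decided places.\<close>

fun fm_below :: "nat \<Rightarrow> fm \<Rightarrow> bool" where
  "fm_below k (Eq s t) \<longleftrightarrow> tm_below k s \<and> tm_below k t"
| "fm_below k (Atom i ts) \<longleftrightarrow> (\<forall>t\<in>set ts. tm_below k t)"
| "fm_below k (Neg \<phi>) \<longleftrightarrow> fm_below k \<phi>"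
| "fm_below k (Conj \<phi> \<psi>) \<longleftrightarrow> fm_below k \<phi> \<and> fm_below k \<psi>"
| "fm_below k (Exists n \<phi>) \<longleftrightarrow> n < k \<and> fm_below k \<phi>"

lemma tm_below_mono: "tm_below k t \<Longrightarrow> k \<le> l \<Longrightarrow> tm_below l t"
  by (induction t) auto

lemma fm_below_mono: "fm_below k \<phi> \<Longrightarrow> k \<le> l \<Longrightarrow> fm_below l \<phi>"
  by (induction \<phi>) (auto intro: tm_below_mono)

lemma tms_below_exists:
  "(\<And>t. t \<in> set ts \<Longrightarrow> \<exists>k. tm_below k t) \<Longrightarrow> \<exists>k. \<forall>t\<in>set ts. tm_below k t"
proof (induction ts)
  case (Cons t ts)
  then obtain k where "\<forall>t\<in>set ts. tm_below k t" by auto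
  moreover obtain l where "tm_below l t" using Cons.prems by auto
  ultimately have "\<forall>s\<in>set (t # ts). tm_below (max k l) s" by (auto intro: tm_below_mono)
  then show ?case by blast
qed simp

lemma tm_below_exists: "\<exists>k. tm_below k t"
proof (induction t)
  case (Var n)
  have "tm_below (Suc n) (Var n)" by simp
  then show ?case by blast
next
  case (App i ts)
  then show ?case using tms_below_exists[of ts] by simp
qed

lemma fm_below_exists: "\<exists>k. fm_below k \<phi>"
proof (induction \<phi>)
  case (Eq s t)
  obtain k l where "tm_below k s" "tm_below l t" using tm_below_exists by metis
  then have "fm_below (max k l) (Eq s t)" by (auto intro: tm_below_mono)
  then show ?case by blast
next
  case (Atom i ts)
  then show ?case using tms_below_exists[of ts] tm_below_exists by simp
next
  case (Conj \<phi> \<psi>)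
  then obtain k l where "fm_below k \<phi>" "fm_below l \<psi>" by blast
  then have "fm_below (max k l) (Conj \<phi> \<psi>)" by (auto intro: fm_below_mono)
  then show ?case by blast
next
  case (Exists n \<phi>)
  then obtain k where "fm_below k \<phi>" by blast
  then have "fm_below (max k (Suc n)) (Exists n \<phi>)" by (auto intro: fm_below_mono)
  then show ?case by blast
qed auto

lemma tm_val_cong: "tm_below k t \<Longrightarrow> (\<And>i. i < k \<Longrightarrow> e i = e' i) \<Longrightarrow> tm_val M e t = tm_val M e' t"
proof (induction t)
  case (App i ts)
  then have "map (tm_val M e) ts = map (tm_val M e') ts" by simp
  then show ?case by (simp only: tm_val.simps)
qed simp

lemma sat_cong: "fm_below k \<phi> \<Longrightarrow> (\<And>i. i < k \<Longrightarrow> e i = e' i) \<Longrightarrow> sat M e \<phi> = sat M e' \<phi>"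
proof (induction \<phi> arbitrary: e e')
  case (Eq s t)
  then show ?case using tm_val_cong[of k _ e e' M] by simp
next
  case (Atom i ts)
  then have "map (tm_val M e) ts = map (tm_val M e') ts" using tm_val_cong[of k _ e e' M] by simp
  then show ?case by (simp only: sat.simps)
next
  case (Conj \<phi> \<psi>)
  then have "sat M e \<phi> = sat M e' \<phi>" "sat M e \<psi> = sat M e' \<psi>" by (metis fm_below.simps(4))+
  then show ?case by simp
next
  case (Exists n \<phi>)
  have "sat M (e(n := a)) \<phi> = sat M (e'(n := a)) \<phi>" for a
    using Exists by (intro Exists.IH) auto
  then show ?case by simp
next
  case (Neg \<phi>)
  have "sat M e \<phi> = sat M e' \<phi>" using Neg by (intro Neg.IH) auto
  then show ?case by simp
qed

locale boolean_ultrapower = boolean_quotient +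
  fixes Lg :: language and M :: "'a struct" and d :: 'a
  assumes M: "is_structure Lg M" and d: "elts d = domain M"
begin

abbreviation "fn i \<equiv> fun_arities Lg ! i"
abbreviation "rn i \<equiv> rel_arities Lg ! i"
abbreviation "D \<equiv> domain M"
abbreviation "DD \<equiv> cm.members (j d)"

text \<open>Restricting to tuples over the domain makes the graph a set; the shape, a pair of a
  coded tuple and a value, is the one that \<open>value_at\<close> tests.\<close>

definition Fgraph :: "nat \<Rightarrow> 'a" where
  "Fgraph i = mkset ((\<lambda>as. vpair (vtuple as) (Fun M i as)) ` tuples D (fn i))"

definition Rgraph :: "nat \<Rightarrow> 'a" where
  "Rgraph i = mkset (vtuple ` {as \<in> tuples D (rn i). Rel M i as})"

lemma set_D: "is_set D"
  using d by (metis rangeI)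

lemma elts_Fgraph: "elts (Fgraph i) = (\<lambda>as. vpair (vtuple as) (Fun M i as)) ` tuples D (fn i)"
  unfolding Fgraph_def by (rule elts_mkset[OF is_set_vtuple_image[OF set_D]])

lemma elts_Rgraph: "elts (Rgraph i) = vtuple ` {as \<in> tuples D (rn i). Rel M i as}"
  unfolding Rgraph_def
  by (rule elts_mkset[OF is_set_subset[OF is_set_vtuple_image[OF set_D, of vtuple "rn i"]]]) blast

lemma DD_iff: "X \<in> DD \<longleftrightarrow> X \<in> W \<and> large (\<lambda>p. \<exists>a\<in>D. dec p X a)"
  using E_j_iff[of X d] d by (auto simp: cm.members_def)

lemma DD_std: "X \<in> DD \<Longrightarrow> std X"
  unfolding std_def DD_iff by (auto elim!: large_mono)

lemma DD_W: "X \<in> DD \<Longrightarrow> X \<in> W"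
  by (simp add: DD_iff)

lemma j_DD: "a \<in> D \<Longrightarrow> j a \<in> DD"
  unfolding DD_iff by (auto intro: large_mono[OF large_j[of a]])

lemma Fun_D: "i < length (fun_arities Lg) \<Longrightarrow> as \<in> tuples D (fn i) \<Longrightarrow> Fun M i as \<in> D"
  using M unfolding is_structure_def by blast

lemma large_decs_D:
  assumes "set xs \<subseteq> DD" shows "large (\<lambda>p. \<exists>as. as \<in> tuples D (length xs) \<and> decs p xs as)"
  using assms
proof (induction xs)
  case Nil
  show ?case using refl by (intro large_all) (auto simp: tuples_def)
next
  case (Cons x xs)
  then have x: "large (\<lambda>p. \<exists>a\<in>D. dec p x a)" "x \<in> W"
    and xs: "large (\<lambda>p. \<exists>as. as \<in> tuples D (length xs) \<and> decs p xs as)"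
    by (simp_all add: DD_iff)
  show ?case
  proof (rule large_both[OF x(1) xs])
    show "persistent (\<lambda>p. \<exists>a\<in>D. dec p x a)" by (intro persistent_intros x)
    fix p assume "\<exists>a\<in>D. dec p x a" "\<exists>as. as \<in> tuples D (length xs) \<and> decs p xs as"
    then obtain a as where "a \<in> D" "dec p x a" "as \<in> tuples D (length xs)" "decs p xs as" by blast
    then show "\<exists>as. as \<in> tuples D (length (x # xs)) \<and> decs p (x # xs) as"
      by (intro exI[of _ "a # as"]) (auto simp: tuples_def)
  qed
qed

lemma tuples_DD: "xs \<in> tuples DD n \<Longrightarrow> set xs \<subseteq> DD" "xs \<in> tuples DD n \<Longrightarrow> length xs = n"
  "xs \<in> tuples DD n \<Longrightarrow> set xs \<subseteq> Collect std" "xs \<in> tuples DD n \<Longrightarrow> set xs \<subseteq> W"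
  using DD_std DD_W by (auto simp: tuples_def)

text \<open>\<open>lift_list\<close> supplies locally standard coordinates; since \<open>w\<close>
  only admits tuples over \<open>D\<close>, the coordinates fall into the internal domain
  \<open>DD\<close>.\<close>

lemma lift_tuple:
  assumes "\<And>as. persistent (\<lambda>p. w p as)" and "large (\<lambda>p. \<exists>as. w p as)"
    and w: "\<And>p as. w p as \<Longrightarrow> as \<in> tuples D n"
  obtains xs where "xs \<in> tuples DD n" "large (\<lambda>p. \<exists>as. w p as \<and> decs p xs as)"
proof -
  have "large (\<lambda>p. \<exists>as. length as = n \<and> w p as)"
    by (rule large_mono[OF assms(2)]) (use w in \<open>auto simp: tuples_def\<close>)
  from lift_list[of w, OF assms(1) this] obtain xs where xs: "set xs \<subseteq> Collect std" "length xs = n"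
    "large (\<lambda>p. \<exists>as. w p as \<and> decs p xs as)" by blast
  have "x \<in> DD" if x: "x \<in> set xs" for x
    unfolding DD_iff
  proof
    show "x \<in> W" using xs x std_W by blast
    show "large (\<lambda>p. \<exists>a\<in>D. dec p x a)"
    proof (rule large_mono[OF xs(3)])
      fix p assume "\<exists>as. w p as \<and> decs p xs as"
      then obtain as where as: "as \<in> tuples D (n)" "list_all2 (dec p) xs as"
        using w by (auto simp: decs_def)
      then obtain k where k: "k < length xs" "x = xs ! k" using x by (metis in_set_conv_nth)
      then have "dec p x (as ! k)" "as ! k \<in> D"
        using as xs(2) by (auto simp: list_all2_nthD tuples_def)
      then show "\<exists>a\<in>D. dec p x a" by blast
    qed
  qed
  then have "xs \<in> tuples DD n" using xs by (auto simp: tuples_def)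
  then show thesis using that xs(3) by blast
qed

lemma value_at_Fgraph:
  assumes "xs \<in> tuples DD (fn i)" "std y"
  shows "cm.value_at (j (Fgraph i)) xs y \<longleftrightarrow>
    large (\<lambda>p. \<exists>as. as \<in> tuples D (fn i) \<and> decs p xs as \<and> dec p y (Fun M i as))"
proof -
  have "(\<exists>as b. decs p xs as \<and> dec p y b \<and> vpair (vtuple as) b \<in> elts (Fgraph i)) \<longleftrightarrow>
    (\<exists>as. as \<in> tuples D (fn i) \<and> decs p xs as \<and> dec p y (Fun M i as))" (is "?l \<longleftrightarrow> ?r") for p
  proof
    assume ?l
    then obtain as b bs where *: "decs p xs as" "dec p y b" "bs \<in> tuples D (fn i)"
      "vtuple as = vtuple bs" "b = Fun M i bs" by (auto simp: elts_Fgraph)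
    have "length as = length bs" using * decs_length tuples_DD(2)[OF assms(1)] by (auto simp: tuples_def)
    then have "as = bs" using * vtuple_inject by blast
    then show ?r using * by blast
  qed (auto simp: elts_Fgraph)
  then show ?thesis by (simp add: value_at_j_iff[OF tuples_DD(3)[OF assms(1)] assms(2)])
qed

lemma holds_at_Rgraph:
  assumes "xs \<in> tuples DD (rn i)"
  shows "cm.holds_at (j (Rgraph i)) xs \<longleftrightarrow>
    large (\<lambda>p. \<exists>as. as \<in> tuples D (rn i) \<and> decs p xs as \<and> Rel M i as)"
proof -
  have "(\<exists>as. decs p xs as \<and> vtuple as \<in> elts (Rgraph i)) \<longleftrightarrow>
    (\<exists>as. as \<in> tuples D (rn i) \<and> decs p xs as \<and> Rel M i as)" (is "?l \<longleftrightarrow> ?r") for p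
  proof
    assume ?l
    then obtain as bs where *: "decs p xs as" "bs \<in> tuples D (rn i)" "Rel M i bs"
      "vtuple as = vtuple bs" by (auto simp: elts_Rgraph)
    have "length as = length bs" using * decs_length tuples_DD(2)[OF assms(1)] by (auto simp: tuples_def)
    then have "as = bs" using * vtuple_inject by blast
    then show ?r using * by blast
  qed (auto simp: elts_Rgraph)
  then show ?thesis by (simp add: holds_at_j_iff[OF tuples_DD(3)[OF assms(1)]])
qed

text \<open>On a large set the arguments are decided; the ground operation is applied there and the
  result lifted. Two values agree because the same decided arguments determine both.\<close>

lemma value_ex1:
  assumes i: "i < length (fun_arities Lg)" and xs: "xs \<in> tuples DD (fn i)"
  shows "\<exists>!y. y \<in> DD \<and> cm.value_at (j (Fgraph i)) xs y"
proof -
  note xW = tuples_DD(4)[OF xs]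
  let ?w = "\<lambda>p b. \<exists>as. as \<in> tuples D (fn i) \<and> decs p xs as \<and> b = Fun M i as"
  have p: "persistent (\<lambda>p. ?w p b)" for b by (intro persistent_intros xW)
  have "large (\<lambda>p. \<exists>b. ?w p b)"
    by (rule large_mono[OF large_decs_D[OF tuples_DD(1)[OF xs]]]) (use tuples_DD(2)[OF xs] in auto)
  then obtain y where y: "std y" "large (\<lambda>p. \<exists>b. ?w p b \<and> dec p y b)"
    by (rule lift[OF p])
  have "large (\<lambda>p. \<exists>a\<in>D. dec p y a)" by (rule large_mono[OF y(2)]) (use Fun_D[OF i] in blast)
  then have "y \<in> DD" using y(1) by (simp add: DD_iff std_W)
  moreover have "cm.value_at (j (Fgraph i)) xs y"
    unfolding value_at_Fgraph[OF xs y(1)] by (rule large_mono[OF y(2)]) blast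
  moreover have "y = z" if z: "z \<in> DD" "cm.value_at (j (Fgraph i)) xs z"
    and y: "y \<in> DD" "cm.value_at (j (Fgraph i)) xs y" for y z
  proof (rule dec_eqI[OF DD_W DD_W])
    have 1: "large (\<lambda>p. \<exists>as. as \<in> tuples D (fn i) \<and> decs p xs as \<and> dec p y (Fun M i as))"
      "large (\<lambda>p. \<exists>as. as \<in> tuples D (fn i) \<and> decs p xs as \<and> dec p z (Fun M i as))"
      using y z value_at_Fgraph[OF xs DD_std] by blast+
    show "large (\<lambda>p. \<exists>a. dec p y a \<and> dec p z a)"
      by (rule large_both[OF 1]) (intro persistent_intros xW DD_W y, use decs_unique[OF _ _ xW] in blast)
  qed fact+
  ultimately show ?thesis by blast
qed

text \<open>The delicate half concerns a member \<open>q\<close> of the image of the graph, which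
  need not come from any single ground pair. Its local arguments are lifted to a tuple
  \<open>xs\<close> over the internal domain, and \<open>q\<close> is then recognized as the pair
  formed from the code of \<open>xs\<close> and the value at \<open>xs\<close>.\<close>

lemma operation:
  assumes i: "i < length (fun_arities Lg)"
  shows "cm.is_operation (j d) (fn i) (j (Fgraph i))"
  unfolding cm.is_operation_def
proof (intro conjI ballI)
  show "\<exists>!y. y \<in> DD \<and> cm.value_at (j (Fgraph i)) xs y" if "xs \<in> tuples DD (fn i)" for xs
    by (rule value_ex1[OF i that])
  fix q assume "q \<in> cm.members (j (Fgraph i))"
  then have q: "q \<in> W" "E q (j (Fgraph i))" by (simp_all add: cm.members_def)
  then have L1: "large (\<lambda>p. \<exists>c\<in>elts (Fgraph i). dec p q c)" using E_j_iff by blast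
  let ?w = "\<lambda>p as. as \<in> tuples D (fn i) \<and> dec p q (vpair (vtuple as) (Fun M i as))"
  have persistent: "persistent (\<lambda>p. ?w p as)" for as by (intro persistent_intros q)
  have "large (\<lambda>p. \<exists>as. ?w p as)" by (rule large_mono[OF L1]) (auto simp: elts_Fgraph)
  then obtain xs where xt: "xs \<in> tuples DD (fn i)" and xs: "large (\<lambda>p. \<exists>as. ?w p as \<and> decs p xs as)"
    by (rule lift_tuple[of ?w, OF persistent]) auto
  obtain y where y: "y \<in> DD" "cm.value_at (j (Fgraph i)) xs y" using value_ex1[OF i xt] by blast
  have ys: "large (\<lambda>p. \<exists>as. as \<in> tuples D (fn i) \<and> decs p xs as \<and> dec p y (Fun M i as))"
    using y value_at_Fgraph[OF xt DD_std] by blast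
  obtain t where t: "std t" "cm.is_tuple xs t" "large (\<lambda>p. \<exists>as. decs p xs as \<and> dec p t (vtuple as))"
    by (rule tuple_exists[OF tuples_DD(3)[OF xt]])
  have 2: "large (\<lambda>p. \<exists>as. decs p xs as \<and> dec p y (Fun M i as) \<and> dec p t (vtuple as))"
    by (rule large_both[OF ys t(3)])
      (intro persistent_intros tuples_DD(4)[OF xt] DD_W y(1), use decs_unique[OF _ _ tuples_DD(4)[OF xt]] in blast)
  have "large (\<lambda>p. \<exists>a b. dec p t a \<and> dec p y b \<and> dec p q (vpair a b))"
    by (rule large_both[OF 2 xs])
      (intro persistent_intros tuples_DD(4)[OF xt] DD_W y(1) std_W t(1), use decs_unique[OF _ _ tuples_DD(4)[OF xt]] in blast)
  then have "cm.is_pair t y q" using is_pair_iff[OF t(1) DD_std[OF y(1)] q(1)] by blast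
  then show "\<exists>xs\<in>tuples DD (fn i). \<exists>y\<in>DD. \<exists>t\<in>W. cm.is_tuple xs t \<and> cm.is_pair t y q"
    using xt y(1) t std_W by blast
qed

lemma relation: "cm.is_relation (j d) (rn i) (j (Rgraph i))"
  unfolding cm.is_relation_def
proof
  fix t assume "t \<in> cm.members (j (Rgraph i))"
  then have t: "t \<in> W" "E t (j (Rgraph i))" by (simp_all add: cm.members_def)
  then have L1: "large (\<lambda>p. \<exists>c\<in>elts (Rgraph i). dec p t c)" using E_j_iff by blast
  let ?w = "\<lambda>p as. as \<in> tuples D (rn i) \<and> dec p t (vtuple as)"
  have persistent: "persistent (\<lambda>p. ?w p as)" for as by (intro persistent_intros t)
  have "large (\<lambda>p. \<exists>as. ?w p as)" by (rule large_mono[OF L1]) (auto simp: elts_Rgraph)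
  then obtain xs where xt: "xs \<in> tuples DD (rn i)" and xs: "large (\<lambda>p. \<exists>as. ?w p as \<and> decs p xs as)"
    by (rule lift_tuple[of ?w, OF persistent]) auto
  have "large (\<lambda>p. \<exists>as. decs p xs as \<and> dec p t (vtuple as))" by (rule large_mono[OF xs]) blast
  then show "\<exists>xs\<in>tuples DD (rn i). cm.is_tuple xs t"
    using xt is_tuple_iff[OF tuples_DD(3)[OF xt] t(1)] by blast
qed

definition Fs :: "'a set list" where "Fs = map (\<lambda>i. j (Fgraph i)) [0..<length (fun_arities Lg)]"
definition Rs :: "'a set list" where "Rs = map (\<lambda>i. j (Rgraph i)) [0..<length (rel_arities Lg)]"

text \<open>Finiteness of the language enters here: domain, operations and relations form a list of
  standard length, which \<open>tuple_exists\<close> codes by one element of the quotient.\<close>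

lemma internal_structure: "\<exists>x. cm.is_internal_structure Lg x (j d) Fs Rs"
proof -
  obtain x where "std x" "cm.is_tuple (j d # Fs @ Rs) x"
    by (rule tuple_exists[of "j d # Fs @ Rs"]) (auto simp: Fs_def Rs_def)
  moreover have "\<not> cm.is_empty (j d)"
  proof -
    obtain a where "a \<in> D" using M by (auto simp: is_structure_def)
    then have "j a \<in> DD" by (rule j_DD)
    then show ?thesis by (auto simp: cm.is_empty_def cm.members_def)
  qed
  ultimately have "cm.is_internal_structure Lg x (j d) Fs Rs"
    unfolding cm.is_internal_structure_def
    using operation relation
    by (auto simp: Fs_def Rs_def std_W list_all2_conv_all_nth)
  then show ?thesis by blast
qed

section \<open>The external structure and the theorem of Los\<close>

definition Ext :: "'a set struct" where "Ext = cm.external_structure (j d) Fs Rs"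

lemma domain_Ext [simp]: "domain Ext = DD"
  by (simp add: Ext_def cm.external_structure_def)

lemma Fun_Ext:
  assumes i: "i < length (fun_arities Lg)" and xs: "xs \<in> tuples DD (fn i)"
  shows "Fun Ext i xs \<in> DD"
    and "large (\<lambda>p. \<exists>as. as \<in> tuples D (fn i) \<and> decs p xs as \<and> dec p (Fun Ext i xs) (Fun M i as))"
proof -
  have "Fun Ext i xs = (THE y. y \<in> DD \<and> cm.value_at (j (Fgraph i)) xs y)"
    using i by (simp add: Ext_def cm.external_structure_def Fs_def)
  then have *: "Fun Ext i xs \<in> DD" "cm.value_at (j (Fgraph i)) xs (Fun Ext i xs)"
    using theI'[OF value_ex1[OF i xs]] by simp_all
  then show "Fun Ext i xs \<in> DD" by blast
  show "large (\<lambda>p. \<exists>as. as \<in> tuples D (fn i) \<and> decs p xs as \<and> dec p (Fun Ext i xs) (Fun M i as))"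
    using * value_at_Fgraph[OF xs DD_std] by blast
qed

lemma Rel_Ext:
  assumes i: "i < length (rel_arities Lg)" and xs: "xs \<in> tuples DD (rn i)"
  shows "Rel Ext i xs \<longleftrightarrow> large (\<lambda>p. \<exists>as. as \<in> tuples D (rn i) \<and> decs p xs as \<and> Rel M i as)"
  using i holds_at_Rgraph[OF xs] by (simp add: Ext_def cm.external_structure_def Rs_def)

text \<open>The fixed default from \<open>k\<close> on makes \<open>g\<close> the only assignment
  belonging to \<open>p\<close>, so statements about assignments that were obtained separately can
  be merged.\<close>

definition asg :: "nat \<Rightarrow> (nat \<Rightarrow> 'a set) \<Rightarrow> 'a \<Rightarrow> (nat \<Rightarrow> 'a) \<Rightarrow> bool" where
  "asg k e p g \<longleftrightarrow> range g \<subseteq> D \<and> (\<forall>i<k. dec p (e i) (g i)) \<and> (\<forall>i\<ge>k. g i = (SOME a. a \<in> D))"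

lemma some_D: "(SOME a. a \<in> D) \<in> D"
proof -
  have "\<exists>a. a \<in> D" using M by (auto simp: is_structure_def)
  then show ?thesis by (rule someI_ex)
qed

lemma asg_unique:
  assumes "asg k e p g" "asg k e p h" "range e \<subseteq> DD" shows "g = h"
proof
  fix i show "g i = h i"
    using assms dec_unique[of p "e i" "g i" "h i"] DD_W[of "e i"] by (cases "i < k") (auto simp: asg_def)
qed

lemma persistent_asg: "range e \<subseteq> DD \<Longrightarrow> persistent (\<lambda>p. asg k e p g)"
  using dec_down DD_W unfolding asg_def by (intro persI) (auto simp: image_subset_iff)

lemma large_asg:
  assumes "range e \<subseteq> DD" shows "large (\<lambda>p. \<exists>g. asg k e p g)"
proof -
  have "set (map e [0..<k]) \<subseteq> DD" using assms by auto
  from large_decs_D[OF this] show ?thesis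
  proof (rule large_mono)
    fix p assume "\<exists>as. as \<in> tuples D (length (map e [0..<k])) \<and> decs p (map e [0..<k]) as"
    then obtain as where "as \<in> tuples D k" and ds: "decs p (map e [0..<k]) as" by auto
    then have as: "set as \<subseteq> D" "length as = k" by (auto simp: tuples_def)
    have "dec p (e i) (as ! i)" if "i < k" for i
      using ds that unfolding decs_def by (auto dest: list_all2_nthD)
    moreover have "as ! i \<in> D" if "i < k" for i using as that by auto
    ultimately have "asg k e p (\<lambda>i. if i < k then as ! i else (SOME a. a \<in> D))"
      using some_D by (auto simp: asg_def)
    then show "\<exists>g. asg k e p g" by blast
  qed
qed

text \<open>Finitely many local statements about single terms are merged into one about the whole
  argument list; \<open>asg_unique\<close> guarantees that they speak of the same
  assignment.\<close>

lemma large_decs_map: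
  assumes "\<And>t. t \<in> set ts \<Longrightarrow> v t \<in> DD \<and> large (\<lambda>p. \<exists>g. asg k e p g \<and> dec p (v t) (u g t))"
    and e: "range e \<subseteq> DD"
  shows "large (\<lambda>p. \<exists>g. asg k e p g \<and> decs p (map v ts) (map (u g) ts))"
  using assms(1)
proof (induction ts)
  case Nil
  show ?case using large_asg[OF e] by simp
next
  case (Cons t ts)
  have t: "v t \<in> DD" "large (\<lambda>p. \<exists>g. asg k e p g \<and> dec p (v t) (u g t))"
    using Cons.prems by auto
  have ts: "large (\<lambda>p. \<exists>g. asg k e p g \<and> decs p (map v ts) (map (u g) ts))"
    using Cons by auto
  show ?case
  proof (rule large_both[OF t(2) ts])
    show "persistent (\<lambda>p. \<exists>g. asg k e p g \<and> dec p (v t) (u g t))"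
      by (intro persistent_intros persistent_asg e DD_W t(1))
    fix p assume "\<exists>g. asg k e p g \<and> dec p (v t) (u g t)"
      "\<exists>g. asg k e p g \<and> decs p (map v ts) (map (u g) ts)"
    then obtain g h where *: "asg k e p g" "dec p (v t) (u g t)" "asg k e p h"
      "decs p (map v ts) (map (u h) ts)" by blast
    then have "h = g" using asg_unique[OF _ _ e] by blast
    then show "\<exists>g. asg k e p g \<and> decs p (map v (t # ts)) (map (u g) (t # ts))" using * by auto
  qed
qed

lemma tm_val_Ext:
  assumes "wf_tm Lg t" "tm_below k t" and e: "range e \<subseteq> DD"
  shows "tm_val Ext e t \<in> DD \<and> large (\<lambda>p. \<exists>g. asg k e p g \<and> dec p (tm_val Ext e t) (tm_val M g t))"
  using assms(1,2)
proof (induction t)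
  case (Var n)
  have "large (\<lambda>p. \<exists>g. asg k e p g \<and> dec p (e n) (g n))"
    by (rule large_mono[OF large_asg[OF e]]) (use Var in \<open>auto simp: asg_def\<close>)
  then show ?case using e by auto
next
  case (App i ts)
  let ?xs = "map (tm_val Ext e) ts"
  have ts: "tm_val Ext e t \<in> DD \<and> large (\<lambda>p. \<exists>g. asg k e p g \<and> dec p (tm_val Ext e t) (tm_val M g t))"
    if "t \<in> set ts" for t using App that by auto
  then have xs: "?xs \<in> tuples DD (fn i)" using App.prems by (auto simp: tuples_def)
  have L1: "large (\<lambda>p. \<exists>g. asg k e p g \<and> decs p ?xs (map (tm_val M g) ts))"
    by (rule large_decs_map[OF ts e])
  have i: "i < length (fun_arities Lg)" using App.prems by simp
  note F = Fun_Ext[OF i xs] and xW = tuples_DD(4)[OF xs]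
  have "large (\<lambda>p. \<exists>g. asg k e p g \<and> dec p (Fun Ext i ?xs) (Fun M i (map (tm_val M g) ts)))"
    by (rule large_both[OF L1 F(2)]) (intro persistent_intros persistent_asg e xW, use decs_unique[OF _ _ xW] in blast)
  then show ?case using F(1) by simp
qed

lemma tms_val_Ext:
  assumes "\<And>t. t \<in> set ts \<Longrightarrow> wf_tm Lg t \<and> tm_below k t" and e: "range e \<subseteq> DD"
  shows "set (map (tm_val Ext e) ts) \<subseteq> DD"
    and "large (\<lambda>p. \<exists>g. asg k e p g \<and> decs p (map (tm_val Ext e) ts) (map (tm_val M g) ts))"
  using assms tm_val_Ext[OF _ _ e] by (auto intro!: large_decs_map)

text \<open>The existential over \<open>g\<close> stands for the one assignment that
  \<open>p\<close> decides. Negation rests on the ultrafilter property, conjunction on uniqueness of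
  \<open>g\<close>, and the quantifier on lifting local witnesses to an element of the internal
  domain.\<close>

lemma Los:
  assumes "wf_fm Lg \<phi>" "fm_below k \<phi>" "range e \<subseteq> DD"
  shows "sat Ext e \<phi> \<longleftrightarrow> large (\<lambda>p. \<exists>g. asg k e p g \<and> sat M g \<phi>)"
  using assms
proof (induction \<phi> arbitrary: e)
  case (Eq s t)
  note e = \<open>range e \<subseteq> DD\<close>
  have s: "tm_val Ext e s \<in> DD" "large (\<lambda>p. \<exists>g. asg k e p g \<and> dec p (tm_val Ext e s) (tm_val M g s))"
    and t: "tm_val Ext e t \<in> DD" "large (\<lambda>p. \<exists>g. asg k e p g \<and> dec p (tm_val Ext e t) (tm_val M g t))"
    using Eq tm_val_Ext[of _ k e] by auto
  have st: "large (\<lambda>p. \<exists>g. asg k e p g \<and> dec p (tm_val Ext e s) (tm_val M g s) \<and> dec p (tm_val Ext e t) (tm_val M g t))"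
    by (rule large_both[OF s(2) t(2)]) (intro persistent_intros persistent_asg e DD_W s(1), use asg_unique[OF _ _ e] in blast)
  have persistent: "persistent (\<lambda>p. \<exists>g. asg k e p g \<and> dec p (tm_val Ext e s) (tm_val M g s) \<and> dec p (tm_val Ext e t) (tm_val M g t))"
    by (intro persistent_intros persistent_asg e DD_W s(1) t(1))
  show ?case
  proof
    assume "sat Ext e (Eq s t)"
    then have eq: "tm_val Ext e s = tm_val Ext e t" by simp
    show "large (\<lambda>p. \<exists>g. asg k e p g \<and> sat M g (Eq s t))"
      by (rule large_mono[OF st]) (use dec_unique[OF _ _ DD_W[OF t(1)]] eq in auto)
  next
    assume large: "large (\<lambda>p. \<exists>g. asg k e p g \<and> sat M g (Eq s t))"
    have "large (\<lambda>p. \<exists>a. dec p (tm_val Ext e s) a \<and> dec p (tm_val Ext e t) a)"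
      by (rule large_both[OF st large persistent]) (use asg_unique[OF _ _ e] in fastforce)
    then show "sat Ext e (Eq s t)" using dec_eqI[OF DD_W[OF s(1)] DD_W[OF t(1)]] by simp
  qed
next
  case (Atom i ts)
  note e = \<open>range e \<subseteq> DD\<close>
  let ?xs = "map (tm_val Ext e) ts"
  have ts: "wf_tm Lg t \<and> tm_below k t" if "t \<in> set ts" for t using Atom.prems that by auto
  have xs: "?xs \<in> tuples DD (rn i)"
    using tms_val_Ext(1)[OF ts e] Atom.prems by (simp add: tuples_def)
  have L1: "large (\<lambda>p. \<exists>g. asg k e p g \<and> decs p ?xs (map (tm_val M g) ts))"
    by (rule tms_val_Ext(2)[OF ts e])
  have i: "i < length (rel_arities Lg)" using Atom.prems by simp
  note R = Rel_Ext[OF i xs] and xW = tuples_DD(4)[OF xs]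
  \<comment> \<open>Adds a decided tuple over \<open>D\<close> of the right length, as
    \<open>Rel_Ext\<close> demands; uniqueness of decided values will identify it with the tuple of
    term values.\<close>
  have L2: "large (\<lambda>p. \<exists>g as. asg k e p g \<and> decs p ?xs (map (tm_val M g) ts) \<and> as \<in> tuples D (rn i) \<and> decs p ?xs as)"
    by (rule large_both[OF L1 large_decs_D[OF tuples_DD(1)[OF xs]]])
      (intro persistent_intros persistent_asg e xW, use tuples_DD(2)[OF xs] in auto)
  have "large (\<lambda>p. \<exists>as. as \<in> tuples D (rn i) \<and> decs p ?xs as \<and> Rel M i as) \<longleftrightarrow>
    large (\<lambda>p. \<exists>g. asg k e p g \<and> Rel M i (map (tm_val M g) ts))" (is "large ?l \<longleftrightarrow> large ?r")
  proof
    show "large ?r" if "large ?l"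
      by (rule large_both[OF L1 that]) (intro persistent_intros persistent_asg e xW, use decs_unique[OF _ _ xW] in blast)
    show "large ?l" if "large ?r"
    proof (rule large_both[OF L2 that])
      fix p assume "\<exists>g as. asg k e p g \<and> decs p ?xs (map (tm_val M g) ts) \<and> as \<in> tuples D (rn i) \<and> decs p ?xs as"
        "\<exists>g. asg k e p g \<and> Rel M i (map (tm_val M g) ts)"
      then obtain g as h where *: "asg k e p g" "decs p ?xs (map (tm_val M g) ts)" "as \<in> tuples D (rn i)"
        "decs p ?xs as" "asg k e p h" "Rel M i (map (tm_val M h) ts)" by blast
      then have "g = h" "as = map (tm_val M g) ts" using asg_unique[OF _ _ e] decs_unique[OF _ _ xW] by blast+
      then show "\<exists>as. as \<in> tuples D (rn i) \<and> decs p ?xs as \<and> Rel M i as" using * by blast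
    qed (intro persistent_intros persistent_asg e xW)
  qed
  then show ?case using R by simp
next
  case (Neg \<phi>)
  note e = \<open>range e \<subseteq> DD\<close>
  have IH: "sat Ext e \<phi> \<longleftrightarrow> large (\<lambda>p. \<exists>g. asg k e p g \<and> sat M g \<phi>)" using Neg by auto
  have persistent: "persistent (\<lambda>p. \<exists>g. asg k e p g \<and> sat M g \<phi>)" "persistent (\<lambda>p. \<exists>g. asg k e p g)"
    by (intro persistent_intros persistent_asg e)+
  have "large (\<lambda>p. \<exists>g. asg k e p g \<and> \<not> sat M g \<phi>)" if "\<not> large (\<lambda>p. \<exists>g. asg k e p g \<and> sat M g \<phi>)"
    by (rule large_both[OF large_asg[OF e] large_neg[OF that] persistent(2)]) (use refl in blast)
  moreover have False if "large (\<lambda>p. \<exists>g. asg k e p g \<and> \<not> sat M g \<phi>)" "large (\<lambda>p. \<exists>g. asg k e p g \<and> sat M g \<phi>)"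
    by (rule large_conflict[OF that(2,1) persistent(1)]) (use asg_unique[OF _ _ e] in blast)
  ultimately show ?case using IH by auto
next
  case (Conj \<phi> \<psi>)
  note e = \<open>range e \<subseteq> DD\<close>
  have IH: "sat Ext e \<phi> \<longleftrightarrow> large (\<lambda>p. \<exists>g. asg k e p g \<and> sat M g \<phi>)"
    "sat Ext e \<psi> \<longleftrightarrow> large (\<lambda>p. \<exists>g. asg k e p g \<and> sat M g \<psi>)" using Conj by auto
  have persistent: "persistent (\<lambda>p. \<exists>g. asg k e p g \<and> sat M g \<phi>)" by (intro persistent_intros persistent_asg e)
  have "large (\<lambda>p. \<exists>g. asg k e p g \<and> sat M g \<phi> \<and> sat M g \<psi>)"
    if "large (\<lambda>p. \<exists>g. asg k e p g \<and> sat M g \<phi>)" "large (\<lambda>p. \<exists>g. asg k e p g \<and> sat M g \<psi>)"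
    by (rule large_both[OF that persistent]) (use asg_unique[OF _ _ e] in blast)
  then show ?case using IH by (auto elim: large_mono)
next
  case (Exists n \<phi>)
  note e = \<open>range e \<subseteq> DD\<close>
  \<comment> \<open>With \<open>n\<close> below \<open>k\<close>, an update at \<open>n\<close> does
    not disturb the default part of an assignment.\<close>
  have n: "n < k" using Exists.prems by simp
  have eZ: "range (e(n := Z)) \<subseteq> DD" if "Z \<in> DD" for Z using e that by auto
  have IH: "sat Ext (e(n := Z)) \<phi> \<longleftrightarrow> large (\<lambda>p. \<exists>g. asg k (e(n := Z)) p g \<and> sat M g \<phi>)"
    if "Z \<in> DD" for Z using Exists.prems by (intro Exists.IH eZ[OF that]) auto
  have persistent: "persistent (\<lambda>p. \<exists>g. asg k e p g)" by (intro persistent_intros persistent_asg e)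
  show ?case
  proof
    assume "sat Ext e (Exists n \<phi>)"
    then obtain Z where Z: "Z \<in> DD" "sat Ext (e(n := Z)) \<phi>" by auto
    then have large: "large (\<lambda>p. \<exists>g. asg k (e(n := Z)) p g \<and> sat M g \<phi>)" using IH by blast
    show "large (\<lambda>p. \<exists>g. asg k e p g \<and> sat M g (Exists n \<phi>))"
    proof (rule large_both[OF large_asg[OF e] large persistent])
      fix p assume "\<exists>g. asg k e p g" "\<exists>g. asg k (e(n := Z)) p g \<and> sat M g \<phi>"
      then obtain g h where gh: "asg k e p g" "asg k (e(n := Z)) p h" "sat M h \<phi>" by blast
      have "asg k (e(n := Z)) p (g(n := h n))" using gh n by (auto simp: asg_def)
      \<comment> \<open>The assignments decided for \<open>e\<close> and for its update can differ
        at \<open>n\<close> only, so the value of \<open>h\<close> there is the witness for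
        \<open>g\<close>.\<close>
      then have "g(n := h n) = h" using asg_unique[OF _ gh(2) eZ[OF Z(1)]] by blast
      moreover have "h n \<in> D" using gh(2) by (auto simp: asg_def)
      moreover from calculation gh(3) have "sat M (g(n := h n)) \<phi>" by simp
      ultimately have "\<exists>a\<in>D. sat M (g(n := a)) \<phi>" by blast
      then have "sat M g (Exists n \<phi>)" by simp
      then show "\<exists>g. asg k e p g \<and> sat M g (Exists n \<phi>)" using gh(1) by blast
    qed
  next
    assume large: "large (\<lambda>p. \<exists>g. asg k e p g \<and> sat M g (Exists n \<phi>))"
    \<comment> \<open>Different conditions may need different witnesses; the predicate admits all
      that work at \<open>p\<close>, and \<open>lift\<close> merges local choices into a single
      \<open>Z\<close>.\<close>
    let ?w = "\<lambda>p a. \<exists>g. asg k e p g \<and> a \<in> D \<and> sat M (g(n := a)) \<phi>"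
    have p: "persistent (\<lambda>p. ?w p a)" for a by (intro persistent_intros persistent_asg e)
    have "large (\<lambda>p. \<exists>a. ?w p a)" by (rule large_mono[OF large]) auto
    then obtain Z where Z: "std Z" "large (\<lambda>p. \<exists>a. ?w p a \<and> dec p Z a)" by (rule lift[OF p])
    have ZD: "Z \<in> DD" unfolding DD_iff using std_W[OF Z(1)] by (auto intro: large_mono[OF Z(2)])
    have "large (\<lambda>p. \<exists>g. asg k (e(n := Z)) p g \<and> sat M g \<phi>)"
    proof (rule large_mono[OF Z(2)])
      fix p assume "\<exists>a. ?w p a \<and> dec p Z a"
      then obtain a g where *: "asg k e p g" "a \<in> D" "sat M (g(n := a)) \<phi>" "dec p Z a" by blast
      then have "asg k (e(n := Z)) p (g(n := a))" using n by (auto simp: asg_def)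
      then show "\<exists>g. asg k (e(n := Z)) p g \<and> sat M g \<phi>" using * by blast
    qed
    then have "sat Ext (e(n := Z)) \<phi>" using IH[OF ZD] by blast
    then show "sat Ext e (Exists n \<phi>)" using ZD by auto
  qed
qed

text \<open>Each \<open>j (e i)\<close> is decided to be \<open>e i\<close> on a large set, and
  finitely many such decisions hold together. Agreement is claimed below \<open>k\<close> only,
  since \<open>g\<close> takes its default value from there on.\<close>

lemma large_asg_j: "range e \<subseteq> D \<Longrightarrow> large (\<lambda>p. \<exists>g. asg k (\<lambda>i. j (e i)) p g \<and> (\<forall>i<k. g i = e i))"
proof -
  assume e: "range e \<subseteq> D"
  then have eD: "range (\<lambda>i. j (e i)) \<subseteq> DD" using j_DD by auto
  have "large (\<lambda>p. \<forall>i<l. dec p (j (e i)) (e i))" for l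
  proof (induction l)
    case 0
    show ?case using refl by (intro large_all) auto
  next
    case (Suc l)
    show ?case
      by (rule large_both[OF large_j[of "e l"] Suc persistent_dec[OF W_j]]) (auto simp: less_Suc_eq)
  qed
  note large = this
  show ?thesis
  proof (rule large_both[OF large_asg[OF eD] large])
    show "persistent (\<lambda>p. \<exists>g. asg k (\<lambda>i. j (e i)) p g)" by (intro persistent_intros persistent_asg eD)
    fix p assume "\<exists>g. asg k (\<lambda>i. j (e i)) p g" and e: "\<forall>i<k. dec p (j (e i)) (e i)"
    then obtain g where g: "asg k (\<lambda>i. j (e i)) p g" by blast
    then have "\<forall>i<k. g i = e i"
      using e dec_unique[OF _ _ W_j] unfolding asg_def by blast
    with g show "\<exists>g. asg k (\<lambda>i. j (e i)) p g \<and> (\<forall>i<k. g i = e i)" by blast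
  qed
qed

text \<open>The decided assignment agrees with \<open>e\<close> on all variables of
  \<open>\<phi>\<close>, so its local truth value is the same at every relevant condition and the
  theorem of Los gives the actual truth value in \<open>M\<close>.\<close>

lemma j_elementary:
  assumes "wf_fm Lg \<phi>" and e: "range e \<subseteq> D"
  shows "sat Ext (\<lambda>i. j (e i)) \<phi> \<longleftrightarrow> sat M e \<phi>"
proof -
  obtain k where k: "fm_below k \<phi>" using fm_below_exists by blast
  have eD: "range (\<lambda>i. j (e i)) \<subseteq> DD" using e j_DD by auto
  have persistent: "persistent (\<lambda>p. \<exists>g. asg k (\<lambda>i. j (e i)) p g \<and> (\<forall>i<k. g i = e i))"
    by (intro persistent_intros persistent_asg eD)
  have los: "sat Ext (\<lambda>i. j (e i)) \<phi> \<longleftrightarrow> large (\<lambda>p. \<exists>g. asg k (\<lambda>i. j (e i)) p g \<and> sat M g \<phi>)"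
    by (rule Los[OF assms(1) k eD])
  have "sat M g \<phi> \<longleftrightarrow> sat M e \<phi>" if "\<forall>i<k. g i = e i" for g
    using sat_cong[OF k] that by blast
  note g = this
  show ?thesis unfolding los
  proof
    assume large: "large (\<lambda>p. \<exists>g. asg k (\<lambda>i. j (e i)) p g \<and> sat M g \<phi>)"
    show "sat M e \<phi>"
    proof (rule ccontr)
      assume "\<not> sat M e \<phi>"
      then show False
        using large_conflict[OF large_asg_j[OF e] large persistent] g asg_unique[OF _ _ eD] by blast
    qed
  next
    assume "sat M e \<phi>"
    then show "large (\<lambda>p. \<exists>g. asg k (\<lambda>i. j (e i)) p g \<and> sat M g \<phi>)"
      by (intro large_mono[OF large_asg_j[OF e]]) (use g in blast)
  qed
qed

lemma large_decs_j: "large (\<lambda>p. decs p (map j as) as)"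
proof (induction as)
  case Nil
  show ?case using refl by (intro large_all) auto
next
  case (Cons a as)
  show ?case by (rule large_both[OF large_j[of a] Cons persistent_dec[OF W_j]]) simp
qed

lemma map_j_tuples: "as \<in> tuples D n \<Longrightarrow> map j as \<in> tuples DD n"
  using j_DD by (auto simp: tuples_def)

lemma Fun_Ext_j:
  assumes i: "i < length (fun_arities Lg)" and as: "as \<in> tuples D (fn i)"
  shows "Fun Ext i (map j as) = j (Fun M i as)"
proof -
  note xs = map_j_tuples[OF as]
  note F = Fun_Ext[OF i xs]
  have "large (\<lambda>p. dec p (Fun Ext i (map j as)) (Fun M i as))"
    by (rule large_both[OF large_decs_j F(2) persistent_decs[OF tuples_DD(4)[OF xs]]])
      (use decs_unique[OF _ _ tuples_DD(4)[OF xs]] in blast)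
  then show ?thesis using dec_jI DD_W F(1) by blast
qed

lemma Rel_Ext_j:
  assumes i: "i < length (rel_arities Lg)" and as: "as \<in> tuples D (rn i)"
  shows "Rel Ext i (map j as) \<longleftrightarrow> Rel M i as"
proof -
  note xs = map_j_tuples[OF as]
  note persistent = persistent_decs[OF tuples_DD(4)[OF xs]]
  have "Rel M i as" if large: "large (\<lambda>p. \<exists>bs. bs \<in> tuples D (rn i) \<and> decs p (map j as) bs \<and> Rel M i bs)"
  proof (rule ccontr)
    assume "\<not> Rel M i as"
    then show False
      using large_conflict[OF large_decs_j[of as] large persistent] decs_unique[OF _ _ tuples_DD(4)[OF xs]] by blast
  qed
  moreover have "large (\<lambda>p. \<exists>bs. bs \<in> tuples D (rn i) \<and> decs p (map j as) bs \<and> Rel M i bs)" if "Rel M i as"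
    by (rule large_mono[OF large_decs_j[of as]]) (use as that in blast)
  ultimately show ?thesis using Rel_Ext[OF i xs] by blast
qed

end

section \<open>The generic injection\<close>

lemma is_set_insert: "is_set (insert x (elts y))"
proof -
  have "insert x (elts y) = (\<Union>z\<in>{mkset {x}, y}. elts z)"
    by (simp add: elts_mkset_singleton)
  then show ?thesis using is_set_UN[OF pairing[of "mkset {x}" y], of elts] by simp
qed

lemma elts_vnat_Suc: "elts (vnat (Suc n)) = insert (vnat n) (elts (vnat n))"
  by (simp add: elts_mkset[OF is_set_insert])

lemma vnat_mem: "m < n \<Longrightarrow> vnat m \<in> elts (vnat n)"
  by (induction n) (auto simp: elts_vnat_Suc less_Suc_eq simp del: vnat.simps)

lemma not_mem_self: "x \<notin> elts (x :: 'v::zfc_universe)"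
  using wf_not_refl[OF foundation, of x] by blast

lemma vnat_inject [simp]: "vnat m = (vnat n :: 'v::zfc_universe) \<longleftrightarrow> m = n"
  using vnat_mem[of m n, where 'a='v] vnat_mem[of n m, where 'a='v] not_mem_self[of "vnat m :: 'v"]
  by (metis linorder_neqE_nat)

definition vomega :: "'v::zfc_universe" where "vomega = mkset (range vnat)"

lemma elts_vomega: "elts vomega = range vnat"
  unfolding vomega_def by (rule elts_mkset[OF is_set_vnat])

context boolean_quotient
begin

section \<open>What the quotient takes for omega\<close>

lemma is_successorI:
  assumes X: "std X" and Y: "std Y"
    and large: "large (\<lambda>p. \<exists>a b. dec p X a \<and> dec p Y b \<and> elts b = insert a (elts a))"
  shows "cm.is_successor X Y"
  unfolding cm.is_successor_def
proof
  note w = std_W[OF X] std_W[OF Y]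
  have persistent: "persistent (\<lambda>p. \<exists>a b. dec p X a \<and> dec p Y b \<and> elts b = insert a (elts a))"
    by (intro persistent_intros w)
  fix Z assume Z: "Z \<in> W"
  have "E Z X \<or> Z = X" if "E Z Y"
  proof -
    have "large (\<lambda>p. \<exists>c d. dec p Z c \<and> dec p Y d \<and> c \<in> elts d)"
      using that by (simp add: E_dec_iff[OF Z Y])
    then have "large (\<lambda>p. (\<exists>a b. dec p Z a \<and> dec p X b \<and> a \<in> elts b) \<or> (\<exists>a. dec p Z a \<and> dec p X a))"
    proof (rule large_both[OF large _ persistent])
      fix p assume "\<exists>a b. dec p X a \<and> dec p Y b \<and> elts b = insert a (elts a)"
        "\<exists>c d. dec p Z c \<and> dec p Y d \<and> c \<in> elts d"
      then obtain a b c d where *: "dec p X a" "dec p Y b" "elts b = insert a (elts a)"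
        "dec p Z c" "dec p Y d" "c \<in> elts d" by blast
      then have "d = b" using dec_unique w by blast
      then have "c = a \<or> c \<in> elts a" using * by simp
      then show "(\<exists>a b. dec p Z a \<and> dec p X b \<and> a \<in> elts b) \<or> (\<exists>a. dec p Z a \<and> dec p X a)"
        using * by blast
    qed
    then have "large (\<lambda>p. \<exists>a b. dec p Z a \<and> dec p X b \<and> a \<in> elts b) \<or> large (\<lambda>p. \<exists>a. dec p Z a \<and> dec p X a)"
      by (rule large_disj)
    then show ?thesis using E_dec_iff[OF Z X] dec_eqI[OF Z w(1)] by blast
  qed
  moreover have "E Z Y" if "E Z X"
  proof -
    have "large (\<lambda>p. \<exists>c d. dec p Z c \<and> dec p X d \<and> c \<in> elts d)"
      using that by (simp add: E_dec_iff[OF Z X])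
    then have "large (\<lambda>p. \<exists>a b. dec p Z a \<and> dec p Y b \<and> a \<in> elts b)"
    proof (rule large_both[OF large _ persistent])
      fix p assume "\<exists>a b. dec p X a \<and> dec p Y b \<and> elts b = insert a (elts a)"
        "\<exists>c d. dec p Z c \<and> dec p X d \<and> c \<in> elts d"
      then obtain a b c d where *: "dec p X a" "dec p Y b" "elts b = insert a (elts a)"
        "dec p Z c" "dec p X d" "c \<in> elts d" by blast
      then have "d = a" using dec_unique w by blast
      then have "c \<in> elts b" using * by simp
      then show "\<exists>a b. dec p Z a \<and> dec p Y b \<and> a \<in> elts b" using * by blast
    qed
    then show ?thesis using E_dec_iff[OF Z Y] by blast
  qed
  moreover have "E X Y" unfolding E_dec_iff[OF w(1) Y]
  proof (rule large_mono[OF large])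
    fix p assume "\<exists>a b. dec p X a \<and> dec p Y b \<and> elts b = insert a (elts a)"
    then obtain a b where "dec p X a" "dec p Y b" "elts b = insert a (elts a)" by blast
    moreover from this have "a \<in> elts b" by simp
    ultimately show "\<exists>a b. dec p X a \<and> dec p Y b \<and> a \<in> elts b" by blast
  qed
  ultimately show "E Z Y \<longleftrightarrow> E Z X \<or> Z = X" by blast
qed

lemma E_j_vomega: "X \<in> W \<Longrightarrow> E X (j vomega) \<longleftrightarrow> large (\<lambda>p. \<exists>n. dec p X (vnat n))"
  by (simp add: E_j_iff elts_vomega)

text \<open>A member of \<open>j vomega\<close> may be decided to be different numbers at different
  conditions; its successor is obtained by adding one at each of them and lifting.\<close>

lemma inductive_j_vomega: "cm.is_inductive (j vomega)"
  unfolding cm.is_inductive_def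
proof (intro conjI ballI)
  have "E (j (vnat 0)) (j vomega)" unfolding E_j_vomega[OF W_j] by (rule large_mono[OF large_j]) blast
  moreover have "cm.is_empty (j (vnat 0))" by (simp add: is_empty_iff)
  ultimately show "\<exists>z\<in>cm.members (j vomega). cm.is_empty z"
    using W_j unfolding cm.members_def by blast
  fix X assume "X \<in> cm.members (j vomega)"
  then have X: "X \<in> W" "E X (j vomega)" by (simp_all add: cm.members_def)
  then have sX: "std X" using std_E std_j by blast
  have large: "large (\<lambda>p. \<exists>n. dec p X (vnat n))" using X E_j_vomega by blast
  let ?w = "\<lambda>p b. \<exists>n. dec p X (vnat n) \<and> b = vnat (Suc n)"
  have p: "persistent (\<lambda>p. ?w p b)" for b by (intro persistent_intros X)
  have "large (\<lambda>p. \<exists>b. ?w p b)" by (rule large_mono[OF large]) blast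
  then obtain Y where Y: "std Y" "large (\<lambda>p. \<exists>b. ?w p b \<and> dec p Y b)" by (rule lift[OF p])
  have "cm.is_successor X Y"
    by (rule is_successorI[OF sX Y(1)], rule large_mono[OF Y(2)]) (use elts_vnat_Suc in blast)
  moreover have "E Y (j vomega)" unfolding E_j_vomega[OF std_W[OF Y(1)]]
    by (rule large_mono[OF Y(2)]) blast
  ultimately show "\<exists>y\<in>cm.members (j vomega). cm.is_successor X y"
    using std_W[OF Y(1)] by (auto simp: cm.members_def)
qed

text \<open>
  A failure of the claim may sit at a nonstandard point of \<open>j vomega\<close>, so external induction is of
  no use. Instead the least failures below the conditions are glued to an element of \<open>W\<close>, which the
  inductivity of \<open>v\<close> refutes.
\<close>

lemma vomega_least:
  assumes v: "v \<in> W" "cm.is_inductive v" and X: "X \<in> W" "E X (j vomega)"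
  shows "E X v"
proof (rule ccontr)
  assume notE: "\<not> E X v"
  let ?V = "rep v"
  note nv = rep(1)[OF v(1)] and nX = rep(1)[OF X(1)]
  define Q where "Q p m \<longleftrightarrow> forces_nmem p (chk (vnat m)) ?V \<and> (\<forall>k<m. forces_mem p (chk (vnat k)) ?V)" for p m
  have persistent_Q: "persistent (\<lambda>p. Q p m)" for m
    unfolding Q_def using forces_nmem_down forces_mem_down[OF _ _ _ name_chk nv] by (intro persI) blast
  have L1: "large (\<lambda>p. \<exists>n. dec p X (vnat n))" using X E_j_vomega by blast
  have L2: "large (\<lambda>p. forces_nmem p (rep X) ?V)" using notE not_E_iff[OF X(1) v(1)] by blast
  have L3: "large (\<lambda>p. \<exists>m. Q p m)"
  proof (rule large_combine[OF L1 L2])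
    show "persistent (\<lambda>p. \<exists>n. dec p X (vnat n))" by (intro persistent_intros X)
    fix p assume p: "p \<in> P" "\<exists>n. dec p X (vnat n)" "forces_nmem p (rep X) ?V"
    then obtain n where "dec p X (vnat n)" by blast
    then have "forces_nmem p (chk (vnat n)) ?V"
      using forces_nmem_cong_left[OF p(3) _ nX name_chk nv] by (simp add: dec_def)
    then have ex: "\<exists>m. \<exists>q\<in>P. st q p \<and> forces_nmem q (chk (vnat m)) ?V" using p(1) refl by blast
    \<comment> \<open>The least number that some extension of \<open>p\<close> forces out of
      \<open>v\<close>. The extension realizing it forces all smaller numbers into \<open>v\<close>,
      because no extension of \<open>p\<close> forces those out and membership is closed under
      density.\<close>
    define m where "m = (LEAST m. \<exists>q\<in>P. st q p \<and> forces_nmem q (chk (vnat m)) ?V)"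
    obtain q where q: "q \<in> P" "st q p" "forces_nmem q (chk (vnat m)) ?V"
      using LeastI_ex[OF ex] unfolding m_def by blast
    have "forces_mem q (chk (vnat k)) ?V" if k: "k < m" for k
    proof (rule forces_mem_dense[OF name_chk nv q(1)])
      fix r assume r: "r \<in> P" "st r q"
      have "\<not> forces_nmem r (chk (vnat k)) ?V"
        using not_less_Least[OF k[unfolded m_def]] r(1) trans[OF r(2) q(2)] by blast
      then show "\<exists>s. forces_mem s (chk (vnat k)) ?V \<and> st s r" unfolding forces_nmem_def by blast
    qed
    then show "\<exists>q\<in>P. st q p \<and> (\<exists>m. Q q m)" using q unfolding Q_def by blast
  qed
  let ?w = "\<lambda>p b. \<exists>m. b = vnat m \<and> Q p m"
  have p: "persistent (\<lambda>p. ?w p b)" for b by (intro persistent_intros persistent_Q)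
  have "large (\<lambda>p. \<exists>b. ?w p b)" by (rule large_mono[OF L3]) blast
  then obtain Y where Y: "std Y" "large (\<lambda>p. \<exists>b. ?w p b \<and> dec p Y b)" by (rule lift[OF p])
  note YW = std_W[OF Y(1)]
  have "large (\<lambda>p. forces_nmem p (rep Y) ?V)"
  proof (rule large_mono[OF Y(2)])
    fix p assume "\<exists>b. ?w p b \<and> dec p Y b"
    then obtain m where m: "forces_nmem p (chk (vnat m)) ?V" "dec p Y (vnat m)" unfolding Q_def by blast
    then show "forces_nmem p (rep Y) ?V"
      using forces_nmem_cong_left[OF m(1) forces_eq_sym[OF rep(1)[OF YW] name_chk] name_chk rep(1)[OF YW] nv]
      by (simp add: dec_def)
  qed
  then have Yv: "\<not> E Y v" using not_E_iff[OF YW v(1)] by blast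
  have "large (\<lambda>p. dec p Y (vnat 0) \<or> (\<exists>k. dec p Y (vnat (Suc k)) \<and> Q p (Suc k)))"
  proof (rule large_mono[OF Y(2)])
    fix p assume "\<exists>b. ?w p b \<and> dec p Y b"
    then obtain m where "Q p m" "dec p Y (vnat m)" by blast
    then show "dec p Y (vnat 0) \<or> (\<exists>k. dec p Y (vnat (Suc k)) \<and> Q p (Suc k))"
      by (cases m) blast+
  qed
  \<comment> \<open>By primality the glued failure \<open>Y\<close> is either zero, against the base
    clause of inductivity, or the successor of a \<open>Z\<close> that belongs to \<open>v\<close>,
    against the successor clause.\<close>
  then have "large (\<lambda>p. dec p Y (vnat 0)) \<or> large (\<lambda>p. \<exists>k. dec p Y (vnat (Suc k)) \<and> Q p (Suc k))" by (rule large_disj)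
  then show False
  proof
    assume "large (\<lambda>p. dec p Y (vnat 0))"
    then have "Y = j (mkset {})" using dec_jI[OF _ YW] by simp
    moreover obtain z where "z \<in> W" "E z v" "cm.is_empty z"
      using v(2) unfolding cm.is_inductive_def cm.members_def by blast
    ultimately show False using is_empty_iff Yv by blast
  next
    assume large: "large (\<lambda>p. \<exists>k. dec p Y (vnat (Suc k)) \<and> Q p (Suc k))"
    let ?w = "\<lambda>p b. \<exists>k. b = vnat k \<and> dec p Y (vnat (Suc k)) \<and> Q p (Suc k)"
    have p: "persistent (\<lambda>p. ?w p b)" for b by (intro persistent_intros persistent_Q YW)
    have "large (\<lambda>p. \<exists>b. ?w p b)" by (rule large_mono[OF large]) blast
    then obtain Z where Z: "std Z" "large (\<lambda>p. \<exists>b. ?w p b \<and> dec p Z b)" by (rule lift[OF p])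
    note ZW = std_W[OF Z(1)]
    have "E Z v" unfolding E_iff[OF ZW v(1)]
    proof (rule large_mono[OF Z(2)])
      fix p assume "\<exists>b. ?w p b \<and> dec p Z b"
      then obtain k where k: "forces_mem p (chk (vnat k)) ?V" "dec p Z (vnat k)" unfolding Q_def by blast
      then show "forces_mem p (rep Z) ?V"
        using forces_mem_cong_left[OF k(1) forces_eq_sym[OF rep(1)[OF ZW] name_chk] name_chk rep(1)[OF ZW] nv]
        by (simp add: dec_def)
    qed
    then obtain y where y: "y \<in> W" "E y v" "cm.is_successor Z y"
      using v(2) ZW unfolding cm.is_inductive_def cm.members_def by blast
    have "cm.is_successor Z Y"
      by (rule is_successorI[OF Z(1) Y(1)], rule large_mono[OF Z(2)]) (use elts_vnat_Suc in blast)
    then have "y = Y"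
      using y(3) by (intro W_extensionality[OF y(1) YW]) (simp add: cm.is_successor_def)
    then show False using y(2) Yv by blast
  qed
qed

lemma omega_j: "cm.is_omega (j vomega)"
  using inductive_j_vomega vomega_least unfolding cm.is_omega_def by blast

text \<open>
  \<open>S a n\<close> is the set of conditions that make \<open>n\<close> the value at \<open>a\<close> of the injection added
  generically.
\<close>

lemma countable_j:
  fixes S :: "'a \<Rightarrow> nat \<Rightarrow> 'a set"
  assumes sub: "\<And>a n. S a n \<subseteq> P"
    and down: "\<And>a n p q. p \<in> S a n \<Longrightarrow> q \<in> P \<Longrightarrow> st q p \<Longrightarrow> q \<in> S a n"
    and func: "\<And>a m n p. p \<in> S a m \<Longrightarrow> p \<in> S a n \<Longrightarrow> m = n"
    and inj: "\<And>a b n p. p \<in> S a n \<Longrightarrow> p \<in> S b n \<Longrightarrow> a = b"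
    and dense: "\<And>a p. a \<in> elts d \<Longrightarrow> p \<in> P \<Longrightarrow> \<exists>q\<in>P. st q p \<and> (\<exists>n. q \<in> S a n)"
  shows "cm.is_countable (j d)"
proof -
  \<comment> \<open>The name of the generic injection: its entries are the check names of all
    candidate pairs, each weighted by the conditions in \<open>S a n\<close>.\<close>
  define Z where "Z = (\<Union>a\<in>elts d. \<Union>x\<in>range vnat. {chk (vpair a x)})"
  define Q where "Q \<pi> = {p \<in> P. \<exists>a\<in>elts d. \<exists>n. \<pi> = chk (vpair a (vnat n)) \<and> p \<in> S a n}" for \<pi>
  have Z: "is_set Z" unfolding Z_def
    by (intro is_set_UN rangeI is_set_vnat is_set_singleton)
  have Zn: "name B \<pi>" if "\<pi> \<in> Z" for \<pi> using that by (auto simp: Z_def)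
  have QP: "Q \<pi> \<subseteq> P" for \<pi> by (auto simp: Q_def)
  let ?f = "name_of Z Q"
  define F where "F = cls ?f"
  have f: "name B ?f" by (rule name_name_of[OF Z Zn QP])
  then have FW: "F \<in> W" by (simp add: F_def)
  have E_F: "E V F \<longleftrightarrow> large (\<lambda>p. forces_mem p (rep V) ?f)" if "V \<in> W" for V
    unfolding F_def by (rule E_cls2[OF that f])
  have E_FD: "large (\<lambda>p. \<exists>a\<in>elts d. \<exists>n. dec p V (vpair a (vnat n)) \<and> p \<in> S a n)" if V: "V \<in> W" "E V F" for V
  proof -
    have "large (\<lambda>p. forces_mem p (rep V) ?f)" using V E_F by blast
    then show ?thesis
    proof (rule large_dense)
      fix p assume forces_mem: "forces_mem p (rep V) ?f"
      obtain q \<pi> where q: "q \<in> P" "st q p" "\<pi> \<in> Z" "q \<in> Q \<pi>" "forces_eq q (rep V) \<pi>"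
        by (rule forces_mem_name_ofD[OF Z Zn QP forces_mem rep(1)[OF V(1)]])
      then show "\<exists>q\<in>P. st q p \<and> (\<exists>a\<in>elts d. \<exists>n. dec q V (vpair a (vnat n)) \<and> q \<in> S a n)"
        unfolding Q_def dec_def by blast
    qed
  qed
  have E_FI: "E V F" if V: "V \<in> W" "large (\<lambda>p. \<exists>a\<in>elts d. \<exists>n. dec p V (vpair a (vnat n)) \<and> p \<in> S a n)" for V
    unfolding E_F[OF V(1)]
  proof (rule large_mono[OF V(2)])
    fix p assume "\<exists>a\<in>elts d. \<exists>n. dec p V (vpair a (vnat n)) \<and> p \<in> S a n"
    then obtain a n where *: "a \<in> elts d" "dec p V (vpair a (vnat n))" "p \<in> S a n" by blast
    show "forces_mem p (rep V) ?f"
    proof (rule forces_mem_name_ofI[OF Z Zn QP rep(1)[OF V(1)]])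
      show "chk (vpair a (vnat n)) \<in> Z" using *(1) by (auto simp: Z_def)
      show "forces_eq p (rep V) (chk (vpair a (vnat n)))" using *(2) by (simp add: dec_def)
      show "\<exists>r\<in>Q (chk (vpair a (vnat n))). st r q" if "q \<in> P" "st q p" for q
        using that * down refl unfolding Q_def by blast
    qed
  qed
  let ?D = "cm.members (j d)" and ?N = "cm.members (j vomega)"
  have D: "X \<in> ?D \<longleftrightarrow> X \<in> W \<and> large (\<lambda>p. \<exists>a\<in>elts d. dec p X a)" for X
    using E_j_iff by (auto simp: cm.members_def)
  have N: "Y \<in> ?N \<longleftrightarrow> Y \<in> W \<and> large (\<lambda>p. \<exists>n. dec p Y (vnat n))" for Y
    using E_j_vomega by (auto simp: cm.members_def)
  have std: "X \<in> ?D \<Longrightarrow> std X" "X \<in> ?N \<Longrightarrow> std X" for X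
    unfolding D N std_def by (auto elim!: large_mono)
  have maps: "cm.maps_to F X Y \<longleftrightarrow> large (\<lambda>p. \<exists>a\<in>elts d. \<exists>n. dec p X a \<and> dec p Y (vnat n) \<and> p \<in> S a n)"
    if XY: "X \<in> ?D" "Y \<in> ?N" for X Y
  proof
    note s = std(1)[OF XY(1)] std(2)[OF XY(2)]
    note w = s[THEN std_W]
    assume "cm.maps_to F X Y"
    then obtain V where V: "V \<in> W" "cm.is_pair X Y V" "E V F" unfolding cm.maps_to_def by blast
    have 1: "large (\<lambda>p. \<exists>a b. dec p X a \<and> dec p Y b \<and> dec p V (vpair a b))"
      using V is_pair_iff[OF s] by blast
    show "large (\<lambda>p. \<exists>a\<in>elts d. \<exists>n. dec p X a \<and> dec p Y (vnat n) \<and> p \<in> S a n)"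
    proof (rule large_both[OF 1 E_FD[OF V(1,3)]])
      show "persistent (\<lambda>p. \<exists>a b. dec p X a \<and> dec p Y b \<and> dec p V (vpair a b))"
        by (intro persistent_intros w V)
      fix p assume "\<exists>a b. dec p X a \<and> dec p Y b \<and> dec p V (vpair a b)"
        "\<exists>a\<in>elts d. \<exists>n. dec p V (vpair a (vnat n)) \<and> p \<in> S a n"
      then obtain a b a' n where *: "dec p X a" "dec p Y b" "dec p V (vpair a b)" "a' \<in> elts d"
        "dec p V (vpair a' (vnat n))" "p \<in> S a' n" by blast
      then have "vpair a b = vpair a' (vnat n)" using dec_unique V(1) by blast
      then show "\<exists>a\<in>elts d. \<exists>n. dec p X a \<and> dec p Y (vnat n) \<and> p \<in> S a n" using * by auto
    qed
  next
    note s = std(1)[OF XY(1)] std(2)[OF XY(2)]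
    note w = s[THEN std_W]
    assume large: "large (\<lambda>p. \<exists>a\<in>elts d. \<exists>n. dec p X a \<and> dec p Y (vnat n) \<and> p \<in> S a n)"
    obtain V where V: "std V" "cm.is_pair X Y V" "large (\<lambda>p. \<exists>a b. dec p X a \<and> dec p Y b \<and> dec p V (vpair a b))"
      by (rule pair_exists[OF s])
    have "large (\<lambda>p. \<exists>a\<in>elts d. \<exists>n. dec p V (vpair a (vnat n)) \<and> p \<in> S a n)"
    proof (rule large_both[OF V(3) large])
      show "persistent (\<lambda>p. \<exists>a b. dec p X a \<and> dec p Y b \<and> dec p V (vpair a b))"
        by (intro persistent_intros w std_W V(1))
      fix p assume "\<exists>a b. dec p X a \<and> dec p Y b \<and> dec p V (vpair a b)"
        "\<exists>a\<in>elts d. \<exists>n. dec p X a \<and> dec p Y (vnat n) \<and> p \<in> S a n"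
      then show "\<exists>a\<in>elts d. \<exists>n. dec p V (vpair a (vnat n)) \<and> p \<in> S a n"
        using dec_unique[OF _ _ w(1)] dec_unique[OF _ _ w(2)] by blast
    qed
    then show "cm.maps_to F X Y"
      using V E_FI[OF std_W[OF V(1)]] std_W[OF V(1)] unfolding cm.maps_to_def by blast
  qed
  have persistent: "persistent (\<lambda>p. \<exists>a\<in>elts d. \<exists>n. dec p X a \<and> dec p Y (vnat n) \<and> p \<in> S a n)"
    if "X \<in> W" "Y \<in> W" for X Y
    using dec_down[OF _ _ _ that(1)] dec_down[OF _ _ _ that(2)] down by (intro persI) blast
  have "cm.is_injection F (j d) (j vomega)"
    unfolding cm.is_injection_def
  proof (intro conjI ballI impI)
    fix V assume "V \<in> cm.members F"
    then have V: "V \<in> W" "E V F" by (simp_all add: cm.members_def)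
    note LV = E_FD[OF V]
    \<comment> \<open>The first coordinate of \<open>V\<close> is lifted to \<open>X\<close>; the
      second coordinate is lifted afterwards, relative to the value decided for
      \<open>X\<close>.\<close>
    let ?w = "\<lambda>p a. a \<in> elts d \<and> (\<exists>n. dec p V (vpair a (vnat n)))"
    have p: "persistent (\<lambda>p. ?w p a)" for a by (intro persistent_intros V)
    have "large (\<lambda>p. \<exists>a. ?w p a)" by (rule large_mono[OF LV]) blast
    then obtain X where X: "std X" "large (\<lambda>p. \<exists>a. ?w p a \<and> dec p X a)" by (rule lift[OF p])
    let ?u = "\<lambda>p b. \<exists>a n. b = vnat n \<and> dec p V (vpair a b) \<and> dec p X a"
    have p': "persistent (\<lambda>p. ?u p a)" for a by (intro persistent_intros V std_W X(1))
    have "large (\<lambda>p. \<exists>b. ?u p b)" by (rule large_mono[OF X(2)]) blast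
    then obtain Y where Y: "std Y" "large (\<lambda>p. \<exists>b. ?u p b \<and> dec p Y b)" by (rule lift[OF p'])
    have "X \<in> ?D" unfolding D using std_W[OF X(1)] by (auto intro: large_mono[OF X(2)])
    moreover have "Y \<in> ?N" unfolding N using std_W[OF Y(1)] by (auto intro: large_mono[OF Y(2)])
    moreover have "cm.is_pair X Y V" unfolding is_pair_iff[OF X(1) Y(1) V(1)]
      by (rule large_mono[OF Y(2)]) blast
    ultimately show "\<exists>x\<in>?D. \<exists>y\<in>?N. cm.is_pair x y V" by blast
  next
    fix X assume X: "X \<in> ?D"
    then have XW: "X \<in> W" and LX: "large (\<lambda>p. \<exists>a\<in>elts d. dec p X a)" by (simp_all add: D)
    let ?w = "\<lambda>p b. \<exists>n. b = vnat n \<and> (\<exists>a\<in>elts d. dec p X a \<and> p \<in> S a n)"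
    have p: "persistent (\<lambda>p. ?w p b)" for b
      using dec_down[OF _ _ _ XW] down by (intro persI) blast
    \<comment> \<open>Density yields totality: a condition deciding \<open>X\<close> to be
      \<open>a\<close> is extended to one that fixes the image of \<open>a\<close>.\<close>
    have "large (\<lambda>p. \<exists>b. ?w p b)"
    proof (rule large_dense[OF LX])
      fix p assume p: "p \<in> P" "\<exists>a\<in>elts d. dec p X a"
      then obtain a where a: "a \<in> elts d" "dec p X a" by blast
      then obtain q n where "q \<in> P" "st q p" "q \<in> S a n" using dense[OF a(1) p(1)] by blast
      then show "\<exists>q\<in>P. st q p \<and> (\<exists>b. ?w q b)" using a dec_down[OF a(2) _ _ XW] by blast
    qed
    then obtain Y where Y: "std Y" "large (\<lambda>p. \<exists>b. ?w p b \<and> dec p Y b)" by (rule lift[OF p])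
    have YN: "Y \<in> ?N" unfolding N using std_W[OF Y(1)] by (auto intro: large_mono[OF Y(2)])
    have "cm.maps_to F X Y" unfolding maps[OF X YN] by (rule large_mono[OF Y(2)]) blast
    moreover have "Y' = Y" if Y': "Y' \<in> ?N" "cm.maps_to F X Y'" and Y: "Y \<in> ?N" "cm.maps_to F X Y" for Y' Y
    proof -
      have w: "Y' \<in> W" "Y \<in> W" using Y Y' by (simp_all add: N)
      note large = Y'(2)[unfolded maps[OF X Y'(1)]] Y(2)[unfolded maps[OF X Y(1)]]
      have "large (\<lambda>p. \<exists>b. dec p Y' b \<and> dec p Y b)"
      proof (rule large_both[OF large persistent[OF XW w(1)]])
        fix p assume "\<exists>a\<in>elts d. \<exists>n. dec p X a \<and> dec p Y' (vnat n) \<and> p \<in> S a n"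
          "\<exists>a\<in>elts d. \<exists>n. dec p X a \<and> dec p Y (vnat n) \<and> p \<in> S a n"
        then obtain a n a' n' where *: "dec p X a" "dec p Y' (vnat n)" "p \<in> S a n"
          "dec p X a'" "dec p Y (vnat n')" "p \<in> S a' n'" by blast
        then have "a' = a" using dec_unique XW by blast
        then have "n' = n" using * func by blast
        then show "\<exists>b. dec p Y' b \<and> dec p Y b" using * by blast
      qed
      then show ?thesis using dec_eqI w by blast
    qed
    ultimately show "\<exists>!y. y \<in> ?N \<and> cm.maps_to F X y" using YN by blast
  next
    fix X X' Y assume X: "X \<in> ?D" "X' \<in> ?D" and Y: "Y \<in> ?N"
      and m: "cm.maps_to F X Y" "cm.maps_to F X' Y"
    have w: "X \<in> W" "X' \<in> W" "Y \<in> W" using X Y by (simp_all add: D N)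
    note large = m(1)[unfolded maps[OF X(1) Y]] m(2)[unfolded maps[OF X(2) Y]]
    have "large (\<lambda>p. \<exists>b. dec p X b \<and> dec p X' b)"
    proof (rule large_both[OF large persistent[OF w(1,3)]])
      fix p assume "\<exists>a\<in>elts d. \<exists>n. dec p X a \<and> dec p Y (vnat n) \<and> p \<in> S a n"
        "\<exists>a\<in>elts d. \<exists>n. dec p X' a \<and> dec p Y (vnat n) \<and> p \<in> S a n"
      then obtain a n a' n' where *: "dec p X a" "dec p Y (vnat n)" "p \<in> S a n"
        "dec p X' a'" "dec p Y (vnat n')" "p \<in> S a' n'" by blast
      then have "vnat n' = (vnat n :: 'a)" using dec_unique w(3) by blast
      then have "a' = a" using * inj by simp
      then show "\<exists>b. dec p X b \<and> dec p X' b" using * by blast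
    qed
    then show "X = X'" using dec_eqI w by blast
  qed
  then show ?thesis using omega_j FW W_j unfolding cm.is_countable_def by blast
qed

end

section \<open>Ultrafilters, cardinals and transport of structure\<close>

lemma is_set_Un: "is_set A \<Longrightarrow> is_set C \<Longrightarrow> is_set (A \<union> C)"
proof -
  assume "is_set A" "is_set C"
  then obtain x y where xy: "A = elts x" "C = elts y" by auto
  have "is_set (\<Union>z\<in>{x, y}. elts z)" by (rule is_set_UN[OF pairing]) simp
  then show ?thesis by (simp add: xy)
qed

lemma is_set_finite: "finite A \<Longrightarrow> is_set A"
proof (induction rule: finite_induct)
  case (insert x F)
  then obtain y where "F = elts y" by auto
  then show ?case using is_set_insert by simp
qed (rule is_set_empty)

section \<open>Existence of ultrafilters on the algebra\<close>

context regular_open_poset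
begin

lemma is_set_carrier: "is_set (carrier B)"
proof -
  obtain x where x: "elts x = P" using small by auto
  have "elts a \<subseteq> elts x" if "a \<in> carrier B" for a
    using roD[of "elts a"] that by (simp add: car x)
  then have "carrier B \<subseteq> {a. elts a \<subseteq> elts x}" by blast
  then show ?thesis by (rule is_set_subset[OF powerset])
qed

definition proper_filter :: "'v set \<Rightarrow> bool" where
  "proper_filter F \<longleftrightarrow> F \<subseteq> carrier B \<and> top B \<in> F \<and> bottom B \<notin> F \<and>
     (\<forall>a\<in>F. \<forall>b\<in>carrier B. elts a \<subseteq> elts b \<longrightarrow> b \<in> F) \<and> (\<forall>a\<in>F. \<forall>b\<in>F. meet B a b \<in> F)"

lemma proper_filterD:
  assumes "proper_filter F"
  shows "F \<subseteq> carrier B" "top B \<in> F" "bottom B \<notin> F"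
    "a \<in> F \<Longrightarrow> b \<in> carrier B \<Longrightarrow> elts a \<subseteq> elts b \<Longrightarrow> b \<in> F"
    "a \<in> F \<Longrightarrow> b \<in> F \<Longrightarrow> meet B a b \<in> F"
  using assms unfolding proper_filter_def by blast+

lemma elts_meet: "a \<in> carrier B \<Longrightarrow> b \<in> carrier B \<Longrightarrow> elts (meet B a b) = elts a \<inter> elts b"
  by (rule meet) (simp_all add: car)

lemma proper_filter_Union:
  assumes C: "C \<noteq> {}" "subset.chain (Collect proper_filter) C"
  shows "proper_filter (\<Union>C)"
proof -
  have pf: "proper_filter F" if "F \<in> C" for F using C(2) that by (auto simp: subset_chain_def)
  have lin: "F \<subseteq> G \<or> G \<subseteq> F" if "F \<in> C" "G \<in> C" for F G
    using C(2) that unfolding subset_chain_def by blast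
  show ?thesis unfolding proper_filter_def
  proof (intro conjI ballI impI)
    show "\<Union>C \<subseteq> carrier B" "top B \<in> \<Union>C" "bottom B \<notin> \<Union>C"
      using pf[THEN proper_filterD(1)] pf[THEN proper_filterD(2)] pf[THEN proper_filterD(3)] C(1) by blast+
    show "b \<in> \<Union>C" if "a \<in> \<Union>C" "b \<in> carrier B" "elts a \<subseteq> elts b" for a b
      using that pf[THEN proper_filterD(4)] by blast
    fix a b assume "a \<in> \<Union>C" "b \<in> \<Union>C"
    then obtain F G where "a \<in> F" "F \<in> C" "b \<in> G" "G \<in> C" by blast
    then obtain H where "a \<in> H" "b \<in> H" "H \<in> C" using lin[of F G] by blast
    then show "meet B a b \<in> \<Union>C" using pf[THEN proper_filterD(5)] by blast
  qed
qed

text \<open>A maximal proper filter, by Zorn. If it omits \<open>a\<close>, adjoining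
  \<open>a\<close> must produce bottom, so some member \<open>m\<close> is disjoint from
  \<open>a\<close> and hence lies below its complement. A nonempty poset keeps top and bottom apart,
  which starts the construction.\<close>

lemma ultrafilter_exists:
  assumes "P \<noteq> {}" shows "\<exists>U. ultrafilter_on B U"
proof -
  have "top B \<noteq> bottom B" using top bot assms by metis
  moreover have "b = top B" if "b \<in> carrier B" "elts (top B) \<subseteq> elts b" for b
    using that roD[of "elts b"] by (intro extensionality) (simp add: car top subset_antisym)
  moreover have "meet B (top B) (top B) = top B" by (rule extensionality) (simp add: elts_meet)
  ultimately have "proper_filter {top B}" unfolding proper_filter_def by auto
  then obtain F where F: "proper_filter F" and max: "\<And>G. proper_filter G \<Longrightarrow> F \<subseteq> G \<Longrightarrow> G = F"
    using subset_Zorn_nonempty[of "Collect proper_filter"] proper_filter_Union by auto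
  note FD = proper_filterD[OF F]
  have "bcompl B a \<in> F" if a: "a \<in> carrier B" "a \<notin> F" for a
  proof -
    let ?G = "{b \<in> carrier B. \<exists>m\<in>F. elts m \<inter> elts a \<subseteq> elts b}"
    have sub: "F \<subseteq> ?G" using FD(1) by blast
    have "top B \<in> ?G" using sub FD(2) by blast
    moreover have "a \<in> ?G" using a FD(2) by blast
    then have "?G \<noteq> F" using a(2) by blast
    then have "\<not> proper_filter ?G" using max sub by blast
    moreover have "meet B b c \<in> ?G" if bc: "b \<in> ?G" "c \<in> ?G" for b c
    proof -
      obtain m n where mn: "m \<in> F" "n \<in> F" "elts m \<inter> elts a \<subseteq> elts b" "elts n \<inter> elts a \<subseteq> elts c"
        using bc by blast
      have "elts (meet B m n) = elts m \<inter> elts n" "elts (meet B b c) = elts b \<inter> elts c"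
        using mn bc FD(1) by (auto intro!: elts_meet)
      then have "elts (meet B m n) \<inter> elts a \<subseteq> elts (meet B b c)" using mn by blast
      moreover have "meet B b c \<in> carrier B" using bc by simp
      ultimately show ?thesis using FD(5)[OF mn(1,2)] by blast
    qed
    ultimately have "bottom B \<in> ?G" unfolding proper_filter_def by blast
    then obtain m where m: "m \<in> F" "elts m \<inter> elts a = {}" by (auto simp: bot)
    have r: "ro (elts m)" using m FD(1) car by blast
    have "elts m \<subseteq> elts (bcompl B a)"
      using m(2) ro_down[OF r] roD[OF r] by (auto simp: elts_bcompl[OF a(1)])
    then show ?thesis using FD(4)[OF m(1) bcompl_props(1)[OF a(1)]] by blast
  qed
  then have "ultrafilter_on B F"
    using FD unfolding ultrafilter_on_def by (auto simp: le)
  then show ?thesis by blast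
qed

end

section \<open>Cardinals in bijection with a given set\<close>

lemma ordinal_mem: "ordinal \<alpha> \<Longrightarrow> \<beta> \<in> elts \<alpha> \<Longrightarrow> ordinal \<beta>"
  unfolding ordinal_def transitive_set_def by blast

text \<open>A transitive collapse: an element goes to the set of images of its predecessors within
  \<open>D\<close>. The well-order is one of the whole type; cutting predecessors down to
  \<open>D\<close> keeps the images sets.\<close>

lemma ordinal_bij_exists:
  assumes D: "is_set (D :: 'v::zfc_universe set)"
  shows "\<exists>(\<alpha> :: 'v) h. ordinal \<alpha> \<and> bij_betw h D (elts \<alpha>)"
proof -
  obtain r :: "'v rel" where r: "Well_order r" "Field r = UNIV"
    using well_ordering[where 'a='v] by blast
  define s where "s = r - Id"
  have o: "wf (r - Id)" "total_on UNIV r" "trans r" "antisym r"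
    using r unfolding well_order_on_def linear_order_on_def partial_order_on_def preorder_on_def by simp_all
  have wf: "wf s" and trans: "trans s" unfolding s_def using o(1) trans_diff_Id[OF o(3,4)] by blast+
  have tot: "(x, y) \<in> s \<or> (y, x) \<in> s" if "x \<noteq> y" for x y
    using o(2) that by (auto simp: s_def total_on_def)
  define rk :: "'v \<Rightarrow> 'v" where "rk = wfrec s (\<lambda>f a. mkset (f ` {b \<in> D. (b, a) \<in> s}))"
  have small: "is_set (rk ` {b \<in> D. (b, a) \<in> s})" for a
    by (rule is_set_image[OF is_set_subset[OF D]]) blast
  have "rk a = mkset (rk ` {b \<in> D. (b, a) \<in> s})" for a
  proof -
    have "rk a = mkset (cut rk s a ` {b \<in> D. (b, a) \<in> s})"
      unfolding rk_def by (subst wfrec[OF wf]) (rule HOL.refl)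
    also have "cut rk s a ` {b \<in> D. (b, a) \<in> s} = rk ` {b \<in> D. (b, a) \<in> s}"
      by (intro image_cong) (auto simp: cut_apply)
    finally show ?thesis .
  qed
  then have elts_rk: "elts (rk a) = rk ` {b \<in> D. (b, a) \<in> s}" for a
    using elts_mkset[OF small] by metis
  have tr: "transitive_set (rk a)" for a
    unfolding transitive_set_def elts_rk using transD[OF trans] by (auto simp: elts_rk)
  define \<alpha> where "\<alpha> = mkset (rk ` D)"
  have \<alpha>: "elts \<alpha> = rk ` D" unfolding \<alpha>_def by (rule elts_mkset[OF is_set_image[OF D]])
  have "ordinal \<alpha>" unfolding ordinal_def transitive_set_def[of \<alpha>] \<alpha> using tr by (auto simp: elts_rk)
  moreover have "inj_on rk D"
  proof (rule inj_onI, rule ccontr)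
    fix a b assume ab: "a \<in> D" "b \<in> D" "rk a = rk b" "a \<noteq> b"
    then have "rk a \<in> elts (rk b) \<or> rk b \<in> elts (rk a)" using tot elts_rk by blast
    then show False using ab(3) not_mem_self by metis
  qed
  then have "bij_betw rk D (elts \<alpha>)" by (simp add: bij_betw_def \<alpha>)
  ultimately show ?thesis by blast
qed

text \<open>Among the ordinals in bijection with \<open>D\<close>, one that is minimal for
  membership is a cardinal: its elements are ordinals again, so none of them is in bijection with
  it.\<close>

lemma cardinal_bij_exists:
  assumes D: "is_set (D :: 'v::zfc_universe set)"
  shows "\<exists>(\<kappa> :: 'v) h. cardinal \<kappa> \<and> bij_betw h D (elts \<kappa>)"
proof -
  let ?Q = "\<lambda>\<beta> :: 'v. ordinal \<beta> \<and> (\<exists>h. bij_betw h D (elts \<beta>))"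
  obtain \<alpha> where "?Q \<alpha>" using ordinal_bij_exists[OF D] by blast
  moreover have "\<not> ?Q \<alpha>" if "\<not> (\<exists>\<kappa>. ?Q \<kappa> \<and> (\<forall>\<beta>\<in>elts \<kappa>. \<not> ?Q \<beta>))" for \<alpha>
    by (induction \<alpha> rule: elts_induct) (use that in blast)
  ultimately obtain \<kappa> where \<kappa>: "?Q \<kappa>" "\<forall>\<beta>\<in>elts \<kappa>. \<not> ?Q \<beta>" by blast
  have "\<nexists>f. bij_betw f (elts \<beta>) (elts \<kappa>)" if \<beta>: "\<beta> \<in> elts \<kappa>" for \<beta>
  proof
    assume "\<exists>f. bij_betw f (elts \<beta>) (elts \<kappa>)"
    then obtain f h where "bij_betw f (elts \<beta>) (elts \<kappa>)" "bij_betw h D (elts \<kappa>)" using \<kappa> by blast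
    then have "\<exists>h. bij_betw h D (elts \<beta>)" by (blast intro: bij_betw_trans bij_betw_inv_into)
    then show False using \<kappa> \<beta> ordinal_mem by blast
  qed
  then have "cardinal \<kappa>" using \<kappa>(1) by (simp add: cardinal_def)
  then show ?thesis using \<kappa> by blast
qed

section \<open>Density in the collapse\<close>

lemma collapse_conditionsI:
  assumes "finite A" "\<And>z. z \<in> A \<Longrightarrow> \<exists>n. \<exists>\<alpha>\<in>elts \<kappa>. z = vpair (vnat n) \<alpha>"
    "\<And>x \<alpha> \<beta>. vpair x \<alpha> \<in> A \<Longrightarrow> vpair x \<beta> \<in> A \<Longrightarrow> \<alpha> = \<beta>"
  shows "mkset A \<in> collapse_conditions \<kappa>"
  using assms unfolding collapse_conditions_def by (simp add: elts_mkset[OF is_set_finite])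

text \<open>Filling the gaps of \<open>p\<close> below some \<open>N\<close> outside its domain with the value \<open>\<gamma>\<close> makes \<open>\<gamma>\<close> occur
  and decides its first occurrence.\<close>

lemma collapse_dense:
  assumes p: "p \<in> collapse_conditions \<kappa>" and \<gamma>: "\<gamma> \<in> elts \<kappa>"
  shows "\<exists>q\<in>collapse_conditions \<kappa>. elts p \<subseteq> elts q \<and>
    (\<exists>n. vpair (vnat n) \<gamma> \<in> elts q \<and> (\<forall>m<n. \<exists>\<beta>. \<beta> \<noteq> \<gamma> \<and> vpair (vnat m) \<beta> \<in> elts q))"
proof -
  have fin: "finite (elts p)" and form: "\<And>z. z \<in> elts p \<Longrightarrow> \<exists>n. \<exists>\<alpha>\<in>elts \<kappa>. z = vpair (vnat n) \<alpha>"
    and func: "\<And>x \<alpha> \<beta>. vpair x \<alpha> \<in> elts p \<Longrightarrow> vpair x \<beta> \<in> elts p \<Longrightarrow> \<alpha> = \<beta>"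
    using p unfolding collapse_conditions_def by blast+
  define dm where "dm = {n. \<exists>\<beta>. vpair (vnat n) \<beta> \<in> elts p}"
  have "dm \<subseteq> (\<lambda>z. THE n. \<exists>\<beta>. z = vpair (vnat n) \<beta>) ` elts p"
  proof
    fix n assume "n \<in> dm"
    then obtain \<beta> where b: "vpair (vnat n) \<beta> \<in> elts p" by (auto simp: dm_def)
    have "(THE k. \<exists>\<beta>'. vpair (vnat n) \<beta> = vpair (vnat k) \<beta>') = n" by (rule the_equality) auto
    then show "n \<in> (\<lambda>z. THE n. \<exists>\<beta>. z = vpair (vnat n) \<beta>) ` elts p"
      by (intro image_eqI[OF _ b]) (rule sym)
  qed
  then have "finite dm" using fin finite_surj by blast
  then obtain N where N: "N \<notin> dm" using ex_new_if_finite infinite_UNIV_nat by blast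
  \<comment> \<open>The interval includes \<open>N\<close>, which is outside the domain of
    \<open>p\<close>, so \<open>\<gamma>\<close> is certain to occur. It may also occur earlier,
    possibly already in \<open>p\<close>, which is why the least occurrence is taken below.\<close>
  define A where "A = elts p \<union> (\<lambda>m. vpair (vnat m) \<gamma>) ` ({..N} - dm)"
  have q: "mkset A \<in> collapse_conditions \<kappa>"
  proof (rule collapse_conditionsI)
    show "finite A" by (simp add: A_def fin)
    show "\<exists>n. \<exists>\<alpha>\<in>elts \<kappa>. z = vpair (vnat n) \<alpha>" if "z \<in> A" for z
      using that form \<gamma> by (auto simp: A_def)
    show "\<alpha> = \<beta>" if "vpair x \<alpha> \<in> A" "vpair x \<beta> \<in> A" for x \<alpha> \<beta>
      using that func by (auto simp: A_def dm_def)
  qed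
  have eA: "elts (mkset A) = A" using fin by (intro elts_mkset is_set_finite) (simp add: A_def)
  have tot: "\<exists>\<beta>. vpair (vnat m) \<beta> \<in> A" if "m \<le> N" for m
    using that by (auto simp: A_def dm_def)
  have ex: "vpair (vnat N) \<gamma> \<in> A" using N by (auto simp: A_def)
  define n where "n = (LEAST n. vpair (vnat n) \<gamma> \<in> A)"
  have n: "vpair (vnat n) \<gamma> \<in> A" "n \<le> N" using ex unfolding n_def by (auto intro: LeastI Least_le)
  moreover have "\<exists>\<beta>. \<beta> \<noteq> \<gamma> \<and> vpair (vnat m) \<beta> \<in> A" if "m < n" for m
  proof -
    have "vpair (vnat m) \<gamma> \<notin> A" using not_less_Least that unfolding n_def by blast
    \<comment> \<open>All places up to \<open>N\<close> are filled, so the place \<open>m\<close>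
      before the first occurrence of \<open>\<gamma>\<close> carries some value, necessarily a
      different one.\<close>
    then show ?thesis using tot[of m] n(2) that by (metis less_imp_le order.trans)
  qed
  moreover have "elts p \<subseteq> A" by (simp add: A_def)
  ultimately show ?thesis by (intro bexI[OF _ q], unfold eA) blast
qed

section \<open>Transport of a structure along an injection\<close>

definition transport :: "('a \<Rightarrow> 'b) \<Rightarrow> 'a struct \<Rightarrow> 'b struct" where
  "transport g M =
     (let h = inv_into (domain M) g in
      \<lparr> domain = g ` domain M, Fun = (\<lambda>i xs. g (Fun M i (map h xs))), Rel = (\<lambda>i xs. Rel M i (map h xs)) \<rparr>)"

context
  fixes L :: language and M :: "'a struct" and g :: "'a \<Rightarrow> 'b"
  assumes M: "is_structure L M" and g: "inj_on g (domain M)"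
begin

lemma transport_simps:
  "domain (transport g M) = g ` domain M"
  "set xs \<subseteq> domain M \<Longrightarrow> Fun (transport g M) i (map g xs) = g (Fun M i xs)"
  "set xs \<subseteq> domain M \<Longrightarrow> Rel (transport g M) i (map g xs) = Rel M i xs"
proof -
  have "map (inv_into (domain M) g \<circ> g) xs = xs" if "set xs \<subseteq> domain M"
    using that g by (intro map_idI) (auto simp: subset_iff)
  then show "domain (transport g M) = g ` domain M"
    "set xs \<subseteq> domain M \<Longrightarrow> Fun (transport g M) i (map g xs) = g (Fun M i xs)"
    "set xs \<subseteq> domain M \<Longrightarrow> Rel (transport g M) i (map g xs) = Rel M i xs"
    by (simp_all add: transport_def Let_def)
qed

lemma tuples_image: "tuples (g ` domain M) n = map g ` tuples (domain M) n"
proof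
  show "tuples (g ` domain M) n \<subseteq> map g ` tuples (domain M) n"
  proof
    fix ys assume ys: "ys \<in> tuples (g ` domain M) n"
    then have "ys \<in> lists (g ` domain M)" by (auto simp: tuples_def)
    then obtain xs where "ys = map g xs" "set xs \<subseteq> domain M" by (auto simp: lists_image)
    then show "ys \<in> map g ` tuples (domain M) n" using ys by (auto simp: tuples_def)
  qed
qed (force simp: tuples_def)

lemma Fun_closed: "i < length (fun_arities L) \<Longrightarrow> xs \<in> tuples (domain M) (fun_arities L ! i) \<Longrightarrow> Fun M i xs \<in> domain M"
  using M by (auto simp: is_structure_def)

lemma is_structure_transport: "is_structure L (transport g M)"
  using M Fun_closed by (auto simp: is_structure_def transport_simps tuples_image) (auto simp: tuples_def transport_simps)

lemma isomorphic_transport: "isomorphic L (transport g M) M"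
proof -
  let ?h = "inv_into (domain M) g"
  have h: "map ?h (map g xs) = xs" if "set xs \<subseteq> domain M" for xs
    using that g by (simp add: map_idI subset_iff)
  have "bij_betw ?h (g ` domain M) (domain M)"
    using g by (intro bij_betw_inv_into) (simp add: bij_betw_def)
  moreover have "?h (Fun (transport g M) i (map g xs)) = Fun M i (map ?h (map g xs))"
    if "i < length (fun_arities L)" "xs \<in> tuples (domain M) (fun_arities L ! i)" for i xs
  proof -
    have "set xs \<subseteq> domain M" using that by (simp add: tuples_def)
    then show ?thesis using Fun_closed[OF that] g by (simp only: transport_simps h inv_into_f_f)
  qed
  moreover have "Rel (transport g M) i (map g xs) = Rel M i (map ?h (map g xs))"
    if "xs \<in> tuples (domain M) n" for i n xs
    using that by (simp only: transport_simps h tuples_def mem_Collect_eq)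
  ultimately show ?thesis unfolding isomorphic_def
    by (intro exI[of _ ?h]) (simp add: transport_simps(1) tuples_image)
qed

lemma tm_val_transport:
  assumes "wf_tm L t" "range e \<subseteq> domain M"
  shows "tm_val M e t \<in> domain M \<and> tm_val (transport g M) (\<lambda>i. g (e i)) t = g (tm_val M e t)"
  using assms(1)
proof (induction t)
  case (Var n)
  then show ?case using assms(2) by auto
next
  case (App i ts)
  then have IH: "\<forall>t\<in>set ts. tm_val M e t \<in> domain M \<and> tm_val (transport g M) (\<lambda>i. g (e i)) t = g (tm_val M e t)"
    by auto
  let ?xs = "map (tm_val M e) ts"
  have xs: "set ?xs \<subseteq> domain M" "?xs \<in> tuples (domain M) (fun_arities L ! i)"
    using IH App.prems by (auto simp: tuples_def)
  have "map (tm_val (transport g M) (\<lambda>i. g (e i))) ts = map g ?xs" using IH by simp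
  then have "tm_val (transport g M) (\<lambda>i. g (e i)) (App i ts) = g (Fun M i ?xs)"
    by (simp only: tm_val.simps transport_simps(2)[OF xs(1)])
  then show ?case using Fun_closed[OF _ xs(2)] App.prems by simp
qed

lemma sat_transport:
  assumes "wf_fm L \<phi>" "range e \<subseteq> domain M"
  shows "sat (transport g M) (\<lambda>i. g (e i)) \<phi> \<longleftrightarrow> sat M e \<phi>"
  using assms
proof (induction \<phi> arbitrary: e)
  case (Eq s t)
  then show ?case using tm_val_transport[of _ e] g by (simp add: inj_on_eq_iff)
next
  case (Atom i ts)
  let ?xs = "map (tm_val M e) ts"
  have t: "\<forall>t\<in>set ts. tm_val M e t \<in> domain M \<and> tm_val (transport g M) (\<lambda>i. g (e i)) t = g (tm_val M e t)"
    using Atom tm_val_transport[of _ e] by auto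
  then have "map (tm_val (transport g M) (\<lambda>i. g (e i))) ts = map g ?xs" "set ?xs \<subseteq> domain M" by auto
  then show ?case by (simp only: sat.simps transport_simps(3))
next
  case (Exists n \<phi>)
  have "sat (transport g M) ((\<lambda>i. g (e i))(n := g a)) \<phi> \<longleftrightarrow> sat M (e(n := a)) \<phi>" if "a \<in> domain M" for a
  proof -
    have "(\<lambda>i. g (e i))(n := g a) = (\<lambda>i. g ((e(n := a)) i))" by auto
    moreover have "sat (transport g M) (\<lambda>i. g ((e(n := a)) i)) \<phi> \<longleftrightarrow> sat M (e(n := a)) \<phi>"
      using Exists.prems that by (intro Exists.IH) auto
    ultimately show ?thesis by (simp only:)
  qed
  then show ?case by (simp add: transport_simps(1))
qed auto

end

section \<open>Moving the ultrapower into the universe\<close>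

context boolean_ultrapower
begin

lemma is_structure_Ext: "is_structure Lg Ext"
proof -
  have "j (SOME a. a \<in> D) \<in> DD" by (rule j_DD[OF some_D])
  then show ?thesis unfolding is_structure_def using Fun_Ext(1) by auto
qed

text \<open>An element of the quotient is a class of names and need not be a set. For members of
  \<open>DD\<close> the relation between conditions and decided values is a faithful substitute, and
  it is included in a fixed set of pairs.\<close>

definition code :: "'a set \<Rightarrow> 'a" where
  "code X = mkset {z. \<exists>p\<in>P. \<exists>a\<in>D. z = vpair p a \<and> dec p X a}"

lemma is_set_pairs: "is_set (\<Union>p\<in>P. vpair p ` D)"
  by (rule is_set_UN[OF small]) (rule is_set_image[OF set_D])

lemma elts_code: "elts (code X) = {z. \<exists>p\<in>P. \<exists>a\<in>D. z = vpair p a \<and> dec p X a}"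
  unfolding code_def by (rule elts_mkset[OF is_set_subset[OF is_set_pairs]]) blast

lemma is_set_range_code: "is_set (range code)"
proof -
  obtain x where x: "elts x = (\<Union>p\<in>P. vpair p ` D)" using is_set_pairs by (metis imageE)
  have "range code \<subseteq> {y. elts y \<subseteq> elts x}" unfolding x elts_code image_subset_iff mem_Collect_eq by blast
  then show ?thesis by (rule is_set_subset[OF powerset])
qed

text \<open>A member of \<open>DD\<close> is decided on a large set of conditions; equal codes give
  both elements the same value there, which suffices by \<open>dec_eqI\<close>.\<close>

lemma code_inj:
  assumes "X \<in> DD" "Y \<in> DD" "code X = code Y" shows "X = Y"
proof (rule dec_eqI[OF DD_W DD_W])
  have eq: "dec p X a \<longleftrightarrow> dec p Y a" if "p \<in> P" "a \<in> D" for p a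
  proof -
    have "vpair p a \<in> elts (code X) \<longleftrightarrow> vpair p a \<in> elts (code Y)" using assms(3) by simp
    then show ?thesis using that by (simp add: elts_code)
  qed
  have "large (\<lambda>p. \<exists>a\<in>D. dec p X a)" using assms(1) by (simp add: DD_iff)
  then show "large (\<lambda>p. \<exists>a. dec p X a \<and> dec p Y a)" by (rule large_mono) (use eq in blast)
qed fact+

text \<open>Sending \<open>j a\<close> back to \<open>a\<close> makes \<open>M\<close> a literal
  substructure and not just an isomorphic copy; the remaining elements receive labels outside the
  domain, formed from their codes.\<close>

lemma relocation_exists:
  obtains g where "inj_on g DD" "\<And>a. a \<in> D \<Longrightarrow> g (j a) = a" "is_set (g ` DD)"
proof
  define g where "g X = (if X \<in> j ` D then inv_into D j X else vpair d (code X))" for X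
  have inj_j: "inj_on j D" by (rule inj_onI) simp
  show gj: "g (j a) = a" if "a \<in> D" for a using that inj_j by (simp add: g_def)
  \<comment> \<open>The tag \<open>d\<close> is the set with elements \<open>D\<close>; if a pair
    built from \<open>d\<close> belonged to \<open>D\<close>, then \<open>d\<close> would precede
    itself in the transitive closure of membership, against foundation.\<close>
  have fresh: "vpair d c \<notin> D" for c
  proof
    assume "vpair d c \<in> D"
    then have "(d, d) \<in> {(x, y). x \<in> elts y}\<^sup>+" using mem_trancl_vpair[of d c d] d by simp
    then show False using wf_not_refl[OF wf_trancl[OF foundation]] by blast
  qed
  have g': "g X = vpair d (code X)" if "X \<notin> j ` D" for X using that by (simp add: g_def)
  show "inj_on g DD"
  proof (rule inj_onI)
    fix X Y assume XY: "X \<in> DD" "Y \<in> DD" "g X = g Y"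
    show "X = Y"
    proof (cases "X \<in> j ` D"; cases "Y \<in> j ` D")
      assume "X \<notin> j ` D" "Y \<notin> j ` D"
      then show ?thesis using XY code_inj by (simp add: g')
    qed (use XY(3) fresh in \<open>auto simp: gj g'\<close>)
  qed
  have "g X \<in> D \<union> vpair d ` range code" for X
    using gj g'[of X] by (cases "X \<in> j ` D") auto
  then have "g ` DD \<subseteq> D \<union> vpair d ` range code" by blast
  then show "is_set (g ` DD)"
    by (rule is_set_subset[OF is_set_Un[OF set_D is_set_image[OF is_set_range_code]]])
qed

end

theorem theorem3:
  fixes L :: language and M :: "'v::zfc_universe struct"
  assumes "is_structure L M" and "is_set (domain M)"
  shows "\<exists>N :: 'v struct. is_structure L N \<and> is_set (domain N) \<and>
           elementary_extension L M N \<and> pseudo_countable L N"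
proof -
  obtain d where d: "elts d = domain M" using assms(2) by (metis imageE)
  obtain \<kappa> :: 'v and h where \<kappa>: "cardinal \<kappa>" and h: "bij_betw h (domain M) (elts \<kappa>)"
    using cardinal_bij_exists[OF assms(2)] by blast
  let ?P = "collapse_conditions \<kappa>" and ?st = "\<lambda>q p :: 'v. elts p \<subseteq> elts q"
  interpret R: regular_open_poset ?P ?st
    by unfold_locales (auto simp: is_set_collapse_conditions)
  \<comment> \<open>The empty condition makes the poset nonempty, as the existence of an ultrafilter
    requires.\<close>
  have "mkset {} \<in> ?P" by (rule collapse_conditionsI) auto
  then obtain U where U: "ultrafilter_on R.B U" using R.ultrafilter_exists by blast
  then have "U \<subseteq> carrier R.B" by (simp add: ultrafilter_on_def)
  \<comment> \<open>\<open>pseudo_countable\<close> asks for the ultrafilter as an element of the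
    universe; it is a set because the carrier of the algebra is one.\<close>
  then obtain u where u: "elts u = U" using is_set_subset[OF R.is_set_carrier] by (metis imageE)
  interpret boolean_ultrapower ?P ?st U L M d
    using U assms(1) d by unfold_locales
  obtain g where g: "inj_on g DD" "\<And>a. a \<in> domain M \<Longrightarrow> g (j a) = a" "is_set (g ` DD)"
    by (rule relocation_exists) blast
  have g': "inj_on g (domain Ext)" using g(1) by simp
  note tr = is_structure_Ext g'
  let ?N = "transport g Ext"
  have gj: "map g (map j as) = as" if "set as \<subseteq> domain M" for as
    using that g(2) by (simp add: map_idI subset_iff)
  have jD: "set (map j as) \<subseteq> domain Ext" if "set as \<subseteq> domain M" for as
    using that j_DD by auto
  have "substructure L M ?N"
    unfolding substructure_def
  proof (intro conjI allI impI ballI)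
    show "domain M \<subseteq> domain ?N"
    proof
      fix a assume a: "a \<in> domain M"
      have "j a \<in> domain Ext" using j_DD[OF a] by simp
      then have "g (j a) \<in> g ` domain Ext" by (rule imageI)
      then show "a \<in> domain ?N" by (simp only: transport_simps(1)[OF tr] g(2)[OF a])
    qed
    fix i as
    {
      assume i: "i < length (fun_arities L)" and as: "as \<in> tuples (domain M) (fun_arities L ! i)"
      have s: "set as \<subseteq> domain M" using as by (simp add: tuples_def)
      have "Fun ?N i (map g (map j as)) = g (Fun Ext i (map j as))"
        by (rule transport_simps(2)[OF tr jD[OF s]])
      then show "Fun M i as = Fun ?N i as"
        using g(2)[OF Fun_D[OF i as]] by (simp only: gj[OF s] Fun_Ext_j[OF i as])
    }
    assume i: "i < length (rel_arities L)" and as: "as \<in> tuples (domain M) (rel_arities L ! i)"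
    have s: "set as \<subseteq> domain M" using as by (simp add: tuples_def)
    have "Rel ?N i (map g (map j as)) = Rel Ext i (map j as)"
      by (rule transport_simps(3)[OF tr jD[OF s]])
    then show "Rel M i as = Rel ?N i as" by (simp only: gj[OF s] Rel_Ext_j[OF i as])
  qed
  moreover have "sat M e \<phi> \<longleftrightarrow> sat ?N e \<phi>" if "wf_fm L \<phi>" "range e \<subseteq> domain M" for e \<phi>
  proof -
    have e: "(\<lambda>i. g (j (e i))) = e" using that(2) g(2) by auto
    have "range (\<lambda>i. j (e i)) \<subseteq> domain Ext" using that(2) j_DD by auto
    from sat_transport[OF tr that(1) this] j_elementary[OF that] show ?thesis by (simp add: e)
  qed
  ultimately have "elementary_extension L M ?N" by (simp add: elementary_extension_def)
  moreover have "pseudo_countable L ?N"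
  proof -
    obtain x where x: "cm.is_internal_structure L x (j d) Fs Rs" using internal_structure by blast
    \<comment> \<open>The condition makes \<open>n\<close> the first place where the generic
      function takes the value \<open>h a\<close>: it has that value at \<open>n\<close> and another
      value at every earlier place. Requiring \<open>a\<close> in the domain of \<open>M\<close>
      matters for injectivity, since \<open>h\<close> is a bijection on that domain.\<close>
    define S where "S a n = {p \<in> ?P. a \<in> domain M \<and> vpair (vnat n) (h a) \<in> elts p \<and>
      (\<forall>m<n. \<exists>\<beta>. \<beta> \<noteq> h a \<and> vpair (vnat m) \<beta> \<in> elts p)}" for a n
    have func: "\<alpha> = \<beta>" if "p \<in> ?P" "vpair x \<alpha> \<in> elts p" "vpair x \<beta> \<in> elts p" for p x \<alpha> \<beta>
      using that unfolding collapse_conditions_def by blast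
    have le: "n \<le> m" if pS: "p \<in> S a m" "p \<in> S a n" for p a m n
    \<comment> \<open>If \<open>m\<close> were smaller than \<open>n\<close>, the place
      \<open>m\<close> would carry both \<open>h a\<close> and, being before \<open>n\<close>, a
      different value.\<close>
    proof (rule ccontr)
      assume "\<not> n \<le> m"
      then have "m < n" by simp
      then obtain \<beta> where "\<beta> \<noteq> h a" "vpair (vnat m) \<beta> \<in> elts p" using pS(2) unfolding S_def by blast
      moreover have "p \<in> ?P" "vpair (vnat m) (h a) \<in> elts p" using pS(1) by (auto simp: S_def)
      ultimately show False using func by blast
    qed
    have "cm.is_countable (j d)"
    proof (rule countable_j[of S])
      show "m = n" if "p \<in> S a m" "p \<in> S a n" for a m n p
        using le[OF that] le[OF that(2,1)] by simp
      show "a = b" if "p \<in> S a n" "p \<in> S b n" for a b n p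
      proof -
        have p: "p \<in> ?P" "vpair (vnat n) (h a) \<in> elts p" "vpair (vnat n) (h b) \<in> elts p"
          and ab: "a \<in> domain M" "b \<in> domain M" using that by (auto simp: S_def)
        have "h a = h b" by (rule func[OF p])
        then show ?thesis using ab h by (auto simp: bij_betw_def inj_on_def)
      qed
      show "\<exists>q\<in>?P. elts p \<subseteq> elts q \<and> (\<exists>n. q \<in> S a n)" if "a \<in> elts d" "p \<in> ?P" for a p
      proof -
        have a: "a \<in> domain M" "h a \<in> elts \<kappa>" using that(1) d h by (auto simp: bij_betw_def)
        show ?thesis using collapse_dense[OF that(2) a(2)] a(1) unfolding S_def by blast
      qed
    qed (unfold S_def, blast+)
    moreover have "isomorphic L ?N (cm.external_structure (j d) Fs Rs)"
      using isomorphic_transport[OF tr] by (simp only: Ext_def)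
    moreover have "W = quotient_universe (collapse_algebra \<kappa>) (elts u)"
      "E = quotient_mem (collapse_algebra \<kappa>) (elts u)"
      by (simp_all add: W_def E_def collapse_algebra_def u)
    moreover have "ultrafilter_on (collapse_algebra \<kappa>) (elts u)"
      using U by (simp add: u collapse_algebra_def)
    ultimately show ?thesis
      using \<kappa> x unfolding pseudo_countable_def Let_def by metis
  qed
  moreover have "is_structure L ?N" by (rule is_structure_transport[OF tr])
  moreover have "is_set (domain ?N)" using g(3) by (simp add: transport_simps(1)[OF tr])
  ultimately show ?thesis by blast
qed

end
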